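(* For every $\varphi\in\mathscr S$, the function $(\alpha,\vartheta)\mapsto\int_{\mathbb{R}}\varphi(E)\,d\mathcal V_{\alpha,\vartheta}(E)$ is infinitely differentiable on the domain $Q=\{(\alpha,\vartheta)\in\mathbb{R}^2:\alpha<1\}$.
   Context: $\mathscr S$ is the Schwartz space of rapidly decreasing smooth complex functions on $\mathbb{R}$. Spectral measures $\mathcal V_{\alpha,\vartheta}$. Let $\mathrm{Sinc}\,\zeta=\sum_{k\ge0}\frac{(-\zeta)^k}{(2k+1)!}$ (entire). Let $\mathbb{C}_{3\pi/2}$ be $\mathbb{C}$ with the ray $\{-it:t\ge0\}$ removed, $\ln$ the branch of the logarithm on it with $\ln1=0$, $z^\rho=e^{\rho\ln z}$, and $\vartheta_\kappa=\pi\kappa/2$. Let $R$ be the unique holomorphic function on $\mathbb{C}\times\mathbb{C}\times\mathbb{C}_{3\pi/2}$ with $R(\kappa^2,\vartheta,z)=\frac1\kappa\left(z^{-\kappa/2}e^{i\pi\kappa/2}\cos(\vartheta-\vartheta_\kappa)-z^{\kappa/2}e^{-i\pi\kappa/2}\cos(\vartheta+\vartheta_\kappa)\right)$ for $\kappa\in\mathbb{C}\setminus\{0\}$. For $\alpha<1$, $\vartheta\in\mathbb{R}$, the function $z\mapsto R(\alpha,\vartheta,z)$ does not vanish on $\mathbb{C}_+=\{\mathrm{Im}\,z>0\}$; put $\mathscr M_{\alpha,\vartheta}(z)=-\frac{R(\alpha,\vartheta+\pi/2,z)}{2\pi^2\,\mathrm{Sinc}^2(\pi^2\alpha)\,R(\alpha,\vartheta,z)}$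 for $z\in\mathbb{C}_+$. One has $\mathrm{Im}\,\mathscr M_{\alpha,\vartheta}>0$ on $\mathbb{C}_+$, so $\pi\mathscr M_{\alpha,\vartheta}$ has a unique representation $a+bz+\int_{\mathbb{R}}\left(\frac1{t-z}-\frac t{t^2+1}\right)d\nu(t)$ on $\mathbb{C}_+$ with $a\in\mathbb{R}$, $b\ge0$ and $\nu$ a positive Radon measure on $\mathbb{R}$ (finite on compact sets) with $\int\frac{d\nu(t)}{t^2+1}<\infty$; $\mathcal V_{\alpha,\vartheta}$ is this $\nu$. In particular every $\varphi\in\mathscr S$ is $\mathcal V_{\alpha,\vartheta}$-integrable. *)

theory Defs
  imports "HOL-Analysis.Analysis"
begin

section \<open>Smooth functions and the Schwartz space\<close>

text \<open>\<open>C_k_on S f k\<close>: on the open set \<open>S\<close>, all iterated directional derivatives of \<open>f\<close> of order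
  less than \<open>k\<close> exist and are (Frechet) differentiable, and those of order \<open>k\<close> are continuous.\<close>

primrec C_k_on ::
  "'a::real_normed_vector set \<Rightarrow> ('a \<Rightarrow> 'b::real_normed_vector) \<Rightarrow> nat \<Rightarrow> bool" where
  "C_k_on S f 0 \<longleftrightarrow> continuous_on S f"
| "C_k_on S f (Suc k) \<longleftrightarrow>
     (\<forall>x\<in>S. f differentiable (at x)) \<and>
     (\<forall>v. C_k_on S (\<lambda>x. frechet_derivative f (at x) v) k)"

definition smooth_on ::
  "'a::real_normed_vector set \<Rightarrow> ('a \<Rightarrow> 'b::real_normed_vector) \<Rightarrow> bool" where
  "smooth_on S f \<longleftrightarrow> open S \<and> (\<forall>k. C_k_on S f k)"

definition schwartz :: "(real \<Rightarrow> complex) set" where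
  "schwartz = {\<phi>. smooth_on UNIV \<phi> \<and>
     (\<forall>m n. bounded (range (\<lambda>x. x ^ m *\<^sub>R
        ((\<lambda>f x. vector_derivative f (at x)) ^^ n) \<phi> x)))}"

section \<open>The function \<open>R\<close>\<close>

definition Sinc :: "complex \<Rightarrow> complex" where
  "Sinc \<zeta> = (\<Sum>k. (- \<zeta>) ^ k / fact (2 * k + 1))"

definition slit_plane :: "complex set" where
  "slit_plane = UNIV - {- \<i> * of_real t | t. t \<ge> 0}"

text \<open>The library's principal branch \<open>Ln\<close> is cut along the non-positive reals; rotating by \<open>-\<i>\<close>
  moves the cut to the ray removed in \<open>slit_plane\<close>, and the value at \<open>1\<close> is \<open>0\<close>.
  The argument ranges over \<open>]-\<pi>/2, 3\<pi>/2[\<close> on \<open>slit_plane\<close>.\<close>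

definition slit_ln :: "complex \<Rightarrow> complex" where
  "slit_ln z = Ln (- \<i> * z) + \<i> * of_real pi / 2"

definition slit_power :: "complex \<Rightarrow> complex \<Rightarrow> complex" where
  "slit_power z \<rho> = exp (\<rho> * slit_ln z)"

definition theta_kappa :: "complex \<Rightarrow> complex" where
  "theta_kappa \<kappa> = of_real pi * \<kappa> / 2"

text \<open>Holomorphy in three variables is complex differentiability: the real Frechet derivative
  exists and is complex linear. It is only used on open sets.\<close>

definition holomorphic3_on :: "(complex \<times> complex \<times> complex \<Rightarrow> complex) \<Rightarrow>
    (complex \<times> complex \<times> complex) set \<Rightarrow> bool" where
  "holomorphic3_on f S \<longleftrightarrow>
     (\<forall>p\<in>S. \<exists>A B C. (f has_derivative (\<lambda>(u, v, w). A * u + B * v + C * w)) (at p))"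

text \<open>The value \<open>0\<close> outside the domain is a dummy that makes the total function unique.\<close>

definition R_fun :: "complex \<times> complex \<times> complex \<Rightarrow> complex" where
  "R_fun = (THE R.
     holomorphic3_on R (UNIV \<times> UNIV \<times> slit_plane) \<and>
     (\<forall>\<kappa> \<theta> z. \<kappa> \<noteq> 0 \<and> z \<in> slit_plane \<longrightarrow>
        R (\<kappa>\<^sup>2, \<theta>, z) = 1 / \<kappa> *
          (slit_power z (- \<kappa> / 2) * exp (\<i> * of_real pi * \<kappa> / 2) * cos (\<theta> - theta_kappa \<kappa>)
           - slit_power z (\<kappa> / 2) * exp (- \<i> * of_real pi * \<kappa> / 2) * cos (\<theta> + theta_kappa \<kappa>))) \<and>
     (\<forall>\<alpha> \<theta> z. z \<notin> slit_plane \<longrightarrow> R (\<alpha>, \<theta>, z) = 0))"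

section \<open>The spectral measures\<close>

definition M_fun :: "real \<Rightarrow> real \<Rightarrow> complex \<Rightarrow> complex" where
  "M_fun \<alpha> \<theta> z =
     - R_fun (of_real \<alpha>, of_real (\<theta> + pi / 2), z) /
       (2 * (of_real pi)\<^sup>2 * (Sinc (of_real (pi\<^sup>2 * \<alpha>)))\<^sup>2 * R_fun (of_real \<alpha>, of_real \<theta>, z))"

text \<open>\<open>\<nu>\<close> is the measure in the Herglotz representation of \<open>F\<close> on the upper half-plane.\<close>

definition herglotz_measure :: "(complex \<Rightarrow> complex) \<Rightarrow> real measure \<Rightarrow> bool" where
  "herglotz_measure F \<nu> \<longleftrightarrow>
     sets \<nu> = sets borel \<and>
     (\<forall>K. compact K \<longrightarrow> emeasure \<nu> K < \<infinity>) \<and>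
     integrable \<nu> (\<lambda>t. 1 / (t\<^sup>2 + 1)) \<and>
     (\<exists>a b :: real. b \<ge> 0 \<and>
        (\<forall>z. Im z > 0 \<longrightarrow>
           F z = of_real a + of_real b * z +
             (\<integral>t. (1 / (of_real t - z) - of_real (t / (t\<^sup>2 + 1))) \<partial>\<nu>)))"

definition spectral_measure :: "real \<Rightarrow> real \<Rightarrow> real measure" where
  "spectral_measure \<alpha> \<theta> = (THE \<nu>. herglotz_measure (\<lambda>z. of_real pi * M_fun \<alpha> \<theta> z) \<nu>)"

end

theory Submission
  imports Defs "HOL-Probability.Probability" "HOL-Complex_Analysis.Complex_Analysis"
begin

text \<open>With \<open>w = ln z - i \<pi>\<close>, the function \<open>R(\<alpha>,\<theta>,z)\<close> equals \<open>sin \<theta> B - cos \<theta> A\<close>, where \<open>A\<close> and \<open>B\<close> are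
  built from the entire functions \<open>sinh \<surd>u / \<surd>u\<close> and \<open>cosh \<surd>u\<close> at \<open>u = \<alpha> w\<^sup>2 / 4\<close>, and
  \<open>R(\<alpha>,\<theta>+\<pi>/2,z) = cos \<theta> B + sin \<theta> A\<close>. The imaginary part of the second function times the conjugate
  of the first does not depend on \<open>\<theta>\<close> and is bounded away from 0 by a negative multiple of \<open>Im z / |z|\<close>,
  locally uniformly in \<open>\<alpha> < 1\<close>. Hence \<open>1 / R\<close>, and with it \<open>M\<close> and all its derivatives in \<open>(\<alpha>,\<theta>)\<close>,
  grow at most like a power of \<open>(1 + |z|)\<^sup>2 / Im z\<close>. Let \<open>U(y)\<close> be the integral of \<open>\<phi>(x)\<close> against
  \<open>\<pi> Im M(x + iy) dx\<close>, so that \<open>U(0+)\<close> is \<open>\<pi>\<close> times the integral of \<open>\<phi>\<close> against the spectral measure.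
  Derivatives of \<open>U\<close> can be moved onto \<open>\<phi>\<close>, so Taylor's formula from \<open>y = 1\<close> to \<open>y = 0\<close> expresses
  \<open>U(0+)\<close> by integrals of derivatives of \<open>\<phi>\<close> against \<open>M\<close>, with a factor \<open>y ^ n\<close> in the remainder that
  makes differentiation under the integral sign possible up to any prescribed order.\<close>

section \<open>The function \<open>R\<close> in closed form\<close>

text \<open>The boundary \<alpha> < 1 comes from the first zero of sinh \<surd>u / \<surd>u, at u =
  -\<pi>^2. The imaginary part in question is \<pi> times the value of that function at -\<pi>^2
  \<alpha>, times v, times its value at -\<alpha> v^2, where v = Im w lies in ]-\<pi>, 0[; for
  \<alpha> < 1 both arguments stay to the right of -\<pi>^2. Growth is polynomial because the entire
  functions have order one half while their argument is quadratic in log z, so that exponentials of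
  |w| are bounded by powers of |z| and 1 / |z|. The obstacle is the real axis, where the available
  bounds for \<open>M\<close> blow up, and parameter derivatives may raise the power further. For a
  given order k a single power N bounds all derivatives up to k on a strip of parameters, and the
  length of the Taylor expansion is chosen after N; smoothness being local, strips exhausting the
  domain suffice. The spectral measure is a definite description, so existence and uniqueness of
  Herglotz representations have to be proved too: compactness of measures on the circle gives the
  former, inversion and characteristic functions the latter.\<close>

definition shc :: "complex \<Rightarrow> complex" where
  "shc u = Sinc (- u)"

text \<open>This is cosh \<surd>u, written by the half-angle formula cosh v = 1 + 2 sinh(v/2)^2, so
  that holomorphy and symmetry under conjugation are inherited from \<open>shc\<close> without a
  second power series.\<close>

definition chc :: "complex \<Rightarrow> complex" where
  "chc u = 1 + (u / 2) * (shc (u / 4))\<^sup>2"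

lemma shc_sums: "(\<lambda>k. u ^ k / fact (2 * k + 1)) sums shc u"
proof -
  have "summable (\<lambda>k. u ^ k / fact (2 * k + 1))"
  proof (rule summable_comparison_test')
    show "summable (\<lambda>k. norm u ^ k / fact k)"
      using summable_exp[of "norm u"] by (simp add: field_simps)
    show "norm (u ^ k / fact (2 * k + 1)) \<le> norm u ^ k / fact k" if "k \<ge> 0" for k
      unfolding norm_divide norm_power norm_fact
      by (intro divide_left_mono fact_mono mult_pos_pos) auto
  qed
  then show ?thesis
    by (simp add: shc_def Sinc_def summable_sums)
qed

lemma shc_holomorphic: "shc holomorphic_on A"
proof -
  have "shc holomorphic_on ball 0 r" for r
    by (rule power_series_holomorphic[where a = "\<lambda>k. 1 / fact (2 * k + 1)"])
      (use shc_sums in simp)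
  then have "shc field_differentiable (at x)" for x
    using holomorphic_on_imp_differentiable_at[of shc "ball 0 (norm x + 1)" x] by simp
  then show ?thesis
    using field_differentiable_at_within holomorphic_on_def by blast
qed

lemma chc_holomorphic: "chc holomorphic_on A"
proof -
  have "(shc \<circ> (\<lambda>u. u / 4)) holomorphic_on A"
    by (intro holomorphic_on_compose holomorphic_intros shc_holomorphic) auto
  then show ?thesis
    unfolding chc_def o_def by (intro holomorphic_intros) auto
qed

lemma shc_0 [simp]: "shc 0 = 1"
  using shc_sums[of 0] powser_sums_zero[of "\<lambda>k. 1 / fact (2 * k + 1) :: complex"] sums_unique2
  by fastforce

text \<open>The odd terms of the series of sinh v, divided by v, form a power series in v^2. The
  identities below are reduced to hyperbolic ones through a square root v of the argument.\<close>

lemma shc_square: "v * shc (v\<^sup>2) = sinh v"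
proof -
  have "(\<lambda>k. v * ((v\<^sup>2) ^ k / fact (2 * k + 1))) sums (v * shc (v\<^sup>2))"
    by (intro sums_mult shc_sums)
  moreover have "(\<lambda>k. v * ((v\<^sup>2) ^ k / fact (2 * k + 1))) sums sinh v"
  proof -
    have *: "strict_mono (\<lambda>k::nat. 2 * k + 1)"
      by (simp add: strict_mono_def)
    have "(\<lambda>k. (\<lambda>n. if even n then 0 else v ^ n /\<^sub>R fact n) (2 * k + 1)) sums sinh v"
      using sinh_converges[of v]
      by (subst sums_mono_reindex[OF *]) (auto elim!: oddE)
    moreover have "(\<lambda>n. if even n then 0 else v ^ n /\<^sub>R fact n) (2 * k + 1)
        = v * ((v\<^sup>2) ^ k / fact (2 * k + 1))" for k
      by (simp add: scaleR_conv_of_real field_simps flip: power_mult)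
    ultimately show ?thesis
      by simp
  qed
  ultimately show ?thesis
    by (rule sums_unique2)
qed

lemma chc_square: "chc (v\<^sup>2) = cosh v"
proof -
  have "chc (v\<^sup>2) = 1 + 2 * ((v / 2) * shc ((v / 2)\<^sup>2))\<^sup>2"
    by (simp add: chc_def power2_eq_square)
  also have "\<dots> = 1 + 2 * (sinh (v / 2))\<^sup>2"
    by (simp only: shc_square)
  also have "\<dots> = cosh v"
    using cosh_double[of "v / 2"] cosh_square_eq[of "v / 2"] by simp
  finally show ?thesis .
qed

text \<open>Duplication formula sinh v = 2 sinh(v/2) cosh(v/2). It later merges two
  \<alpha>-dependent constants of \<open>R\<close> into the single value Sinc(\<pi>^2
  \<alpha>).\<close>

lemma shc_double: "shc u = shc (u / 4) * chc (u / 4)"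
proof (cases "u = 0")
  case False
  define v where "v = csqrt u"
  have v: "v\<^sup>2 = u" "(v / 2)\<^sup>2 = u / 4" "v \<noteq> 0"
    using False by (auto simp: v_def power_divide)
  have "v * shc u = 2 * sinh (v / 2) * cosh (v / 2)"
    using shc_square[of v] sinh_double[of "v / 2"] v by simp
  also have "\<dots> = v * (shc (u / 4) * chc (u / 4))"
    using shc_square[of "v / 2"] chc_square[of "v / 2"] v by simp
  finally show ?thesis
    using v by simp
qed (simp add: chc_def)

lemma shc_cnj: "shc (cnj u) = cnj (shc u)"
  using shc_sums[of "cnj u"] sums_cnj[THEN iffD2, OF shc_sums[of u]]
  by (simp add: sums_unique2)

lemma chc_cnj: "chc (cnj u) = cnj (chc u)"
  using shc_cnj[of "u / 4"] by (simp add: chc_def)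

lemma Im_shc_real [simp]: "Im (shc (of_real x)) = 0"
  using shc_cnj[of "of_real x"] by (metis complex_cnj_complex_of_real Reals_cnj_iff complex_is_Real_iff)

lemma shc_of_real: "shc (of_real x) = of_real (Re (shc (of_real x)))"
  by (simp add: complex_eq_iff)

text \<open>For s > 0 the value is sinh v / v with v = \<surd>s, for s < 0 it is sin v / v with v =
  \<surd>(-s); the hypothesis keeps v below \<pi>, the first positive zero of sine.\<close>

lemma Re_shc_pos:
  fixes s :: real
  assumes "s > - pi\<^sup>2"
  shows "Re (shc (of_real s)) > 0"
proof (cases "s = 0" "s > 0" rule: case_split[case_product case_split])
  case False_True
  then show ?thesis
  proof -
    define v where "v = sqrt s"
    have "of_real v * shc (of_real s) = sinh (of_real v)"
      using shc_square[of "of_real v"] False_True by (simp add: v_def flip: of_real_power)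
    moreover have "sinh (of_real v :: complex) = of_real (sinh v)"
      by (simp add: sinh_field_def exp_of_real flip: of_real_minus)
    ultimately have "v * Re (shc (of_real s)) = sinh v"
      by (metis Re_complex_of_real shc_of_real of_real_mult)
    moreover have "v > 0" "sinh v > 0"
      using False_True by (auto simp: v_def)
    ultimately show ?thesis
      by (metis zero_less_mult_pos)
  qed
next
  case False_False
  define v where "v = sqrt (- s)"
  have v: "v > 0" "v < pi" "v\<^sup>2 = - s"
    using False_False assms by (auto simp: v_def real_less_lsqrt real_sqrt_less_iff)
  have "(\<i> * of_real v) * shc (of_real s) = sinh (\<i> * of_real v)"
    using shc_square[of "\<i> * of_real v"] v(3) by (simp add: power_mult_distrib flip: of_real_power)
  also have "\<dots> = \<i> * of_real (sin v)"
    by (simp add: sinh_conv_sin sin_of_real)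
  finally have "of_real v * shc (of_real s) = of_real (sin v)"
    by simp
  then have "v * Re (shc (of_real s)) = sin v"
    by (metis Re_complex_of_real shc_of_real of_real_mult)
  moreover have "sin v > 0"
    using v by (simp add: sin_gt_zero)
  ultimately show ?thesis
    using v by (metis zero_less_mult_pos)
qed auto

text \<open>Product formula 2 sinh a cosh b = sinh(a + b) + sinh(a - b) with a = vw/2 and b = v
  cnj(w)/2, where v^2 = \<alpha>. Conjugation acts on \<open>chc\<close> through its argument, in
  which only v^2 appears, so b contains v itself even when \<alpha> < 0 makes v imaginary. The first
  summand is real, the second purely imaginary.\<close>

lemma shc_chc_cnj:
  fixes \<alpha> :: real
  shows "w * shc (of_real \<alpha> * w\<^sup>2 / 4) * cnj (chc (of_real \<alpha> * w\<^sup>2 / 4)) =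
    of_real (Re w) * shc (of_real (\<alpha> * (Re w)\<^sup>2)) + \<i> * of_real (Im w) * shc (of_real (- \<alpha> * (Im w)\<^sup>2))"
proof (cases "\<alpha> = 0")
  case True
  then show ?thesis
    by (simp add: chc_def complex_eq[of w, symmetric])
next
  case False
  define v where "v = csqrt (of_real \<alpha>)"
  have v: "v\<^sup>2 = of_real \<alpha>" "v \<noteq> 0"
    using False by (auto simp: v_def)
  have "v * (w * shc (of_real \<alpha> * w\<^sup>2 / 4) * cnj (chc (of_real \<alpha> * w\<^sup>2 / 4)))
    = 2 * ((v * w / 2) * shc ((v * w / 2)\<^sup>2)) * chc ((v * cnj w / 2)\<^sup>2)"
    by (simp add: power_divide power_mult_distrib v flip: chc_cnj)
  also have "\<dots> = 2 * sinh (v * w / 2) * cosh (v * cnj w / 2)"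
    by (simp only: shc_square chc_square)
  also have "\<dots> = sinh (v * w / 2 + v * cnj w / 2) + sinh (v * w / 2 - v * cnj w / 2)"
    by (simp add: sinh_add sinh_diff)
  also have "v * w / 2 + v * cnj w / 2 = v * of_real (Re w)"
    by (simp add: complex_eq_iff field_simps)
  also have "v * w / 2 - v * cnj w / 2 = v * (\<i> * of_real (Im w))"
    by (simp add: complex_eq_iff field_simps)
  also have "sinh (v * of_real (Re w)) + sinh (v * (\<i> * of_real (Im w))) =
    v * (of_real (Re w) * shc (of_real (\<alpha> * (Re w)\<^sup>2)) + \<i> * of_real (Im w) * shc (of_real (- \<alpha> * (Im w)\<^sup>2)))"
    by (simp add: power_mult_distrib v algebra_simps flip: shc_square)
  finally show ?thesis
    using v(2) by (metis mult_cancel_left)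
qed

section \<open>Closed form and uniqueness of \<open>R\<close>\<close>

definition log_neg :: "complex \<Rightarrow> complex" where
  "log_neg z = slit_ln z - \<i> * of_real pi"

text \<open>Every term is entire in \<alpha> = \<kappa>^2, so the division by \<kappa> leaves no
  singularity at \<kappa> = 0. The variable w stands for \<open>log_neg z\<close>, which on the
  upper half-plane is the principal logarithm of -z, with imaginary part between -\<pi> and
  0.\<close>

definition R_expl :: "complex \<Rightarrow> complex \<Rightarrow> complex \<Rightarrow> complex" where
  "R_expl \<alpha> \<theta> w = of_real pi * sin \<theta> * shc (- (of_real pi)\<^sup>2 / 4 * \<alpha>) * chc (\<alpha> * w\<^sup>2 / 4)
     - cos \<theta> * chc (- (of_real pi)\<^sup>2 / 4 * \<alpha>) * (w * shc (\<alpha> * w\<^sup>2 / 4))"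

text \<open>The shift by -i\<pi> in w absorbs the exponential factors: the difference becomes
  exp(-\<kappa>w/2) cos(\<theta> - \<pi>\<kappa>/2) - exp(\<kappa>w/2) cos(\<theta> +
  \<pi>\<kappa>/2), and the addition theorem for cosine sorts it into sinh and cosh of
  \<kappa>w/2.\<close>

lemma R_expl_square:
  assumes "\<kappa> \<noteq> 0"
  shows "R_expl (\<kappa>\<^sup>2) \<theta> (log_neg z) = 1 / \<kappa> *
          (slit_power z (- \<kappa> / 2) * exp (\<i> * of_real pi * \<kappa> / 2) * cos (\<theta> - theta_kappa \<kappa>)
           - slit_power z (\<kappa> / 2) * exp (- \<i> * of_real pi * \<kappa> / 2) * cos (\<theta> + theta_kappa \<kappa>))"
proof -
  define w where "w = log_neg z"
  have 1: "slit_power z (- \<kappa> / 2) * exp (\<i> * of_real pi * \<kappa> / 2) = exp (- (\<kappa> * w / 2))"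
    "slit_power z (\<kappa> / 2) * exp (- \<i> * of_real pi * \<kappa> / 2) = exp (\<kappa> * w / 2)"
    unfolding slit_power_def w_def log_neg_def mult_exp_exp
    by (simp_all add: algebra_simps add_divide_distrib diff_divide_distrib)
  have 2: "\<kappa> * w * shc (\<kappa>\<^sup>2 * w\<^sup>2 / 4) = 2 * sinh (\<kappa> * w / 2)"
    using shc_square[of "\<kappa> * w / 2"] by (simp add: power_divide power_mult_distrib)
  have 3: "chc (\<kappa>\<^sup>2 * w\<^sup>2 / 4) = cosh (\<kappa> * w / 2)"
    using chc_square[of "\<kappa> * w / 2"] by (simp add: power_divide power_mult_distrib)
  have 4: "of_real pi * \<kappa> * shc (- (of_real pi)\<^sup>2 / 4 * \<kappa>\<^sup>2) = 2 * sin (theta_kappa \<kappa>)"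
    using shc_square[of "\<i> * theta_kappa \<kappa>"]
    by (simp add: theta_kappa_def power_divide power_mult_distrib sinh_conv_sin mult_ac)
  have 5: "chc (- (of_real pi)\<^sup>2 / 4 * \<kappa>\<^sup>2) = cos (theta_kappa \<kappa>)"
    using chc_square[of "\<i> * theta_kappa \<kappa>"]
    by (simp add: theta_kappa_def power_divide power_mult_distrib cosh_conv_cos)
  have "\<kappa> * R_expl (\<kappa>\<^sup>2) \<theta> w =
      sin \<theta> * (of_real pi * \<kappa> * shc (- (of_real pi)\<^sup>2 / 4 * \<kappa>\<^sup>2)) * chc (\<kappa>\<^sup>2 * w\<^sup>2 / 4)
      - cos \<theta> * chc (- (of_real pi)\<^sup>2 / 4 * \<kappa>\<^sup>2) * (\<kappa> * w * shc (\<kappa>\<^sup>2 * w\<^sup>2 / 4))"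
    by (simp add: R_expl_def algebra_simps)
  also have "\<dots> = exp (- (\<kappa> * w / 2)) * cos (\<theta> - theta_kappa \<kappa>)
           - exp (\<kappa> * w / 2) * cos (\<theta> + theta_kappa \<kappa>)"
    unfolding 2 3 4 5 cos_diff cos_add sinh_field_def cosh_field_def by (simp add: field_simps)
  finally show ?thesis
    unfolding 1 w_def[symmetric] using assms by (simp add: field_simps)
qed

text \<open>Pointwise form of \<open>holomorphic3_on\<close>. Sums, products, constants, coordinates
  and composition with holomorphic functions of one variable generate the closed form of
  \<open>R\<close>.\<close>

definition diff3_at :: "(complex \<times> complex \<times> complex \<Rightarrow> complex) \<Rightarrow> complex \<times> complex \<times> complex \<Rightarrow> bool" where
  "diff3_at f p \<longleftrightarrow> (\<exists>A B C. (f has_derivative (\<lambda>(u, v, w). A * u + B * v + C * w)) (at p))"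

lemma diff3_at_add: "diff3_at f p \<Longrightarrow> diff3_at g p \<Longrightarrow> diff3_at (\<lambda>x. f x + g x) p"
proof -
  assume "diff3_at f p" "diff3_at g p"
  then obtain A B C A' B' C' where
    "(f has_derivative (\<lambda>(u, v, w). A * u + B * v + C * w)) (at p)"
    "(g has_derivative (\<lambda>(u, v, w). A' * u + B' * v + C' * w)) (at p)"
    unfolding diff3_at_def by blast
  from has_derivative_add[OF this]
  have "((\<lambda>x. f x + g x) has_derivative (\<lambda>(u, v, w). (A + A') * u + (B + B') * v + (C + C') * w)) (at p)"
    by (rule has_derivative_eq_rhs) (auto simp: fun_eq_iff algebra_simps)
  then show ?thesis
    unfolding diff3_at_def by blast
qed

lemma diff3_at_mult: "diff3_at f p \<Longrightarrow> diff3_at g p \<Longrightarrow> diff3_at (\<lambda>x. f x * g x) p"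
proof -
  assume "diff3_at f p" "diff3_at g p"
  then obtain A B C A' B' C' where
    "(f has_derivative (\<lambda>(u, v, w). A * u + B * v + C * w)) (at p)"
    "(g has_derivative (\<lambda>(u, v, w). A' * u + B' * v + C' * w)) (at p)"
    unfolding diff3_at_def by blast
  from has_derivative_mult[OF this]
  have "((\<lambda>x. f x * g x) has_derivative (\<lambda>(u, v, w). (f p * A' + A * g p) * u
      + (f p * B' + B * g p) * v + (f p * C' + C * g p) * w)) (at p)"
    by (rule has_derivative_eq_rhs) (auto simp: fun_eq_iff algebra_simps)
  then show ?thesis
    unfolding diff3_at_def by blast
qed

lemma diff3_at_const: "diff3_at (\<lambda>_. c) p"
  unfolding diff3_at_def by (intro exI[of _ 0]) (auto simp: case_prod_unfold)

lemma diff3_at_coords: "diff3_at (\<lambda>x. fst x) p" "diff3_at (\<lambda>x. fst (snd x)) p" "diff3_at (\<lambda>x. snd (snd x)) p"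
proof -
  have "((\<lambda>x. fst x) has_derivative (\<lambda>(u, v, w). 1 * u + 0 * v + 0 * w)) (at p)"
    "((\<lambda>x. fst (snd x)) has_derivative (\<lambda>(u, v, w). 0 * u + 1 * v + 0 * w)) (at p)"
    "((\<lambda>x. snd (snd x)) has_derivative (\<lambda>(u, v, w). 0 * u + 0 * v + 1 * w)) (at p)"
    by (auto simp: case_prod_unfold intro!: derivative_eq_intros)
  then show "diff3_at (\<lambda>x. fst x) p" "diff3_at (\<lambda>x. fst (snd x)) p" "diff3_at (\<lambda>x. snd (snd x)) p"
    unfolding diff3_at_def by blast+
qed

lemma diff3_at_compose: 
  assumes "f field_differentiable (at (g p))" "diff3_at g p"
  shows "diff3_at (\<lambda>x. f (g x)) p"
proof -
  obtain f' A B C where 1: "(f has_field_derivative f') (at (g p))"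
    and 2: "(g has_derivative (\<lambda>(u, v, w). A * u + B * v + C * w)) (at p)"
    using assms unfolding diff3_at_def field_differentiable_def by blast
  have "((\<lambda>x. f (g x)) has_derivative (\<lambda>(u, v, w). (A * f') * u + (B * f') * v + (C * f') * w)) (at p)"
    using has_derivative_compose[OF 2 1[unfolded has_field_derivative_def]]
    by (rule has_derivative_eq_rhs) (auto simp: fun_eq_iff algebra_simps)
  then show ?thesis
    unfolding diff3_at_def by blast
qed

text \<open>Multiplication by -i carries the removed ray to the cut of \<open>Ln\<close>, so
  openness and differentiability are pulled back from the complement of that cut.\<close>

lemma open_slit_plane: "open slit_plane"
  and slit_ln_differentiable: "z \<in> slit_plane \<Longrightarrow> slit_ln field_differentiable (at z)"
proof -
  have eq: "slit_plane = (\<lambda>z. - \<i> * z) -` (- \<real>\<^sub>\<le>\<^sub>0)"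
  proof (rule set_eqI)
    fix z
    have "(\<exists>t\<ge>0. z = - (\<i> * of_real t)) \<longleftrightarrow> - \<i> * z \<in> \<real>\<^sub>\<le>\<^sub>0"
    proof
      assume "- \<i> * z \<in> \<real>\<^sub>\<le>\<^sub>0"
      then have "- Re z = 0" "Im z \<le> 0"
        by (auto simp: complex_nonpos_Reals_iff)
      then show "\<exists>t\<ge>0. z = - (\<i> * of_real t)"
        by (intro exI[of _ "- Im z"]) (auto simp: complex_eq_iff)
    qed (auto simp: complex_nonpos_Reals_iff)
    then show "z \<in> slit_plane \<longleftrightarrow> z \<in> (\<lambda>z. - \<i> * z) -` (- \<real>\<^sub>\<le>\<^sub>0)"
      by (auto simp: slit_plane_def)
  qed
  show "open slit_plane"
    unfolding eq by (intro open_vimage continuous_intros) auto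
  show "slit_ln field_differentiable (at z)" if "z \<in> slit_plane" for z
  proof -
    have "z \<noteq> 0" "- \<i> * z \<notin> \<real>\<^sub>\<le>\<^sub>0"
      using that by (auto simp: eq)
    then have "(slit_ln has_field_derivative 1 / z) (at z)"
      unfolding slit_ln_def
      by (auto intro!: derivative_eq_intros simp: field_simps)
    then show ?thesis
      unfolding field_differentiable_def by blast
  qed
qed

text \<open>The value 0 off the slit plane copies the dummy value in the definition of
  \<open>R_fun\<close>, so that the two can be equal as total functions.\<close>

definition R_closed_form :: "complex \<times> complex \<times> complex \<Rightarrow> complex" where
  "R_closed_form = (\<lambda>(\<alpha>, \<theta>, z). if z \<in> slit_plane then R_expl \<alpha> \<theta> (log_neg z) else 0)"

lemma entire_differentiable:
  "shc field_differentiable (at x)" "chc field_differentiable (at x)"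
  "sin field_differentiable (at (x::complex))" "cos field_differentiable (at (x::complex))"
  using shc_holomorphic[of UNIV] chc_holomorphic[of UNIV]
  by (auto simp: holomorphic_on_def intro: field_differentiable_at_sin field_differentiable_at_cos)

lemma R_closed_form_holomorphic: "holomorphic3_on R_closed_form (UNIV \<times> UNIV \<times> slit_plane)"
  unfolding holomorphic3_on_def diff3_at_def[symmetric]
proof
  fix p :: "complex \<times> complex \<times> complex"
  assume p: "p \<in> UNIV \<times> UNIV \<times> slit_plane"
  define f where "f = (\<lambda>p. R_expl (fst p) (fst (snd p)) (log_neg (snd (snd p))))"
  have ln: "diff3_at (\<lambda>x. log_neg (snd (snd x))) p"
    unfolding log_neg_def diff_conv_add_uminus
    by (intro diff3_at_add diff3_at_const diff3_at_compose[of slit_ln] diff3_at_coords slit_ln_differentiable)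
      (use p in auto)
  have "diff3_at f p"
    unfolding f_def R_expl_def diff_conv_add_uminus minus_mult_left divide_inverse power2_eq_square
    by (intro diff3_at_add diff3_at_mult diff3_at_const diff3_at_compose[of shc] diff3_at_compose[of chc]
       diff3_at_compose[of sin] diff3_at_compose[of cos] diff3_at_compose[of uminus] diff3_at_coords ln
       entire_differentiable field_differentiable_minus field_differentiable_ident)
  then show "diff3_at R_closed_form p"
    unfolding diff3_at_def
  proof (elim exE, intro exI)
    fix A B C assume *: "(f has_derivative (\<lambda>(u, v, w). A * u + B * v + C * w)) (at p)"
    show "(R_closed_form has_derivative (\<lambda>(u, v, w). A * u + B * v + C * w)) (at p)"
      using p by (rule has_derivative_transform_within_open[OF * open_Times[OF open_UNIV open_Times[OF open_UNIV open_slit_plane]]])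
        (auto simp: f_def R_closed_form_def)
  qed
qed

text \<open>For \<alpha> \<noteq> 0 the prescribed formula with \<kappa> =
  \<open>csqrt \<alpha>\<close> fixes the value; at \<alpha> = 0 any two solutions agree by
  continuity in \<alpha>.\<close>

lemma R_fun_eq: "R_fun = R_closed_form"
  unfolding R_fun_def
proof (rule the_equality)
  show 1: "holomorphic3_on R_closed_form (UNIV \<times> UNIV \<times> slit_plane) \<and>
     (\<forall>\<kappa> \<theta> z. \<kappa> \<noteq> 0 \<and> z \<in> slit_plane \<longrightarrow>
        R_closed_form (\<kappa>\<^sup>2, \<theta>, z) = 1 / \<kappa> *
          (slit_power z (- \<kappa> / 2) * exp (\<i> * of_real pi * \<kappa> / 2) * cos (\<theta> - theta_kappa \<kappa>)
           - slit_power z (\<kappa> / 2) * exp (- \<i> * of_real pi * \<kappa> / 2) * cos (\<theta> + theta_kappa \<kappa>))) \<and>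
     (\<forall>\<alpha> \<theta> z. z \<notin> slit_plane \<longrightarrow> R_closed_form (\<alpha>, \<theta>, z) = 0)"
    using R_closed_form_holomorphic R_expl_square by (simp add: R_closed_form_def)
  fix R
  assume 2: "holomorphic3_on R (UNIV \<times> UNIV \<times> slit_plane) \<and>
     (\<forall>\<kappa> \<theta> z. \<kappa> \<noteq> 0 \<and> z \<in> slit_plane \<longrightarrow>
        R (\<kappa>\<^sup>2, \<theta>, z) = 1 / \<kappa> *
          (slit_power z (- \<kappa> / 2) * exp (\<i> * of_real pi * \<kappa> / 2) * cos (\<theta> - theta_kappa \<kappa>)
           - slit_power z (\<kappa> / 2) * exp (- \<i> * of_real pi * \<kappa> / 2) * cos (\<theta> + theta_kappa \<kappa>))) \<and>
     (\<forall>\<alpha> \<theta> z. z \<notin> slit_plane \<longrightarrow> R (\<alpha>, \<theta>, z) = 0)"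
  have nz: "R (\<alpha>, \<theta>, z) = R_closed_form (\<alpha>, \<theta>, z)" if "\<alpha> \<noteq> 0" "z \<in> slit_plane" for \<alpha> \<theta> z
  proof -
    have "csqrt \<alpha> \<noteq> 0" "(csqrt \<alpha>)\<^sup>2 = \<alpha>"
      using that by auto
    then show ?thesis
      using 1 2 that by metis
  qed
  have cont: "isCont f p" if "holomorphic3_on f (UNIV \<times> UNIV \<times> slit_plane)" "p \<in> UNIV \<times> UNIV \<times> slit_plane" for f p
    using that unfolding holomorphic3_on_def by (meson has_derivative_continuous)
  have "R (\<alpha>, \<theta>, z) = R_closed_form (\<alpha>, \<theta>, z)" for \<alpha> \<theta> z
  proof (cases "z \<in> slit_plane \<and> \<alpha> = 0")
    case True
    have lim: "(\<lambda>\<alpha>. f (\<alpha>, \<theta>, z)) \<midarrow>0\<rightarrow> f (0, \<theta>, z)"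
      if "holomorphic3_on f (UNIV \<times> UNIV \<times> slit_plane)" for f
    proof -
      have "isCont (\<lambda>\<alpha>. f (\<alpha>, \<theta>, z)) 0"
        by (rule isCont_o2[of 0 "\<lambda>\<alpha>. (\<alpha>, \<theta>, z)" f]) (use True that in \<open>auto intro!: cont continuous_intros\<close>)
      then show ?thesis
        by (simp add: isCont_def)
    qed
    have "(\<lambda>\<alpha>. R_closed_form (\<alpha>, \<theta>, z)) \<midarrow>0\<rightarrow> R (0, \<theta>, z)"
      by (rule Lim_transform_eventually[OF lim])
        (use 2 True nz in \<open>auto simp: eventually_at intro!: exI[of _ 1]\<close>)
    then have "R (0, \<theta>, z) = R_closed_form (0, \<theta>, z)"
      using lim[of R_closed_form] 1 by (meson LIM_unique)
    then show ?thesis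
      using True by simp
  next
    case False
    then show ?thesis
      using 1 2 nz by metis
  qed
  then show "R = R_closed_form"
    by auto
qed

section \<open>Parameter integrals over the upper half-plane\<close>

lemma C_k_on_cong:
  assumes "open S" "\<And>x. x \<in> S \<Longrightarrow> f x = g x" "C_k_on S f k"
  shows "C_k_on S g k"
  using assms
proof (induction k arbitrary: f g)
  case 0
  then show ?case
    using continuous_on_cong by (metis C_k_on.simps(1))
next
  case (Suc k)
  have d: "(g has_derivative frechet_derivative f (at x)) (at x)" if "x \<in> S" for x
  proof (rule has_derivative_transform_within_open[of f])
    show "(f has_derivative frechet_derivative f (at x)) (at x)"
      using Suc.prems(3) that by (auto simp flip: frechet_derivative_works)
  qed (use Suc.prems that in auto)
  moreover have "C_k_on S (\<lambda>x. frechet_derivative g (at x) v) k" for v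
  proof (rule Suc.IH[of "\<lambda>x. frechet_derivative f (at x) v"])
    show "frechet_derivative f (at x) v = frechet_derivative g (at x) v" if "x \<in> S" for x
      using frechet_derivative_at[OF d[OF that]] by simp
  qed (use Suc.prems in auto)
  ultimately show ?case
    unfolding C_k_on.simps differentiable_def by blast
qed

text \<open>\<open>C_k_on\<close> is phrased with the choice function
  \<open>frechet_derivative\<close>; on an open set a derivative D that is known explicitly may
  replace it.\<close>

lemma C_k_on_SucI:
  assumes "open S" "\<And>x. x \<in> S \<Longrightarrow> (f has_derivative D x) (at x)" "\<And>v. C_k_on S (\<lambda>x. D x v) k"
  shows "C_k_on S f (Suc k)"
  unfolding C_k_on.simps
proof (intro conjI ballI allI)
  show "f differentiable (at x)" if "x \<in> S" for x
    using assms(2)[OF that] unfolding differentiable_def by blast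
  show "C_k_on S (\<lambda>x. frechet_derivative f (at x) v) k" for v
    by (rule C_k_on_cong[OF assms(1) _ assms(3)[of v]]) (use assms(2) frechet_derivative_at in metis)
qed

lemma C_k_on_lincomb:
  assumes "open S" "C_k_on S f k" "C_k_on S g k"
  shows "C_k_on S (\<lambda>x. a *\<^sub>R f x + b *\<^sub>R g x) k"
  using assms
proof (induction k arbitrary: f g)
  case 0
  then show ?case
    by (auto intro!: continuous_intros)
next
  case (Suc k)
  show ?case
  proof (rule C_k_on_SucI[OF \<open>open S\<close>])
    fix x assume "x \<in> S"
    then have "(f has_derivative frechet_derivative f (at x)) (at x)"
      "(g has_derivative frechet_derivative g (at x)) (at x)"
      using Suc.prems by (auto simp flip: frechet_derivative_works)
    then show "((\<lambda>x. a *\<^sub>R f x + b *\<^sub>R g x) has_derivative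
        (\<lambda>v. a *\<^sub>R frechet_derivative f (at x) v + b *\<^sub>R frechet_derivative g (at x) v)) (at x)"
      by (auto intro!: derivative_intros)
  next
    show "C_k_on S (\<lambda>x. a *\<^sub>R frechet_derivative f (at x) v + b *\<^sub>R frechet_derivative g (at x) v) k" for v
      using Suc by simp
  qed
qed

lemma C_k_on_zero: "C_k_on S (\<lambda>x. 0) k"
  by (induction k) (auto simp: frechet_derivative_const)

lemma C_k_on_sum:
  assumes "open S" "\<And>i. i \<in> I \<Longrightarrow> C_k_on S (f i) k"
  shows "C_k_on S (\<lambda>x. \<Sum>i\<in>I. c i *\<^sub>R f i x) k"
  using assms(2)
proof (induction I rule: infinite_finite_induct)
  case (insert i I)
  then show ?case
    using C_k_on_lincomb[OF assms(1), of "f i" k "\<lambda>x. \<Sum>i\<in>I. c i *\<^sub>R f i x" "c i" 1] by simp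
qed (use C_k_on_zero in auto)

text \<open>Glues strips of parameters together, since the growth bounds are uniform on each strip
  but not on the whole domain.\<close>

lemma C_k_on_UN:
  assumes "\<And>i. i \<in> I \<Longrightarrow> open (U i)" "\<And>i. i \<in> I \<Longrightarrow> C_k_on (U i) f k"
  shows "C_k_on (\<Union>i\<in>I. U i) f k"
  using assms by (induction k arbitrary: f) (auto intro: continuous_on_open_UN)

section \<open>Measurability and polynomial growth on the upper half-plane\<close>

lemma borel_measurable_half_plane:
  assumes "continuous_on {z. Im z > 0} q" "f \<in> borel_measurable M" "\<And>\<omega>. \<omega> \<in> space M \<Longrightarrow> Im (f \<omega>) > 0"
  shows "(\<lambda>\<omega>. q (f \<omega>)) \<in> borel_measurable M"
proof -
  have "f \<in> M \<rightarrow>\<^sub>M restrict_space borel {z. Im z > 0}"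
    using assms(2,3) by (intro measurable_restrict_space2) auto
  from measurable_compose[OF this borel_measurable_continuous_on_restrict[OF assms(1)]]
  show ?thesis .
qed

text \<open>A single weight dominating \<open>norm z\<close>, \<open>1 / norm z\<close> and \<open>1 / Im z\<close> on the upper half-plane.\<close>

definition hp_weight :: "complex \<Rightarrow> real" where
  "hp_weight z = (1 + norm z)\<^sup>2 / Im z"

lemma hp_weight_ge:
  assumes "Im z > 0"
  shows "hp_weight z \<ge> 1" "hp_weight z \<ge> norm z" "hp_weight z \<ge> 1 / Im z"
    "hp_weight z \<ge> 1 / norm z" "hp_weight z \<ge> norm z / Im z"
proof -
  have 1: "Im z \<le> norm z" "norm z > 0"
    using abs_Im_le_cmod[of z] assms by auto
  have 2: "(1 + norm z)\<^sup>2 \<ge> 1" "(1 + norm z)\<^sup>2 \<ge> norm z * norm z" "(1 + norm z)\<^sup>2 \<ge> norm z"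
    using 1 by (auto simp: power2_eq_square algebra_simps)
  have "norm z * Im z \<le> norm z * norm z"
    using 1 by (intro mult_left_mono) auto
  then show "hp_weight z \<ge> norm z" "hp_weight z \<ge> 1 / Im z" "hp_weight z \<ge> norm z / Im z"
    using 2 assms unfolding hp_weight_def by (auto simp: field_simps)
  show "hp_weight z \<ge> 1"
    using \<open>hp_weight z \<ge> norm z / Im z\<close> 1 assms by (simp add: le_divide_eq order_trans[of 1 "norm z / Im z"])
  have "1 / norm z \<le> 1 / Im z"
    using 1 assms by (simp add: frac_le)
  then show "hp_weight z \<ge> 1 / norm z"
    using \<open>hp_weight z \<ge> 1 / Im z\<close> by simp
qed

lemma hp_weight_power_mono: "Im z > 0 \<Longrightarrow> m \<le> n \<Longrightarrow> hp_weight z ^ m \<le> hp_weight z ^ n"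
  using hp_weight_ge(1) by (intro power_increasing)

text \<open>Continuity is separate in the two arguments: in p it serves dominated convergence of
  parameter integrals, in z the measurability of the integrand.\<close>

definition power_bounded :: "nat \<Rightarrow> (real \<times> real) set \<Rightarrow> (real \<times> real \<Rightarrow> complex \<Rightarrow> complex) \<Rightarrow> bool" where
  "power_bounded N S h \<longleftrightarrow> (\<forall>z. Im z > 0 \<longrightarrow> continuous_on S (\<lambda>p. h p z)) \<and>
     (\<forall>p\<in>S. continuous_on {z. Im z > 0} (h p)) \<and>
     (\<exists>C. \<forall>p\<in>S. \<forall>z. Im z > 0 \<longrightarrow> norm (h p z) \<le> C * hp_weight z ^ N)"

lemma power_boundedE:
  assumes "power_bounded N S h"
  obtains C where "C \<ge> 0" "\<And>p z. p \<in> S \<Longrightarrow> Im z > 0 \<Longrightarrow> norm (h p z) \<le> C * hp_weight z ^ N"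
proof -
  obtain C where C: "\<And>p z. p \<in> S \<Longrightarrow> Im z > 0 \<Longrightarrow> norm (h p z) \<le> C * hp_weight z ^ N"
    using assms unfolding power_bounded_def by blast
  have "norm (h p z) \<le> \<bar>C\<bar> * hp_weight z ^ N" if "p \<in> S" "Im z > 0" for p z
  proof -
    have "C * hp_weight z ^ N \<le> \<bar>C\<bar> * hp_weight z ^ N"
      using hp_weight_ge(1)[OF that(2)] by (intro mult_right_mono zero_le_power) auto
    then show ?thesis
      using C[OF that] by simp
  qed
  then show thesis
    by (intro that[of "\<bar>C\<bar>"]) auto
qed

lemma power_boundedI:
  assumes "\<And>z. Im z > 0 \<Longrightarrow> continuous_on S (\<lambda>p. h p z)"
    "\<And>p. p \<in> S \<Longrightarrow> continuous_on {z. Im z > 0} (h p)"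
    "\<And>p z. p \<in> S \<Longrightarrow> Im z > 0 \<Longrightarrow> norm (h p z) \<le> C * hp_weight z ^ N"
  shows "power_bounded N S h"
  using assms unfolding power_bounded_def by blast

lemma power_bounded_continuous:
  assumes "power_bounded N S h"
  shows "Im z > 0 \<Longrightarrow> continuous_on S (\<lambda>p. h p z)"
    "p \<in> S \<Longrightarrow> continuous_on {z. Im z > 0} (h p)"
  using assms by (auto simp: power_bounded_def)

lemma power_bounded_mono:
  assumes "power_bounded N S h" "N \<le> N'"
  shows "power_bounded N' S h"
proof -
  obtain C where C: "C \<ge> 0" "\<And>p z. p \<in> S \<Longrightarrow> Im z > 0 \<Longrightarrow> norm (h p z) \<le> C * hp_weight z ^ N"
    using assms(1) by (rule power_boundedE) blast
  have "norm (h p z) \<le> C * hp_weight z ^ N'" if "p \<in> S" "Im z > 0" for p z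
    using C(2)[OF that] mult_left_mono[OF hp_weight_power_mono[OF that(2) assms(2)] C(1)] by simp
  then show ?thesis
    using assms(1) unfolding power_bounded_def by blast
qed

lemma power_bounded_mult:
  assumes "power_bounded N S h" "power_bounded N' S h'"
  shows "power_bounded (N + N') S (\<lambda>p z. h p z * h' p z)"
proof -
  obtain C where C: "C \<ge> 0" "\<And>p z. p \<in> S \<Longrightarrow> Im z > 0 \<Longrightarrow> norm (h p z) \<le> C * hp_weight z ^ N"
    using assms(1) by (rule power_boundedE) blast
  obtain C' where C': "C' \<ge> 0" "\<And>p z. p \<in> S \<Longrightarrow> Im z > 0 \<Longrightarrow> norm (h' p z) \<le> C' * hp_weight z ^ N'"
    using assms(2) by (rule power_boundedE) blast
  have "norm (h p z * h' p z) \<le> (C * C') * hp_weight z ^ (N + N')" if "p \<in> S" "Im z > 0" for p z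
  proof -
    have "norm (h p z) * norm (h' p z) \<le> (C * hp_weight z ^ N) * (C' * hp_weight z ^ N')"
      using C' C that hp_weight_ge(1)[OF that(2)] by (intro mult_mono) auto
    then show ?thesis
      by (simp add: norm_mult power_add mult_ac)
  qed
  then show ?thesis
    by (intro power_boundedI continuous_intros power_bounded_continuous[OF assms(1)] power_bounded_continuous[OF assms(2)])
qed

lemma power_bounded_add:
  assumes "power_bounded N S h" "power_bounded N S h'"
  shows "power_bounded N S (\<lambda>p z. h p z + h' p z)"
proof -
  obtain C where C: "\<And>p z. p \<in> S \<Longrightarrow> Im z > 0 \<Longrightarrow> norm (h p z) \<le> C * hp_weight z ^ N"
    using assms(1) by (rule power_boundedE) blast
  obtain C' where C': "\<And>p z. p \<in> S \<Longrightarrow> Im z > 0 \<Longrightarrow> norm (h' p z) \<le> C' * hp_weight z ^ N"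
    using assms(2) by (rule power_boundedE) blast
  have "norm (h p z + h' p z) \<le> (C + C') * hp_weight z ^ N" if "p \<in> S" "Im z > 0" for p z
    using C[OF that] C'[OF that] norm_triangle_ineq[of "h p z" "h' p z"] by (simp add: algebra_simps)
  then show ?thesis
    by (intro power_boundedI continuous_intros power_bounded_continuous[OF assms(1)] power_bounded_continuous[OF assms(2)])
qed

text \<open>Differentiability up to order \<open>k\<close> in the parameters, where the same power \<open>N\<close> of the weight
  bounds all derivatives uniformly. The parameters are real, the second argument is the spectral one.\<close>

primrec diff_upto :: "nat \<Rightarrow> (real \<times> real) set \<Rightarrow> nat \<Rightarrow> (real \<times> real \<Rightarrow> complex \<Rightarrow> complex) \<Rightarrow> bool" where
  "diff_upto N S 0 h \<longleftrightarrow> power_bounded N S h"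
| "diff_upto N S (Suc k) h \<longleftrightarrow> power_bounded N S h \<and> (\<exists>h1 h2. diff_upto N S k h1 \<and> diff_upto N S k h2 \<and>
     (\<forall>p\<in>S. \<forall>z. Im z > 0 \<longrightarrow>
       ((\<lambda>p. h p z) has_derivative (\<lambda>v. fst v *\<^sub>R h1 p z + snd v *\<^sub>R h2 p z)) (at p)))"

lemma diff_upto_power_bounded: "diff_upto N S k h \<Longrightarrow> power_bounded N S h"
  by (cases k) auto

lemma diff_upto_mono: "diff_upto N S k h \<Longrightarrow> N \<le> N' \<Longrightarrow> diff_upto N' S k h"
proof (induction k arbitrary: h)
  case 0
  then show ?case
    using power_bounded_mono by auto
next
  case (Suc k)
  then show ?case
    unfolding diff_upto.simps using power_bounded_mono by blast
qed

lemma power_bounded_linear: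
  assumes "bounded_linear L" and h: "power_bounded N S h"
  shows "power_bounded N S (\<lambda>p z. L (h p z))"
proof -
  interpret L: bounded_linear L
    by fact
  obtain K where K: "\<And>x. norm (L x) \<le> norm x * K"
    using L.bounded by blast
  obtain C where C: "C \<ge> 0" "\<And>p z. p \<in> S \<Longrightarrow> Im z > 0 \<Longrightarrow> norm (h p z) \<le> C * hp_weight z ^ N"
    using h by (rule power_boundedE) blast
  have "norm (L (h p z)) \<le> (C * \<bar>K\<bar>) * hp_weight z ^ N" if "p \<in> S" "Im z > 0" for p z
  proof -
    have "norm (L (h p z)) \<le> norm (h p z) * \<bar>K\<bar>"
      using order_trans[OF K mult_left_mono[OF abs_ge_self norm_ge_zero]] .
    also have "\<dots> \<le> (C * hp_weight z ^ N) * \<bar>K\<bar>"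
      using C(2)[OF that] by (intro mult_right_mono) auto
    finally show ?thesis
      by (simp add: mult_ac)
  qed
  then show ?thesis
    by (intro power_boundedI L.continuous_on power_bounded_continuous[OF h])
qed

lemma diff_upto_linear:
  assumes "bounded_linear L" "diff_upto N S k h"
  shows "diff_upto N S k (\<lambda>p z. L (h p z))"
  using assms(2)
proof (induction k arbitrary: h)
  case 0
  then show ?case
    using power_bounded_linear[OF assms(1)] by simp
next
  case (Suc k)
  interpret L: bounded_linear L
    by fact
  obtain h1 h2 where 1: "power_bounded N S h" "diff_upto N S k h1" "diff_upto N S k h2"
    "\<And>p z. p \<in> S \<Longrightarrow> Im z > 0 \<Longrightarrow>
       ((\<lambda>p. h p z) has_derivative (\<lambda>v. fst v *\<^sub>R h1 p z + snd v *\<^sub>R h2 p z)) (at p)"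
    using Suc.prems by auto
  have "((\<lambda>p. L (h p z)) has_derivative (\<lambda>v. fst v *\<^sub>R L (h1 p z) + snd v *\<^sub>R L (h2 p z))) (at p)"
    if p: "p \<in> S" "Im z > 0" for p z
    using L.has_derivative[OF 1(4)[OF p]]
    by (rule has_derivative_eq_rhs) (auto simp: L.add L.scaleR)
  then show ?case
    using power_bounded_linear[OF assms(1) 1(1)] Suc.IH[OF 1(2)] Suc.IH[OF 1(3)] unfolding diff_upto.simps by blast
qed

text \<open>Products and inverses raise the power of the weight, so the closure rules leave the
  exponent existential. The version \<open>diff_upto\<close> with a fixed exponent is recovered at
  the end, when an integrable majorant has to be named.\<close>

definition bounded_diff :: "(real \<times> real) set \<Rightarrow> nat \<Rightarrow> (real \<times> real \<Rightarrow> complex \<Rightarrow> complex) \<Rightarrow> bool" where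
  "bounded_diff S k h \<longleftrightarrow> (\<exists>N. diff_upto N S k h)"

lemma bounded_diff_0: "bounded_diff S 0 h \<longleftrightarrow> (\<exists>N. power_bounded N S h)"
  by (simp add: bounded_diff_def)

lemma bounded_diff_SucI:
  assumes "power_bounded N S h" "bounded_diff S k h1" "bounded_diff S k h2"
    "\<And>p z. p \<in> S \<Longrightarrow> Im z > 0 \<Longrightarrow>
       ((\<lambda>p. h p z) has_derivative (\<lambda>v. fst v *\<^sub>R h1 p z + snd v *\<^sub>R h2 p z)) (at p)"
  shows "bounded_diff S (Suc k) h"
proof -
  obtain N1 N2 where N: "diff_upto N1 S k h1" "diff_upto N2 S k h2"
    using assms unfolding bounded_diff_def by blast
  \<comment> \<open>The sum serves as a common exponent because the weight is at least 1.\<close>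
  define M where "M = N + N1 + N2"
  have "diff_upto M S k h1" "diff_upto M S k h2" "power_bounded M S h"
    using N assms(1) by (auto simp: M_def intro: diff_upto_mono power_bounded_mono)
  then show ?thesis
    using assms(4) unfolding bounded_diff_def diff_upto.simps by blast
qed

lemma bounded_diff_SucE:
  assumes "bounded_diff S (Suc k) h"
  obtains N h1 h2 where "power_bounded N S h" "bounded_diff S k h1" "bounded_diff S k h2"
    "\<And>p z. p \<in> S \<Longrightarrow> Im z > 0 \<Longrightarrow>
       ((\<lambda>p. h p z) has_derivative (\<lambda>v. fst v *\<^sub>R h1 p z + snd v *\<^sub>R h2 p z)) (at p)"
  using assms unfolding bounded_diff_def diff_upto.simps by blast

lemma bounded_diff_power_bounded: "bounded_diff S k h \<Longrightarrow> \<exists>N. power_bounded N S h"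
  unfolding bounded_diff_def using diff_upto_power_bounded by blast

lemma bounded_diff_Suc_imp: "bounded_diff S (Suc k) h \<Longrightarrow> bounded_diff S k h"
proof (induction k arbitrary: h)
  case 0
  then show ?case
    using bounded_diff_power_bounded bounded_diff_0 by blast
next
  case (Suc k)
  from Suc.prems obtain N h1 h2 where "power_bounded N S h" "bounded_diff S (Suc k) h1" "bounded_diff S (Suc k) h2"
    "\<And>p z. p \<in> S \<Longrightarrow> Im z > 0 \<Longrightarrow>
       ((\<lambda>p. h p z) has_derivative (\<lambda>v. fst v *\<^sub>R h1 p z + snd v *\<^sub>R h2 p z)) (at p)"
    by (rule bounded_diff_SucE) blast
  then show ?case
    using Suc.IH by (intro bounded_diff_SucI[of N S h k h1 h2]) auto
qed

lemma bounded_diff_add: "bounded_diff S k h \<Longrightarrow> bounded_diff S k h' \<Longrightarrow> bounded_diff S k (\<lambda>p z. h p z + h' p z)"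
proof (induction k arbitrary: h h')
  case 0
  then obtain N N' where "power_bounded N S h" "power_bounded N' S h'"
    unfolding bounded_diff_0 by blast
  then have "power_bounded (N + N') S (\<lambda>p z. h p z + h' p z)"
    by (intro power_bounded_add) (auto elim: power_bounded_mono)
  then show ?case
    unfolding bounded_diff_0 by blast
next
  case (Suc k)
  obtain N h1 h2 where 1: "power_bounded N S h" "bounded_diff S k h1" "bounded_diff S k h2"
    "\<And>p z. p \<in> S \<Longrightarrow> Im z > 0 \<Longrightarrow>
       ((\<lambda>p. h p z) has_derivative (\<lambda>v. fst v *\<^sub>R h1 p z + snd v *\<^sub>R h2 p z)) (at p)"
    using Suc.prems(1) by (rule bounded_diff_SucE) blast
  obtain N' h1' h2' where 2: "power_bounded N' S h'" "bounded_diff S k h1'" "bounded_diff S k h2'"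
    "\<And>p z. p \<in> S \<Longrightarrow> Im z > 0 \<Longrightarrow>
       ((\<lambda>p. h' p z) has_derivative (\<lambda>v. fst v *\<^sub>R h1' p z + snd v *\<^sub>R h2' p z)) (at p)"
    using Suc.prems(2) by (rule bounded_diff_SucE) blast
  show ?case
  proof (rule bounded_diff_SucI)
    show "power_bounded (N + N') S (\<lambda>p z. h p z + h' p z)"
      using 1(1) 2(1) by (intro power_bounded_add) (auto elim: power_bounded_mono)
    show "bounded_diff S k (\<lambda>p z. h1 p z + h1' p z)" "bounded_diff S k (\<lambda>p z. h2 p z + h2' p z)"
      using 1 2 Suc.IH by auto
    fix p z assume p: "p \<in> S" "Im z > 0"
    show "((\<lambda>p. h p z + h' p z) has_derivative
      (\<lambda>v. fst v *\<^sub>R (h1 p z + h1' p z) + snd v *\<^sub>R (h2 p z + h2' p z))) (at p)"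
      using has_derivative_add[OF 1(4)[OF p] 2(4)[OF p]]
      by (rule has_derivative_eq_rhs) (auto simp: algebra_simps)
  qed
qed

lemma bounded_diff_mult: "bounded_diff S k h \<Longrightarrow> bounded_diff S k h' \<Longrightarrow> bounded_diff S k (\<lambda>p z. h p z * h' p z)"
proof (induction k arbitrary: h h')
  case 0
  then show ?case
    unfolding bounded_diff_0 using power_bounded_mult by blast
next
  case (Suc k)
  obtain N h1 h2 where 1: "power_bounded N S h" "bounded_diff S k h1" "bounded_diff S k h2"
    "\<And>p z. p \<in> S \<Longrightarrow> Im z > 0 \<Longrightarrow>
       ((\<lambda>p. h p z) has_derivative (\<lambda>v. fst v *\<^sub>R h1 p z + snd v *\<^sub>R h2 p z)) (at p)"
    using Suc.prems(1) by (rule bounded_diff_SucE) blast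
  obtain N' h1' h2' where 2: "power_bounded N' S h'" "bounded_diff S k h1'" "bounded_diff S k h2'"
    "\<And>p z. p \<in> S \<Longrightarrow> Im z > 0 \<Longrightarrow>
       ((\<lambda>p. h' p z) has_derivative (\<lambda>v. fst v *\<^sub>R h1' p z + snd v *\<^sub>R h2' p z)) (at p)"
    using Suc.prems(2) by (rule bounded_diff_SucE) blast
  show ?case
  proof (rule bounded_diff_SucI)
    show "power_bounded (N + N') S (\<lambda>p z. h p z * h' p z)"
      using 1(1) 2(1) by (rule power_bounded_mult)
    \<comment> \<open>Leibniz' rule leaves one factor undifferentiated, so order k is needed for h
      and h' themselves besides their partial derivatives.\<close>
    show "bounded_diff S k (\<lambda>p z. h p z * h1' p z + h1 p z * h' p z)"
      "bounded_diff S k (\<lambda>p z. h p z * h2' p z + h2 p z * h' p z)"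
      using 1 2 Suc.IH bounded_diff_Suc_imp[OF Suc.prems(1)] bounded_diff_Suc_imp[OF Suc.prems(2)]
      by (auto intro!: bounded_diff_add)
    fix p z assume p: "p \<in> S" "Im z > 0"
    show "((\<lambda>p. h p z * h' p z) has_derivative
      (\<lambda>v. fst v *\<^sub>R (h p z * h1' p z + h1 p z * h' p z) + snd v *\<^sub>R (h p z * h2' p z + h2 p z * h' p z))) (at p)"
      using has_derivative_mult[OF 1(4)[OF p] 2(4)[OF p]]
      by (rule has_derivative_eq_rhs) (auto simp: algebra_simps)
  qed
qed

lemma bounded_diff_function_of_z:
  assumes "continuous_on {z. Im z > 0} f" "\<And>z. Im z > 0 \<Longrightarrow> norm (f z) \<le> C * hp_weight z ^ N"
  shows "bounded_diff S k (\<lambda>p z. f z)"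
proof -
  have pb: "power_bounded N S (\<lambda>p z. f z)"
    using assms by (auto simp: power_bounded_def)
  have zero: "bounded_diff S k (\<lambda>p z. 0)" for k
  proof (induction k)
    case 0
    show ?case
      unfolding bounded_diff_0 by (rule exI[of _ 0]) (auto simp: power_bounded_def)
  next
    case (Suc k)
    show ?case
      by (rule bounded_diff_SucI[OF _ Suc Suc, of 0]) (auto simp: power_bounded_def)
  qed
  show ?thesis
    using pb zero by (cases k) (auto simp: bounded_diff_0 intro!: bounded_diff_SucI[OF pb zero zero])
qed

lemma bounded_diff_const: "bounded_diff S k (\<lambda>p z. c)"
  by (rule bounded_diff_function_of_z[of _ "norm c" 0]) auto

text \<open>The partial derivatives of 1/h are -(1/h) h1 (1/h) and -(1/h) h2 (1/h), so in the
  induction on the order the only new bound is the one for 1/h itself.\<close>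

lemma bounded_diff_inverse:
  assumes "bounded_diff S k h" "\<And>p z. p \<in> S \<Longrightarrow> Im z > 0 \<Longrightarrow> h p z \<noteq> 0"
    "\<And>p z. p \<in> S \<Longrightarrow> Im z > 0 \<Longrightarrow> norm (inverse (h p z)) \<le> C * hp_weight z ^ N"
  shows "bounded_diff S k (\<lambda>p z. inverse (h p z))"
  using assms(1)
proof (induction k)
  have pb: "power_bounded N S (\<lambda>p z. inverse (h p z))" if "power_bounded M S h" for M
    using assms(2,3) by (intro power_boundedI continuous_intros power_bounded_continuous[OF that]) auto
  {
    case 0
    then show ?case
      unfolding bounded_diff_0 using pb by blast
  next
    case (Suc k)
    obtain M h1 h2 where 1: "power_bounded M S h" "bounded_diff S k h1" "bounded_diff S k h2"
      "\<And>p z. p \<in> S \<Longrightarrow> Im z > 0 \<Longrightarrow>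
         ((\<lambda>p. h p z) has_derivative (\<lambda>v. fst v *\<^sub>R h1 p z + snd v *\<^sub>R h2 p z)) (at p)"
      using Suc.prems(1) by (rule bounded_diff_SucE) blast
    have IH: "bounded_diff S k (\<lambda>p z. inverse (h p z))"
      using Suc bounded_diff_Suc_imp by blast
    show ?case
    proof (rule bounded_diff_SucI[OF pb[OF 1(1)]])
      show "bounded_diff S k (\<lambda>p z. - 1 * (inverse (h p z) * (h1 p z * inverse (h p z))))"
        "bounded_diff S k (\<lambda>p z. - 1 * (inverse (h p z) * (h2 p z * inverse (h p z))))"
        by (intro bounded_diff_mult bounded_diff_const IH 1)+
      fix p z assume p: "p \<in> S" "Im z > 0"
      have alg: "- (u * (a *\<^sub>R x + b *\<^sub>R y) * u) = a *\<^sub>R (- 1 * (u * (x * u))) + b *\<^sub>R (- 1 * (u * (y * u)))"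
        for u x y :: complex and a b
        by (simp only: mult_scaleR_left mult_scaleR_right ring_distribs minus_add_distrib scaleR_minus_right
          mult_1_left mult_minus_left mult.assoc)
      show "((\<lambda>p. inverse (h p z)) has_derivative
         (\<lambda>v. fst v *\<^sub>R (- 1 * (inverse (h p z) * (h1 p z * inverse (h p z)))) +
              snd v *\<^sub>R (- 1 * (inverse (h p z) * (h2 p z * inverse (h p z)))))) (at p)"
        by (rule has_derivative_eq_rhs[OF Deriv.has_derivative_inverse[OF assms(2)[OF p] 1(4)[OF p]]])
          (simp only: alg)
    qed
  }
qed

section \<open>Differentiation under the integral sign\<close>

lemma norm_mult_scaleR_inverse:
  fixes g r :: complex and v :: "'a::real_normed_vector"
  shows "norm (g * (r /\<^sub>R norm v)) = norm g * (norm r / norm v)"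
  by (simp add: norm_mult divide_inverse mult.commute)

lemma has_bochner_integral_quotient:
  fixes a b c d :: "'b \<Rightarrow> complex"
  assumes "integrable m a" "integrable m b" "integrable m c" "integrable m d"
  shows "has_bochner_integral m (\<lambda>\<omega>. (a \<omega> - b \<omega> - (s *\<^sub>R c \<omega> + t *\<^sub>R d \<omega>)) /\<^sub>R r)
    ((integral\<^sup>L m a - integral\<^sup>L m b - (s *\<^sub>R integral\<^sup>L m c + t *\<^sub>R integral\<^sup>L m d)) /\<^sub>R r)"
  using assms unfolding has_bochner_integral_iff by simp

text \<open>The assumption \<open>int\<close> is the majorant, up to constants, for every h of
  growth N and so for all derivatives at once. Convexity of S is there for the mean value
  inequality. The locale is instantiated on horizontal lines and on the strip between heights 0 and
  1.\<close>

locale weighted_param =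
  fixes S :: "(real \<times> real) set" and m :: "'b measure" and g :: "'b \<Rightarrow> complex"
    and \<zeta> :: "'b \<Rightarrow> complex" and N :: nat
  assumes S: "open S" "convex S"
    and g [measurable]: "g \<in> borel_measurable m"
    and \<zeta> [measurable]: "\<zeta> \<in> borel_measurable m"
    and Im_pos: "\<And>\<omega>. \<omega> \<in> space m \<Longrightarrow> Im (\<zeta> \<omega>) > 0"
    and int: "integrable m (\<lambda>\<omega>. norm (g \<omega>) * hp_weight (\<zeta> \<omega>) ^ N)"
begin

lemma measurable_h:
  assumes "power_bounded N S h" "p \<in> S"
  shows "(\<lambda>\<omega>. h p (\<zeta> \<omega>)) \<in> borel_measurable m"
  by (rule borel_measurable_half_plane[where q = "h p", OF power_bounded_continuous(2)[OF assms] \<zeta> Im_pos])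

lemma integrable_h:
  assumes "power_bounded N S h" "p \<in> S"
  shows "integrable m (\<lambda>\<omega>. g \<omega> * h p (\<zeta> \<omega>))"
proof -
  obtain C where C: "\<And>p z. p \<in> S \<Longrightarrow> Im z > 0 \<Longrightarrow> norm (h p z) \<le> C * hp_weight z ^ N"
    using assms(1) by (rule power_boundedE) blast
  show ?thesis
  proof (rule Bochner_Integration.integrable_bound)
    show "integrable m (\<lambda>\<omega>. C * (norm (g \<omega>) * hp_weight (\<zeta> \<omega>) ^ N))"
      using int by simp
    show "(\<lambda>\<omega>. g \<omega> * h p (\<zeta> \<omega>)) \<in> borel_measurable m"
      using measurable_h[OF assms] by simp
    have "norm (g \<omega> * h p (\<zeta> \<omega>)) \<le> norm (C * (norm (g \<omega>) * hp_weight (\<zeta> \<omega>) ^ N))"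
      if "\<omega> \<in> space m" for \<omega>
    proof -
      have "norm (g \<omega> * h p (\<zeta> \<omega>)) \<le> norm (g \<omega>) * (C * hp_weight (\<zeta> \<omega>) ^ N)"
        unfolding norm_mult using C[OF assms(2) Im_pos[OF that]] by (intro mult_left_mono) auto
      then show ?thesis
        by (simp add: mult_ac)
    qed
    then show "AE \<omega> in m. norm (g \<omega> * h p (\<zeta> \<omega>)) \<le> norm (C * (norm (g \<omega>) * hp_weight (\<zeta> \<omega>) ^ N))"
      by simp
  qed
qed

lemma continuous_integral:
  assumes "power_bounded N S h"
  shows "continuous_on S (\<lambda>p. \<integral>\<omega>. g \<omega> * h p (\<zeta> \<omega>) \<partial>m)"
proof -
  obtain C where C: "\<And>p z. p \<in> S \<Longrightarrow> Im z > 0 \<Longrightarrow> norm (h p z) \<le> C * hp_weight z ^ N"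
    using assms(1) by (rule power_boundedE) blast
  show ?thesis
    unfolding continuous_on_sequentially o_def
  proof (intro allI ballI impI, elim conjE)
    fix X p assume p: "p \<in> S" and X: "\<forall>n. X n \<in> S" "X \<longlonglongrightarrow> p"
    show "(\<lambda>n. \<integral>\<omega>. g \<omega> * h (X n) (\<zeta> \<omega>) \<partial>m) \<longlonglongrightarrow> (\<integral>\<omega>. g \<omega> * h p (\<zeta> \<omega>) \<partial>m)"
    proof (rule integral_dominated_convergence)
      show "integrable m (\<lambda>\<omega>. C * (norm (g \<omega>) * hp_weight (\<zeta> \<omega>) ^ N))"
        using int by simp
      show "(\<lambda>\<omega>. g \<omega> * h p (\<zeta> \<omega>)) \<in> borel_measurable m"
        "(\<lambda>\<omega>. g \<omega> * h (X n) (\<zeta> \<omega>)) \<in> borel_measurable m" for n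
        using measurable_h[OF assms p] measurable_h[OF assms X(1)[rule_format, of n]] by simp_all
      have "(\<lambda>n. h (X n) (\<zeta> \<omega>)) \<longlonglongrightarrow> h p (\<zeta> \<omega>)" if "\<omega> \<in> space m" for \<omega>
      proof -
        have "continuous_on S (\<lambda>p. h p (\<zeta> \<omega>))"
          using assms Im_pos[OF that] by (simp add: power_bounded_def)
        then show ?thesis
          using p X by (auto simp: continuous_on_sequentially o_def)
      qed
      then show "AE \<omega> in m. (\<lambda>n. g \<omega> * h (X n) (\<zeta> \<omega>)) \<longlonglongrightarrow> g \<omega> * h p (\<zeta> \<omega>)"
        by (auto intro!: tendsto_intros)
      have "norm (g \<omega> * h (X n) (\<zeta> \<omega>)) \<le> C * (norm (g \<omega>) * hp_weight (\<zeta> \<omega>) ^ N)"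
        if "\<omega> \<in> space m" for \<omega> n
      proof -
        have "norm (g \<omega> * h (X n) (\<zeta> \<omega>)) \<le> norm (g \<omega>) * (C * hp_weight (\<zeta> \<omega>) ^ N)"
          unfolding norm_mult using C[of "X n", OF _ Im_pos[OF that]] X by (intro mult_left_mono) auto
        then show ?thesis
          by (simp add: mult_ac)
      qed
      then show "AE \<omega> in m. norm (g \<omega> * h (X n) (\<zeta> \<omega>)) \<le> C * (norm (g \<omega>) * hp_weight (\<zeta> \<omega>) ^ N)" for n
        by simp
    qed
  qed
qed

text \<open>Dominated convergence for the remainder quotients. The remainder is the increment of h
  minus the linear term; the mean value inequality on S bounds the increment, and the triangle
  inequality the linear term, each by C1 + C2 times the weight and the length of the step, hence the
  factor 2.\<close>

lemma has_derivative_integral: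
  assumes h: "power_bounded N S h" "power_bounded N S h1" "power_bounded N S h2" and p: "p \<in> S"
    and der: "\<And>p z. p \<in> S \<Longrightarrow> Im z > 0 \<Longrightarrow>
         ((\<lambda>p. h p z) has_derivative (\<lambda>v. fst v *\<^sub>R h1 p z + snd v *\<^sub>R h2 p z)) (at p)"
  shows "((\<lambda>p. \<integral>\<omega>. g \<omega> * h p (\<zeta> \<omega>) \<partial>m) has_derivative
    (\<lambda>v. fst v *\<^sub>R (\<integral>\<omega>. g \<omega> * h1 p (\<zeta> \<omega>) \<partial>m) + snd v *\<^sub>R (\<integral>\<omega>. g \<omega> * h2 p (\<zeta> \<omega>) \<partial>m))) (at p)"
    (is "(?I has_derivative ?D) (at p)")
proof -
  obtain C1 where C1: "C1 \<ge> 0" "\<And>p z. p \<in> S \<Longrightarrow> Im z > 0 \<Longrightarrow> norm (h1 p z) \<le> C1 * hp_weight z ^ N"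
    using h(2) by (rule power_boundedE) blast
  obtain C2 where C2: "C2 \<ge> 0" "\<And>p z. p \<in> S \<Longrightarrow> Im z > 0 \<Longrightarrow> norm (h2 p z) \<le> C2 * hp_weight z ^ N"
    using h(3) by (rule power_boundedE) blast
  have lin: "norm (fst v *\<^sub>R h1 q z + snd v *\<^sub>R h2 q z) \<le> ((C1 + C2) * hp_weight z ^ N) * norm v"
    if "q \<in> S" "Im z > 0" for q z v
  proof -
    have "norm (fst v *\<^sub>R h1 q z + snd v *\<^sub>R h2 q z) \<le> \<bar>fst v\<bar> * norm (h1 q z) + \<bar>snd v\<bar> * norm (h2 q z)"
      by (metis norm_scaleR norm_triangle_ineq)
    also have "\<dots> \<le> norm v * (C1 * hp_weight z ^ N) + norm v * (C2 * hp_weight z ^ N)"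
      using C1(2)[OF that] C2(2)[OF that] norm_fst_le[of "fst v" "snd v"] norm_snd_le[of "snd v" "fst v"]
      by (intro add_mono mult_mono) auto
    finally show ?thesis
      by (simp add: algebra_simps)
  qed
  have mvt: "norm (h q z - h p z) \<le> ((C1 + C2) * hp_weight z ^ N) * norm (q - p)"
    if "q \<in> S" "Im z > 0" for q z
  proof (rule differentiable_bound[OF S(2)])
    show "((\<lambda>p. h p z) has_derivative (\<lambda>v. fst v *\<^sub>R h1 x z + snd v *\<^sub>R h2 x z)) (at x within S)"
      if "x \<in> S" for x
      using der[OF that \<open>Im z > 0\<close>] by (rule has_derivative_at_withinI)
    show "onorm (\<lambda>v. fst v *\<^sub>R h1 x z + snd v *\<^sub>R h2 x z) \<le> (C1 + C2) * hp_weight z ^ N"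
      if "x \<in> S" for x
      by (rule onorm_le) (rule lin[OF that \<open>Im z > 0\<close>])
  qed (use that p in auto)
  show ?thesis
    unfolding has_derivative_iff_norm
  proof
    show "bounded_linear ?D"
      by (intro bounded_linear_add bounded_linear_scaleR_left[THEN bounded_linear_compose]
           bounded_linear_fst bounded_linear_snd)
    \<comment> \<open>S is open, so the limit may be taken within S, where all points of a sequence
      obey the bounds.\<close>
    have "((\<lambda>y. norm (?I y - ?I p - ?D (y - p)) / norm (y - p)) \<longlongrightarrow> 0) (at p within S)"
      unfolding tendsto_at_iff_sequentially o_def
    proof (intro allI impI)
      fix X assume X: "\<forall>i. X i \<in> S - {p}" "X \<longlonglongrightarrow> p"
      define q where "q i = (\<lambda>\<omega>. (g \<omega> * h (X i) (\<zeta> \<omega>) - g \<omega> * h p (\<zeta> \<omega>) -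
        (fst (X i - p) *\<^sub>R (g \<omega> * h1 p (\<zeta> \<omega>)) + snd (X i - p) *\<^sub>R (g \<omega> * h2 p (\<zeta> \<omega>)))) /\<^sub>R norm (X i - p))" for i
      have q_alt: "q i \<omega> = g \<omega> * ((h (X i) (\<zeta> \<omega>) - h p (\<zeta> \<omega>) -
        (fst (X i - p) *\<^sub>R h1 p (\<zeta> \<omega>) + snd (X i - p) *\<^sub>R h2 p (\<zeta> \<omega>))) /\<^sub>R norm (X i - p))" for i \<omega>
        by (simp only: q_def mult_scaleR_left mult_scaleR_right ring_distribs)
      have hb: "has_bochner_integral m (q i) ((?I (X i) - ?I p - ?D (X i - p)) /\<^sub>R norm (X i - p))" for i
      proof -
        have "X i \<in> S"
          using X(1)[rule_format, of i] by (rule DiffD1)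
        show ?thesis
          unfolding q_def
          by (rule has_bochner_integral_quotient[OF integrable_h[OF h(1) \<open>X i \<in> S\<close>] integrable_h[OF h(1) p]
                integrable_h[OF h(2) p] integrable_h[OF h(3) p]])
      qed
      then have int_q: "integrable m (q i)" for i
        by (rule integrable.intros)
      have norm_eq: "norm (?I (X i) - ?I p - ?D (X i - p)) / norm (X i - p) = norm (\<integral>\<omega>. q i \<omega> \<partial>m)" for i
        unfolding has_bochner_integral_integral_eq[OF hb] by (simp add: divide_inverse mult.commute)
      have "(\<lambda>i. \<integral>\<omega>. q i \<omega> \<partial>m) \<longlonglongrightarrow> (\<integral>\<omega>. 0 \<partial>m)"
      proof (rule integral_dominated_convergence)
        show "integrable m (\<lambda>\<omega>. (2 * (C1 + C2)) * (norm (g \<omega>) * hp_weight (\<zeta> \<omega>) ^ N))"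
          using int by simp
        show "q i \<in> borel_measurable m" for i
          by (rule borel_measurable_integrable[OF int_q])
        have "(\<lambda>i. q i \<omega>) \<longlonglongrightarrow> 0" if "\<omega> \<in> space m" for \<omega>
        proof (rule tendsto_norm_zero_cancel)
          define e where "e y = norm (h y (\<zeta> \<omega>) - h p (\<zeta> \<omega>) - (fst (y - p) *\<^sub>R h1 p (\<zeta> \<omega>) + snd (y - p) *\<^sub>R h2 p (\<zeta> \<omega>))) / norm (y - p)" for y
          have "(e \<longlongrightarrow> 0) (at p within S)"
            using der[OF p Im_pos[OF that]] unfolding has_derivative_iff_norm at_within_open[OF p S(1)] e_def
            by (rule conjunct2)
          then have "(\<lambda>i. e (X i)) \<longlonglongrightarrow> 0"
            using X by (simp add: tendsto_at_iff_sequentially o_def)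
          then have "(\<lambda>i. norm (g \<omega>) * e (X i)) \<longlonglongrightarrow> 0"
            by (rule tendsto_mult_right_zero)
          then show "(\<lambda>i. norm (q i \<omega>)) \<longlonglongrightarrow> 0"
            unfolding q_alt norm_mult_scaleR_inverse e_def .
        qed
        then show "AE \<omega> in m. (\<lambda>i. q i \<omega>) \<longlonglongrightarrow> 0"
          by simp
        have "norm (q i \<omega>) \<le> (2 * (C1 + C2)) * (norm (g \<omega>) * hp_weight (\<zeta> \<omega>) ^ N)"
          if "\<omega> \<in> space m" for i \<omega>
        proof -
          define r where "r = h (X i) (\<zeta> \<omega>) - h p (\<zeta> \<omega>) -
            (fst (X i - p) *\<^sub>R h1 p (\<zeta> \<omega>) + snd (X i - p) *\<^sub>R h2 p (\<zeta> \<omega>))"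
          have "norm r \<le> norm (h (X i) (\<zeta> \<omega>) - h p (\<zeta> \<omega>)) +
              norm (fst (X i - p) *\<^sub>R h1 p (\<zeta> \<omega>) + snd (X i - p) *\<^sub>R h2 p (\<zeta> \<omega>))"
            unfolding r_def by (rule norm_triangle_ineq4)
          also have "\<dots> \<le> ((C1 + C2) * hp_weight (\<zeta> \<omega>) ^ N) * norm (X i - p) +
              ((C1 + C2) * hp_weight (\<zeta> \<omega>) ^ N) * norm (X i - p)"
            by (intro add_mono mvt lin p Im_pos that X(1)[rule_format, THEN DiffD1])
          finally have "norm r \<le> (2 * (C1 + C2) * hp_weight (\<zeta> \<omega>) ^ N) * norm (X i - p)"
            by (simp only: mult_2[symmetric] mult.assoc)
          then have "norm r / norm (X i - p) \<le> 2 * (C1 + C2) * hp_weight (\<zeta> \<omega>) ^ N"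
            using X(1)[rule_format, of i] by (subst pos_divide_le_eq) auto
          then have "norm (g \<omega>) * (norm r / norm (X i - p)) \<le> norm (g \<omega>) * (2 * (C1 + C2) * hp_weight (\<zeta> \<omega>) ^ N)"
            by (intro mult_left_mono) auto
          then show ?thesis
            unfolding q_alt r_def[symmetric] norm_mult_scaleR_inverse by (simp only: mult_ac)
        qed
        then show "AE \<omega> in m. norm (q i \<omega>) \<le> (2 * (C1 + C2)) * (norm (g \<omega>) * hp_weight (\<zeta> \<omega>) ^ N)" for i
          by simp
      qed auto
      then show "(\<lambda>i. norm (?I (X i) - ?I p - ?D (X i - p)) / norm (X i - p)) \<longlonglongrightarrow> 0"
        unfolding norm_eq by (auto intro: tendsto_norm_zero)
    qed
    then show "((\<lambda>y. norm (?I y - ?I p - ?D (y - p)) / norm (y - p)) \<longlongrightarrow> 0) (at p)"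
      unfolding at_within_open[OF p S(1)] .
  qed
qed

lemma C_k_on_integral:
  assumes "diff_upto N S k h"
  shows "C_k_on S (\<lambda>p. \<integral>\<omega>. g \<omega> * h p (\<zeta> \<omega>) \<partial>m) k"
  using assms
proof (induction k arbitrary: h)
  case 0
  then show ?case
    by (simp add: continuous_integral)
next
  case (Suc k)
  then obtain h1 h2 where h: "power_bounded N S h" "diff_upto N S k h1" "diff_upto N S k h2"
    "\<And>p z. p \<in> S \<Longrightarrow> Im z > 0 \<Longrightarrow>
       ((\<lambda>p. h p z) has_derivative (\<lambda>v. fst v *\<^sub>R h1 p z + snd v *\<^sub>R h2 p z)) (at p)"
    by auto
  show ?case
  proof (rule C_k_on_SucI[OF S(1)])
    show "((\<lambda>p. \<integral>\<omega>. g \<omega> * h p (\<zeta> \<omega>) \<partial>m) has_derivative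
      (\<lambda>v. fst v *\<^sub>R (\<integral>\<omega>. g \<omega> * h1 p (\<zeta> \<omega>) \<partial>m) + snd v *\<^sub>R (\<integral>\<omega>. g \<omega> * h2 p (\<zeta> \<omega>) \<partial>m))) (at p)"
      if "p \<in> S" for p
      using h(1) diff_upto_power_bounded[OF h(2)] diff_upto_power_bounded[OF h(3)] that h(4)
      by (rule has_derivative_integral)
    show "C_k_on S (\<lambda>p. fst v *\<^sub>R (\<integral>\<omega>. g \<omega> * h1 p (\<zeta> \<omega>) \<partial>m) + snd v *\<^sub>R (\<integral>\<omega>. g \<omega> * h2 p (\<zeta> \<omega>) \<partial>m)) k" for v
      using Suc.IH h by (intro C_k_on_lincomb S(1))
  qed
qed

end

section \<open>Existence of Herglotz representations\<close>

definition circ :: "real \<Rightarrow> complex" where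
  "circ x = exp (2 * of_real pi * \<i> * of_real x)"

lemma norm_circ [simp]: "norm (circ x) = 1"
  and circ_nonzero [simp]: "circ x \<noteq> 0"
  and continuous_circ: "continuous_on A circ"
  and cnj_circ: "cnj (circ x) = inverse (circ x)"
  by (auto simp: circ_def exp_minus[symmetric] exp_cnj intro!: continuous_intros)

lemma circ_minus_nonzero: "norm w < 1 \<Longrightarrow> circ x - w \<noteq> 0"
  using norm_circ[of x] by (metis eq_iff_diff_eq_0 less_irrefl)

text \<open>On |u| = r with u = r \<open>circ x\<close> one has du / (u - rw) = 2\<pi>i
  \<open>circ x / (circ x - w)\<close> dx. Evaluation at rw instead of w keeps the kernel
  independent of r, so that only the density changes as r tends to 1.\<close>

lemma has_integral_Cauchy_circ:
  assumes "continuous_on (cball 0 r) f" "f holomorphic_on ball 0 r" "r > 0" "norm w < 1"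
  shows "((\<lambda>x. f (of_real r * circ x) * (circ x / (circ x - w))) has_integral f (of_real r * w)) {0..1}"
proof -
  have "((\<lambda>u. f u / (u - of_real r * w)) has_contour_integral (2 * of_real pi * \<i> * f (of_real r * w)))
         (circlepath 0 r)"
    using assms by (intro Cauchy_integral_circlepath) (auto simp: norm_mult)
  then have "((\<lambda>x. 2 * of_real pi * \<i> * (f (of_real r * circ x) * (circ x / (circ x - w))))
      has_integral (2 * of_real pi * \<i> * f (of_real r * w))) {0..1}"
    unfolding has_contour_integral_def
  proof (rule has_integral_eq[rotated])
    fix x :: real assume x: "x \<in> {0..1}"
    have c: "circlepath 0 r x = of_real r * circ x"
      by (simp add: circlepath circ_def)
    have d: "vector_derivative (circlepath 0 r) (at x within {0..1}) = 2 * of_real pi * \<i> * of_real r * circ x"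
      using x by (simp add: vector_derivative_circlepath01 circ_def)
    show "f (circlepath 0 r x) / (circlepath 0 r x - of_real r * w) *
          vector_derivative (circlepath 0 r) (at x within {0..1}) =
          2 * of_real pi * \<i> * (f (of_real r * circ x) * (circ x / (circ x - w)))"
      unfolding c d right_diff_distrib[symmetric]
      using assms(3) circ_minus_nonzero[OF assms(4), of x] by (simp add: field_simps)
  qed
  then have "((\<lambda>x. inverse (2 * of_real pi * \<i>) * (2 * of_real pi * \<i> * (f (of_real r * circ x) * (circ x / (circ x - w)))))
      has_integral inverse (2 * of_real pi * \<i>) * (2 * of_real pi * \<i> * f (of_real r * w))) {0..1}"
    by (rule has_integral_mult_right)
  then show ?thesis
    by (simp add: field_simps)
qed

text \<open>Schwarz integral formula. Cauchy's formula gives G(rw); a second application, at the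
  centre and to G(u) / (1 - cnj(w) u / r), gives G(0), and its conjugate carries the same kernel
  because 1 - w / \<open>circ x\<close> = (\<open>circ x\<close> - w) / \<open>circ x\<close>. The
  sum replaces G by twice its real part.\<close>

lemma has_integral_Schwarz_circ:
  assumes G: "G holomorphic_on ball 0 1" and r: "0 < r" "r < 1" and w: "norm w < 1"
  shows "((\<lambda>x. of_real (Re (G (of_real r * circ x))) * (2 * circ x / (circ x - w)))
    has_integral (G (of_real r * w) + cnj (G 0))) {0..1}"
proof -
  have sub: "cball 0 r \<subseteq> ball 0 1" "ball 0 r \<subseteq> cball (0::complex) r"
    using r by auto
  have 1: "((\<lambda>x. G (of_real r * circ x) * (circ x / (circ x - w))) has_integral G (of_real r * w)) {0..1}"
    using G r w sub by (intro has_integral_Cauchy_circ)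
      (auto intro: holomorphic_on_imp_continuous_on holomorphic_on_subset)
  define f where "f u = G u / (1 - cnj w * u / of_real r)" for u
  have nz: "1 - cnj w * u / of_real r \<noteq> 0" if "u \<in> cball 0 r" for u
  proof -
    have "norm u * norm w \<le> r * norm w"
      using that by (intro mult_right_mono) auto
    also have "\<dots> < r"
      using w r by simp
    finally have "norm (cnj w * u / of_real r) < 1"
      using r by (simp add: norm_mult norm_divide mult.commute)
    then show ?thesis
      by (metis eq_iff_diff_eq_0 norm_one less_irrefl)
  qed
  have holf: "f holomorphic_on cball 0 r"
    unfolding f_def using G r sub nz by (intro holomorphic_intros holomorphic_on_subset[OF G]) auto
  have "((\<lambda>x. f (of_real r * circ x) * (circ x / (circ x - 0))) has_integral f (of_real r * 0)) {0..1}"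
    using r sub by (intro has_integral_Cauchy_circ holomorphic_on_imp_continuous_on holf
        holomorphic_on_subset[OF holf]) auto
  then have "((\<lambda>x. cnj (f (of_real r * circ x))) has_integral cnj (G 0)) {0..1}"
    by (subst (asm) has_integral_cnj[symmetric]) (simp add: f_def o_def)
  also have "(\<lambda>x. cnj (f (of_real r * circ x))) = (\<lambda>x. cnj (G (of_real r * circ x)) * (circ x / (circ x - w)))"
  proof
    fix x
    have "circ x * (1 - w * inverse (circ x)) = circ x - w"
      by (simp add: algebra_simps)
    then have "1 - w * inverse (circ x) = (circ x - w) / circ x"
      by (simp add: field_simps)
    then show "cnj (f (of_real r * circ x)) = cnj (G (of_real r * circ x)) * (circ x / (circ x - w))"
      unfolding f_def using r by (simp add: cnj_circ)
  qed
  finally have "((\<lambda>x. G (of_real r * circ x) * (circ x / (circ x - w)) +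
      cnj (G (of_real r * circ x)) * (circ x / (circ x - w)))
      has_integral (G (of_real r * w) + cnj (G 0))) {0..1}"
    by (rule has_integral_add[OF 1])
  moreover have "G (of_real r * circ x) * (circ x / (circ x - w)) + cnj (G (of_real r * circ x)) * (circ x / (circ x - w)) =
      of_real (Re (G (of_real r * circ x))) * (2 * circ x / (circ x - w))" for x
  proof -
    have "G (of_real r * circ x) * (circ x / (circ x - w)) + cnj (G (of_real r * circ x)) * (circ x / (circ x - w)) =
       (G (of_real r * circ x) + cnj (G (of_real r * circ x))) * (circ x / (circ x - w))"
      by (simp only: distrib_right)
    also have "\<dots> = of_real (2 * Re (G (of_real r * circ x))) * (circ x / (circ x - w))"
      by (simp add: complex_add_cnj)
    finally show ?thesis
      by simp
  qed
  ultimately show ?thesis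
    by simp
qed

lemma continuous_circ_kernel:
  assumes "norm w < 1"
  shows "continuous_on A (\<lambda>x. 2 * circ x / (circ x - w))"
    and "norm (2 * circ x / (circ x - w)) \<le> 2 / (1 - norm w)"
proof -
  show "continuous_on A (\<lambda>x. 2 * circ x / (circ x - w))"
    using assms circ_minus_nonzero by (intro continuous_intros continuous_circ) auto
  have "1 - norm w \<le> norm (circ x - w)"
    using norm_triangle_ineq2[of "circ x" w] by simp
  then show "norm (2 * circ x / (circ x - w)) \<le> 2 / (1 - norm w)"
    using assms by (auto simp: norm_divide norm_mult intro!: frac_le)
qed

text \<open>Helly's theorem extracts the boundary measure of a function with positive real part
  from its values on circles of radius tending to 1.\<close>

theorem Herglotz_disc:
  assumes G: "G holomorphic_on ball 0 1" and pos: "\<And>w. norm w < 1 \<Longrightarrow> Re (G w) > 0"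
  obtains M where "real_distribution M"
    "\<And>w. norm w < 1 \<Longrightarrow>
      G w + cnj (G 0) = of_real (Re (G 0)) * (\<integral>x. 2 * circ x / (circ x - w) \<partial>M)"
proof -
  define m where "m = Re (G 0)"
  have m: "m > 0"
    using pos[of 0] by (simp add: m_def)
  \<comment> \<open>Division by m = Re G(0) normalises: at w = 0 the kernel is the constant 2 and
    the Schwarz formula gives 2m, so the density has total mass 1.\<close>
  define \<rho> where "\<rho> r x = indicator {0..1} x * (Re (G (of_real r * circ x)) / m)" for r x :: real
  define \<mu> where "\<mu> r = density lborel (\<lambda>x. ennreal (\<rho> r x))" for r
  have cont: "continuous_on A (\<lambda>x. Re (G (of_real r * circ x)))" if "0 < r" "r < 1" for A r
  proof -
    have "continuous_on A (\<lambda>x. G (of_real r * circ x))"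
      using that by (intro continuous_on_compose2[OF holomorphic_on_imp_continuous_on[OF G]]
          continuous_intros continuous_circ) (auto simp: norm_mult)
    then show ?thesis
      by (intro continuous_intros)
  qed
  have meas [measurable]: "\<rho> r \<in> borel_measurable borel" if "0 < r" "r < 1" for r
    unfolding \<rho>_def
    by (intro borel_measurable_times borel_measurable_indicator borel_measurable_divide
        borel_measurable_const borel_measurable_continuous_onI cont that) auto
  have nonneg: "\<rho> r x \<ge> 0" if "0 < r" "r < 1" for r x
    unfolding \<rho>_def using pos[of "of_real r * circ x"] m that by (auto simp: norm_mult indicator_def)
  have int: "integrable lborel (\<lambda>x. \<rho> r x *\<^sub>R (2 * circ x / (circ x - w)))"
    "(\<integral>x. \<rho> r x *\<^sub>R (2 * circ x / (circ x - w)) \<partial>lborel) = (G (of_real r * w) + cnj (G 0)) / of_real m"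
    if r: "0 < r" "r < 1" and w: "norm w < 1" for r w
  proof -
    define h where "h x = of_real (Re (G (of_real r * circ x))) * (2 * circ x / (circ x - w))" for x
    have eq: "(\<lambda>x. \<rho> r x *\<^sub>R (2 * circ x / (circ x - w))) = (\<lambda>x. (indicator {0..1} x *\<^sub>R h x) / of_real m)"
      by (rule ext) (simp add: \<rho>_def h_def scaleR_conv_of_real indicator_def)
    have "continuous_on {0..1} h"
      unfolding h_def by (intro continuous_intros cont r continuous_circ_kernel w)
    then have 1: "set_integrable lborel {0..1} h"
      by (rule borel_integrable_atLeastAtMost')
    then show "integrable lborel (\<lambda>x. \<rho> r x *\<^sub>R (2 * circ x / (circ x - w)))"
      unfolding eq set_integrable_def by simp
    have "(\<integral>x. indicator {0..1} x *\<^sub>R h x \<partial>lborel) = integral {0..1} h"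
      using set_borel_integral_eq_integral(2)[OF 1] by (simp add: set_lebesgue_integral_def)
    also have "\<dots> = G (of_real r * w) + cnj (G 0)"
      unfolding h_def by (rule integral_unique) (rule has_integral_Schwarz_circ[OF G r w])
    finally show "(\<integral>x. \<rho> r x *\<^sub>R (2 * circ x / (circ x - w)) \<partial>lborel) = (G (of_real r * w) + cnj (G 0)) / of_real m"
      unfolding eq by simp
  qed
  have mass: "integrable lborel (\<rho> r)" "(\<integral>x. \<rho> r x \<partial>lborel) = 1" if r: "0 < r" "r < 1" for r
  proof -
    have eq: "\<rho> r x *\<^sub>R (2 * circ x / (circ x - 0)) = of_real (2 * \<rho> r x)" for x
      by (simp add: scaleR_conv_of_real)
    have "integrable lborel (\<lambda>x. complex_of_real (2 * \<rho> r x))"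
      using int(1)[OF r, of 0] unfolding eq by simp
    then have i: "integrable lborel (\<lambda>x. 2 * \<rho> r x)"
      by (simp only: complex_of_real_integrable_eq)
    then show "integrable lborel (\<rho> r)"
      by simp
    have "complex_of_real (\<integral>x. 2 * \<rho> r x \<partial>lborel) = 2"
      using int(2)[OF r, of 0] m unfolding eq by (simp add: m_def complex_add_cnj)
    then show "(\<integral>x. \<rho> r x \<partial>lborel) = 1"
      by simp
  qed
  have dist: "real_distribution (\<mu> r)" if r: "0 < r" "r < 1" for r
  proof (intro real_distribution.intro real_distribution_axioms.intro prob_spaceI)
    have "emeasure (\<mu> r) (space (\<mu> r)) = (\<integral>\<^sup>+x. ennreal (\<rho> r x) \<partial>lborel)"
      using meas[OF r] by (simp add: \<mu>_def emeasure_density)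
    also have "\<dots> = 1"
      using nn_integral_eq_integral[OF mass(1)[OF r]] nonneg[OF r] mass(2)[OF r] by simp
    finally show "emeasure (\<mu> r) (space (\<mu> r)) = 1" .
  qed (auto simp: \<mu>_def)
  \<comment> \<open>The offset 2 makes the radii start at 1/2, inside the range 0 < r < 1 where the
    densities are controlled.\<close>
  define R where "R n = 1 - 1 / (real n + 2)" for n
  have R: "0 < R n" "R n < 1" for n
    by (auto simp: R_def field_simps)
  have R_lim: "R \<longlonglongrightarrow> 1"
    unfolding R_def by real_asymp
  have "tight (\<lambda>n. \<mu> (R n))"
    unfolding tight_def
  proof (intro conjI allI impI)
    show "real_distribution (\<mu> (R n))" for n
      using dist R by blast
    fix \<epsilon> :: real assume "\<epsilon> > 0"
    \<comment> \<open>All the mass lies in [0, 1]; the half-open interval fits the format of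
      \<open>tight\<close>.\<close>
    have "measure (\<mu> (R n)) {-1<..1} = 1" for n
    proof -
      interpret real_distribution "\<mu> (R n)"
        using dist R by blast
      have "AE x in \<mu> (R n). x \<in> {-1<..1}"
        unfolding \<mu>_def using meas[OF R, of n]
        by (subst AE_density) (simp, auto simp: \<rho>_def indicator_def)
      then show ?thesis
        by (intro prob_eq_1[THEN iffD2]) auto
    qed
    then show "\<exists>a b. a < b \<and> (\<forall>n. 1 - \<epsilon> < measure (\<mu> (R n)) {a<..b})"
      using \<open>\<epsilon> > 0\<close> by (intro exI[of _ "-1"] exI[of _ 1]) auto
  qed
  from tight_imp_convergent_subsubsequence[OF this strict_mono_id]
  obtain s M where s: "strict_mono s" and M: "real_distribution M"
    and conv: "weak_conv_m ((\<lambda>n. \<mu> (R n)) \<circ> id \<circ> s) M"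
    by blast
  have conv': "weak_conv_m (\<lambda>n. \<mu> (R (s n))) M"
    using conv by (simp add: o_def)
  have "G w + cnj (G 0) = of_real (Re (G 0)) * (\<integral>x. 2 * circ x / (circ x - w) \<partial>M)"
    if w: "norm w < 1" for w
  proof -
    have "(\<lambda>n. \<integral>x. 2 * circ x / (circ x - w) \<partial>\<mu> (R (s n))) \<longlonglongrightarrow> (\<integral>x. 2 * circ x / (circ x - w) \<partial>M)"
      using dist[OF R] M conv'
      by (rule weak_conv_imp_integral_bdd_continuous_conv)
        (use continuous_circ_kernel[OF w] continuous_on_eq_continuous_at[OF open_UNIV] in blast)+
    moreover have "(\<integral>x. 2 * circ x / (circ x - w) \<partial>\<mu> (R (s n))) = (G (of_real (R (s n)) * w) + cnj (G 0)) / of_real m" for n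
      unfolding \<mu>_def
      using R[of "s n"] meas[OF R] nonneg[OF R]
      by (subst integral_density)
        (auto simp: int(2) w intro!: borel_measurable_continuous_onI continuous_circ_kernel)
    moreover have "(\<lambda>n. (G (of_real (R (s n)) * w) + cnj (G 0)) / of_real m) \<longlonglongrightarrow> (G w + cnj (G 0)) / of_real m"
    proof -
      have "isCont G w"
        using holomorphic_on_imp_continuous_on[OF G] w
        by (simp add: continuous_on_eq_continuous_at)
      moreover have "(\<lambda>n. of_real (R (s n)) * w) \<longlonglongrightarrow> of_real 1 * w"
        using LIMSEQ_subseq_LIMSEQ[OF R_lim s] by (intro tendsto_intros) (simp add: o_def)
      ultimately have "(\<lambda>n. G (of_real (R (s n)) * w)) \<longlonglongrightarrow> G w"
        by (auto intro: isCont_tendsto_compose)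
      then show ?thesis
        using m by (intro tendsto_intros) auto
    qed
    ultimately have "(\<integral>x. 2 * circ x / (circ x - w) \<partial>M) = (G w + cnj (G 0)) / of_real m"
      using LIMSEQ_unique by auto
    then show ?thesis
      using m by (simp add: m_def)
  qed
  then show thesis
    using that M by blast
qed

text \<open>Cayley transform c of the disc into the half-plane. The boundary point
  \<open>circ x\<close> corresponds to the real point T x = -cot(\<pi> x), except for
  \<open>circ x\<close> = 1, which corresponds to infinity and whose mass becomes the linear
  coefficient b. The density m (1 + t^2) comes from (1 + tz) / (t - z) = (1 + t^2) (1 / (t - z) - t
  / (t^2 + 1)).\<close>

theorem Herglotz_half_plane:
  assumes F: "F holomorphic_on {z. Im z > 0}" and pos: "\<And>z. Im z > 0 \<Longrightarrow> Im (F z) > 0"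
  shows "\<exists>\<nu>. herglotz_measure F \<nu>"
proof -
  define c where "c w = \<i> * (1 + w) / (1 - w)" for w :: complex
  define G where "G w = - \<i> * F (c w)" for w
  have Im_c: "Im (c w) > 0" if "norm w < 1" for w
  proof -
    have nz: "1 - w \<noteq> 0"
      using that by auto
    have "c w = (\<i> * (1 + w)) * cnj (1 - w) / ((1 - w) * cnj (1 - w))"
      using nz unfolding c_def by (subst mult_divide_mult_cancel_right) auto
    then have "c w = \<i> * ((1 + w) * cnj (1 - w)) / of_real ((norm (1 - w))\<^sup>2)"
      by (simp only: complex_norm_square mult.assoc)
    then have "Im (c w) = Re ((1 + w) * cnj (1 - w)) / (norm (1 - w))\<^sup>2"
      by (simp add: Im_divide_of_real)
    also have "Re ((1 + w) * cnj (1 - w)) = 1 - (norm w)\<^sup>2"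
      unfolding cmod_power2 by (simp add: algebra_simps power2_eq_square)
    finally show ?thesis
      using nz that by (simp add: power_less_one_iff abs_square_less_1)
  qed
  have "c holomorphic_on ball 0 1"
    unfolding c_def by (intro holomorphic_intros) auto
  then have "(F \<circ> c) holomorphic_on ball 0 1"
    using Im_c by (intro holomorphic_on_compose_gen[OF _ F]) auto
  then have "G holomorphic_on ball 0 1"
    unfolding G_def o_def by (intro holomorphic_intros)
  moreover have "Re (G w) > 0" if "norm w < 1" for w
    using pos[OF Im_c[OF that]] by (simp add: G_def)
  ultimately obtain M where M: "real_distribution M"
    and rep: "\<And>w. norm w < 1 \<Longrightarrow>
      G w + cnj (G 0) = of_real (Re (G 0)) * (\<integral>x. 2 * circ x / (circ x - w) \<partial>M)"
    using Herglotz_disc by blast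
  interpret real_distribution M
    by fact
  define m where "m = Re (G 0)"
  have c0: "c 0 = \<i>"
    by (simp add: c_def)
  have m: "m = Im (F \<i>)" "m > 0"
    using pos[of \<i>] by (auto simp: m_def G_def c0)
  define A where "A = {x::real. sin (pi * x) \<noteq> 0}"
  define T where "T x = - cot (pi * x)" for x :: real
  define B where "B = density M (indicator A)"
  define \<nu> where "\<nu> = density (distr B borel T) (\<lambda>t. ennreal (m * (1 + t\<^sup>2)))"
  have [measurable]: "A \<in> sets borel"
    unfolding A_def by measurable
  have [measurable]: "T \<in> borel_measurable borel"
    unfolding T_def cot_def by measurable
  have [measurable]: "T \<in> B \<rightarrow>\<^sub>M borel"
    unfolding B_def by simp
  have nu_integral: "integrable \<nu> f \<longleftrightarrow> integrable M (\<lambda>x. indicator A x *\<^sub>R ((m * (1 + (T x)\<^sup>2)) *\<^sub>R f (T x)))"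
    "(\<integral>t. f t \<partial>\<nu>) = (\<integral>x. indicator A x *\<^sub>R ((m * (1 + (T x)\<^sup>2)) *\<^sub>R f (T x)) \<partial>M)"
    if [measurable]: "f \<in> borel_measurable borel" for f :: "real \<Rightarrow> 'a::{banach, second_countable_topology}"
  proof -
    have [measurable]: "f \<in> borel_measurable (distr B borel T)"
      by simp
    have B_eq: "B = density M (\<lambda>x. ennreal (indicator A x))"
      by (simp add: B_def ennreal_indicator)
    have "integrable \<nu> f \<longleftrightarrow> integrable (distr B borel T) (\<lambda>t. (m * (1 + t\<^sup>2)) *\<^sub>R f t)"
      unfolding \<nu>_def using m by (subst integrable_density) auto
    also have "\<dots> \<longleftrightarrow> integrable B (\<lambda>x. (m * (1 + (T x)\<^sup>2)) *\<^sub>R f (T x))"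
      by (subst integrable_distr_eq) auto
    also have "\<dots> \<longleftrightarrow> integrable M (\<lambda>x. indicator A x *\<^sub>R ((m * (1 + (T x)\<^sup>2)) *\<^sub>R f (T x)))"
      unfolding B_eq by (subst integrable_density) auto
    finally show "integrable \<nu> f \<longleftrightarrow> integrable M (\<lambda>x. indicator A x *\<^sub>R ((m * (1 + (T x)\<^sup>2)) *\<^sub>R f (T x)))" .
    have "(\<integral>t. f t \<partial>\<nu>) = (\<integral>t. (m * (1 + t\<^sup>2)) *\<^sub>R f t \<partial>distr B borel T)"
      unfolding \<nu>_def using m by (subst integral_density) auto
    also have "\<dots> = (\<integral>x. (m * (1 + (T x)\<^sup>2)) *\<^sub>R f (T x) \<partial>B)"
      by (subst integral_distr) auto
    also have "\<dots> = (\<integral>x. indicator A x *\<^sub>R ((m * (1 + (T x)\<^sup>2)) *\<^sub>R f (T x)) \<partial>M)"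
      unfolding B_eq by (subst integral_density) auto
    finally show "(\<integral>t. f t \<partial>\<nu>) = (\<integral>x. indicator A x *\<^sub>R ((m * (1 + (T x)\<^sup>2)) *\<^sub>R f (T x)) \<partial>M)" .
  qed
  have one_plus: "1 + t\<^sup>2 \<noteq> 0" "1 + t\<^sup>2 > 0" for t :: real
    by (simp_all add: add_nonneg_eq_0_iff add_pos_nonneg)
  show ?thesis
  proof (intro exI[of _ \<nu>])
    show "herglotz_measure F \<nu>"
      unfolding herglotz_measure_def
    proof (intro conjI allI impI exI)
      show sets_nu: "sets \<nu> = sets borel"
        by (simp add: \<nu>_def)
      show int1: "integrable \<nu> (\<lambda>t. 1 / (t\<^sup>2 + 1))"
      proof -
        have "integrable M (\<lambda>x. indicator A x *\<^sub>R m)"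
          using m by (intro integrable_const_bound[of _ m]) (auto simp: indicator_def)
        also have "(\<lambda>x. indicator A x *\<^sub>R m) = (\<lambda>x. indicator A x *\<^sub>R ((m * (1 + (T x)\<^sup>2)) *\<^sub>R (1 / ((T x)\<^sup>2 + 1))))"
          using one_plus by (auto simp: fun_eq_iff add.commute)
        finally show ?thesis
          by (subst nu_integral) auto
      qed
      fix K :: "real set" assume "compact K"
      then obtain b where b: "\<And>t. t \<in> K \<Longrightarrow> \<bar>t\<bar> \<le> b" and [measurable]: "K \<in> sets borel"
        using compact_imp_bounded bounded_real borel_compact by metis
      have "integrable \<nu> (\<lambda>t. indicator K t :: real)"
      proof (rule Bochner_Integration.integrable_bound)
        show "integrable \<nu> (\<lambda>t. (b\<^sup>2 + 1) * (1 / (t\<^sup>2 + 1)))"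
          using int1 by (intro integrable_mult_right)
        show "indicator K \<in> borel_measurable \<nu>"
          using sets_nu by (simp cong: measurable_cong_sets)
        have "norm (indicator K t :: real) \<le> norm ((b\<^sup>2 + 1) * (1 / (t\<^sup>2 + 1)))" for t
        proof (cases "t \<in> K")
          case True
          then have "t\<^sup>2 \<le> b\<^sup>2"
            using b[OF True] by (metis abs_ge_zero order_trans power2_abs power_mono)
          then show ?thesis
            using True one_plus[of t] by (simp add: add.commute)
        qed auto
        then show "AE t in \<nu>. norm (indicator K t :: real) \<le> norm ((b\<^sup>2 + 1) * (1 / (t\<^sup>2 + 1)))"
          by simp
      qed
      then show "emeasure \<nu> K < \<infinity>"
        using sets_nu by (simp add: integrable_indicator_iff sets_eq_imp_space_eq[OF sets_nu])
    next
      show "0 \<le> m * measure M (- A)"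
        using m by simp
    next
      fix z :: complex assume z: "Im z > 0"
      define w where "w = (z - \<i>) / (z + \<i>)"
      have zi: "z + \<i> \<noteq> 0"
        using z by (auto simp: complex_eq_iff)
      have "(norm (z - \<i>))\<^sup>2 < (norm (z + \<i>))\<^sup>2"
        using z unfolding cmod_power2 by (simp add: power2_eq_square algebra_simps)
      then have w: "norm w < 1"
        using zi by (simp add: w_def norm_divide power2_less_imp_less)
      have cw: "c w = z"
      proof -
        have w1: "1 + w = 2 * z / (z + \<i>)" "1 - w = 2 * \<i> / (z + \<i>)"
          using zi by (auto simp: w_def field_simps)
        show ?thesis
          unfolding c_def w1 using zi by simp
      qed
      \<comment> \<open>Off A the value z is the limit of (1 + tz) / (t - z) as t tends to
        infinity.\<close>
      define L where "L x = (if x \<in> A then (1 + of_real (T x) * z) / (of_real (T x) - z) else z)" for x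
      have K_eq: "2 * circ x / (circ x - w) = 1 - \<i> * L x" for x
      proof (cases "x \<in> A")
        case True
        then have s: "sin (pi * x) \<noteq> 0"
          by (simp add: A_def)
        define t where "t = T x"
        have tz: "of_real t - z \<noteq> 0" "of_real t + \<i> \<noteq> 0"
          using z by (auto simp: complex_eq_iff)
        have "circ x = (cis (pi * x))\<^sup>2"
          by (simp add: circ_def cis_conv_exp exp_double[symmetric] mult_ac)
        moreover have "of_real (sin (pi * x)) * (of_real t + \<i>) = - cnj (cis (pi * x))"
          "of_real (sin (pi * x)) * (of_real t - \<i>) = - cis (pi * x)"
          using s by (auto simp: complex_eq_iff t_def T_def cot_def)
        moreover have "cis (pi * x) * cnj (cis (pi * x)) = 1"
          by (simp add: cis_cnj cis_mult)
        ultimately have "circ x * (of_real (sin (pi * x)) * (of_real t + \<i>)) = of_real (sin (pi * x)) * (of_real t - \<i>)"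
          by (simp add: power2_eq_square mult.assoc)
        then have "of_real (sin (pi * x)) * (circ x * (of_real t + \<i>)) = of_real (sin (pi * x)) * (of_real t - \<i>)"
          by (simp only: mult_ac)
        then have "circ x * (of_real t + \<i>) = of_real t - \<i>"
          using s by (simp only: mult_cancel_left of_real_eq_0_iff simp_thms)
        then have cx: "circ x = (of_real t - \<i>) / (of_real t + \<i>)"
          using tz(2) by (simp add: eq_divide_eq)
        \<comment> \<open>In these variables \<open>circ x\<close> = 1 - 2i/a and w = 1 - 2i/b, so
          their difference is 2i (a - b) / (ab).\<close>
        define a b where "a = of_real t + \<i>" and "b = z + \<i>"
        have ab: "a \<noteq> 0" "b \<noteq> 0" "a - b \<noteq> 0"
          using tz zi by (auto simp: a_def b_def)
        have e: "of_real t - \<i> = a - 2 * \<i>" "z - \<i> = b - 2 * \<i>" "of_real t = a - \<i>" "z = b - \<i>"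
          by (auto simp: a_def b_def)
        have cx': "circ x = (a - 2 * \<i>) / a"
          unfolding cx e(1) a_def ..
        have d: "circ x - w = 2 * \<i> * (a - b) / (a * b)"
          unfolding cx' w_def b_def[symmetric] e(2) using ab by (simp add: field_simps)
        have "2 * circ x / (circ x - w) = 2 * ((a - 2 * \<i>) / a) / (2 * \<i> * (a - b) / (a * b))"
          unfolding d unfolding cx' ..
        also have "\<dots> = (a - 2 * \<i>) * b / (\<i> * (a - b))"
          using ab by (simp add: field_simps)
        also have "\<dots> = 1 - \<i> * ((1 + (a - \<i>) * (b - \<i>)) / (a - b))"
          using ab by (simp add: field_simps)
        also have "a - b = of_real t - z"
          by (simp add: a_def b_def)
        finally show ?thesis
          using True by (simp add: L_def flip: t_def e(3,4))
      next
        case False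
        then have s: "sin (pi * x) = 0"
          by (simp add: A_def)
        then have "cis (pi * x) * cis (pi * x) = 1"
          by (simp add: cis_cnj complex_eq_iff cis_mult flip: power2_eq_square) (use sin_cos_squared_add[of "pi * x"] in \<open>auto simp: cos_double sin_double s\<close>)
        then have "circ x = 1"
          by (simp add: circ_def cis_conv_exp exp_double[symmetric] mult_ac flip: exp_add)
        moreover have "1 - w = 2 * \<i> / (z + \<i>)"
          using zi by (auto simp: w_def field_simps)
        ultimately have "2 * circ x / (circ x - w) = 2 / (2 * \<i> / (z + \<i>))"
          by simp
        also have "\<dots> = 1 - \<i> * z"
          using zi by (simp add: field_simps)
        finally show ?thesis
          using False by (simp add: L_def)
      qed
      have int_K: "integrable M (\<lambda>x. 2 * circ x / (circ x - w))"
      proof (rule integrable_const_bound[of _ "2 / (1 - norm w)"])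
        show "AE x in M. norm (2 * circ x / (circ x - w)) \<le> 2 / (1 - norm w)"
          using continuous_circ_kernel(2)[OF w] by simp
        have "(\<lambda>x. 2 * circ x / (circ x - w)) \<in> borel_measurable borel"
          using continuous_circ_kernel(1)[OF w] by (rule borel_measurable_continuous_onI)
        then show "(\<lambda>x. 2 * circ x / (circ x - w)) \<in> borel_measurable M"
          by simp
      qed
      have L_eq: "L x = \<i> * (2 * circ x / (circ x - w) - 1)" for x
        unfolding K_eq by simp
      have int_L: "integrable M L"
        unfolding L_eq using int_K by simp
      have "F z = \<i> * G w"
        by (simp add: G_def cw)
      also have "\<dots> = \<i> * (of_real m * (\<integral>x. 2 * circ x / (circ x - w) \<partial>M) - cnj (G 0))"
        using rep[OF w] unfolding m_def by (metis add_diff_cancel_right')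
      also have "(\<integral>x. 2 * circ x / (circ x - w) \<partial>M) = 1 - \<i> * (\<integral>x. L x \<partial>M)"
        unfolding K_eq using int_L prob_space by simp
      \<comment> \<open>Since G(0) = -i F(i) and m = Im F(i), the terms i m and -i cnj(G(0)) add up
        to Re F(i), the constant a of the representation.\<close>
      also have "\<i> * (of_real m * (1 - \<i> * (\<integral>x. L x \<partial>M)) - cnj (G 0)) = of_real (Re (F \<i>)) + of_real m * (\<integral>x. L x \<partial>M)"
        by (simp add: G_def c0 m complex_eq_iff algebra_simps)
      also have "of_real m * (\<integral>x. L x \<partial>M) = of_real m * (\<integral>x. indicator (- A) x *\<^sub>R z \<partial>M) +
          of_real m * (\<integral>x. indicator A x *\<^sub>R L x \<partial>M)"
      proof -
        have "(\<integral>x. L x \<partial>M) = (\<integral>x. indicator (- A) x *\<^sub>R z + indicator A x *\<^sub>R L x \<partial>M)"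
          by (rule Bochner_Integration.integral_cong) (auto simp: indicator_def L_def)
        also have "\<dots> = (\<integral>x. indicator (- A) x *\<^sub>R z \<partial>M) + (\<integral>x. indicator A x *\<^sub>R L x \<partial>M)"
          using int_L by (intro Bochner_Integration.integral_add integrable_mult_indicator) auto
        finally show ?thesis
          by (simp add: distrib_left)
      qed
      also have "of_real m * (\<integral>x. indicator (- A) x *\<^sub>R z \<partial>M) = of_real (m * measure M (- A)) * z"
        by (simp add: scaleR_conv_of_real)
      also have "of_real m * (\<integral>x. indicator A x *\<^sub>R L x \<partial>M) =
          (\<integral>x. indicator A x *\<^sub>R ((m * (1 + (T x)\<^sup>2)) *\<^sub>R (1 / (of_real (T x) - z) - of_real (T x / ((T x)\<^sup>2 + 1)))) \<partial>M)"
        unfolding integral_mult_right_zero[symmetric]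
      proof (rule Bochner_Integration.integral_cong[OF refl])
        fix x
        define t where "t = T x"
        have tz: "of_real t - z \<noteq> 0"
          using z by (auto simp: complex_eq_iff)
        have t2: "complex_of_real t * of_real t + 1 \<noteq> 0"
          using one_plus(1)[of t] by (metis add.commute of_real_1 of_real_add of_real_eq_0_iff of_real_mult power2_eq_square)
        have "(1 + of_real t * z) / (of_real t - z) = (1 + t\<^sup>2) *\<^sub>R (1 / (of_real t - z) - of_real (t / (t\<^sup>2 + 1)))"
        proof -
          have "(1 + t\<^sup>2) * (t / (t\<^sup>2 + 1)) = t"
            using one_plus[of t] by (simp add: add.commute[of 1])
          then have "complex_of_real (1 + t\<^sup>2) * of_real (t / (t\<^sup>2 + 1)) = of_real t"
            by (metis of_real_mult)
          then have "(1 + t\<^sup>2) *\<^sub>R (1 / (of_real t - z) - of_real (t / (t\<^sup>2 + 1))) =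
              of_real (1 + t\<^sup>2) / (of_real t - z) - of_real t"
            by (simp only: scaleR_conv_of_real right_diff_distrib) simp
          also have "\<dots> = (1 + of_real t * z) / (of_real t - z)"
            using tz by (simp add: field_simps power2_eq_square)
          finally show ?thesis ..
        qed
        then show "of_real m * (indicator A x *\<^sub>R L x) =
          indicator A x *\<^sub>R ((m * (1 + (T x)\<^sup>2)) *\<^sub>R (1 / (of_real (T x) - z) - of_real (T x / ((T x)\<^sup>2 + 1))))"
          by (simp add: L_def t_def scaleR_conv_of_real indicator_def)
      qed
      also have "\<dots> = (\<integral>t. (1 / (of_real t - z) - of_real (t / (t\<^sup>2 + 1))) \<partial>\<nu>)"
        by (rule nu_integral(2)[symmetric]) measurable
      finally show "F z = of_real (Re (F \<i>)) + of_real (m * measure M (- A)) * z +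
          (\<integral>t. (1 / (of_real t - z) - of_real (t / (t\<^sup>2 + 1))) \<partial>\<nu>)"
        by simp
    qed
  qed
qed

section \<open>Boundary limits and uniqueness of Herglotz measures\<close>

lemma integrable_Cauchy_density: "integrable lborel (\<lambda>x::real. 1 / (1 + x\<^sup>2))"
  and integral_Cauchy_density: "(\<integral>x. 1 / (1 + x\<^sup>2) \<partial>(lborel :: real measure)) = pi"
proof -
  have "einterval (-\<infinity>) \<infinity> = UNIV"
    by (auto simp: einterval_def)
  then show "integrable lborel (\<lambda>x::real. 1 / (1 + x\<^sup>2))" "(\<integral>x. 1 / (1 + x\<^sup>2) \<partial>(lborel :: real measure)) = pi"
    using integrable_inverse_1_plus_square LBINT_inverse_1_plus_square
    by (simp_all add: set_integrable_def interval_lebesgue_integral_def set_lebesgue_integral_def inverse_eq_divide)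
qed

lemma one_plus_square_pos: "1 + t\<^sup>2 > 0" for t :: real
  by (simp add: add_pos_nonneg)

text \<open>Poisson kernel of the half-plane without the factor 1/\<pi>, so that Im (1 / (t - z)) is
  its value at height Im z and offset t - Re z; its total mass is \<pi>.\<close>

definition poisson :: "real \<Rightarrow> real \<Rightarrow> real" where
  "poisson y x = y / (x\<^sup>2 + y\<^sup>2)"

lemma poisson_bounds:
  assumes "y > 0"
  shows "poisson y x \<ge> 0" "poisson y x \<le> 1 / y"
  using assms by (auto simp: poisson_def field_simps power2_eq_square add_nonneg_pos)

lemma poisson_measurable [measurable]: "poisson y \<in> borel_measurable borel"
  unfolding poisson_def by measurable

lemma poisson_affine: "y > 0 \<Longrightarrow> y * poisson y (t - (t + y * s)) = 1 / (1 + s\<^sup>2)"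
proof -
  assume "y > 0"
  have "(t - (t + y * s))\<^sup>2 + y\<^sup>2 = y * y * (1 + s\<^sup>2)"
    by (simp add: power2_eq_square algebra_simps)
  then show ?thesis
    unfolding poisson_def using \<open>y > 0\<close> one_plus_square_pos[of s] by simp
qed

text \<open>The substitution x = t + ys turns the kernel into the fixed density 1 / (1 + s^2), which
  moves the dependence on y into the argument of f.\<close>

lemma poisson_convolution:
  fixes f :: "real \<Rightarrow> 'a::{banach, second_countable_topology}"
  assumes "y > 0"
  shows "(\<integral>x. poisson y (t - x) *\<^sub>R f x \<partial>lborel) = (\<integral>s. (1 / (1 + s\<^sup>2)) *\<^sub>R f (t + y * s) \<partial>lborel)"
    and "integrable lborel (\<lambda>x. poisson y (t - x))"
    and "(\<integral>x. poisson y (t - x) \<partial>lborel) = pi"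
proof -
  \<comment> \<open>The range type is left free so that the equation also applies to the real
    constant 1, which yields the mass.\<close>
  have eq: "(\<integral>x. poisson y (t - x) *\<^sub>R f x \<partial>lborel) = (\<integral>s. (1 / (1 + s\<^sup>2)) *\<^sub>R f (t + y * s) \<partial>lborel)"
    for f :: "real \<Rightarrow> 'b::{banach, second_countable_topology}"
  proof -
    have "(\<integral>x. poisson y (t - x) *\<^sub>R f x \<partial>lborel) =
        (\<integral>s. y *\<^sub>R (poisson y (t - (t + y * s)) *\<^sub>R f (t + y * s)) \<partial>lborel)"
      using assms by (subst lborel_integral_real_affine[of y _ t]) (simp, simp only: abs_of_pos integral_scaleR_right)
    then show ?thesis
      using poisson_affine[OF assms] by simp
  qed
  show "(\<integral>x. poisson y (t - x) *\<^sub>R f x \<partial>lborel) = (\<integral>s. (1 / (1 + s\<^sup>2)) *\<^sub>R f (t + y * s) \<partial>lborel)"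
    by (rule eq)
  show "(\<integral>x. poisson y (t - x) \<partial>lborel) = pi"
    using eq[of "\<lambda>_. 1 :: real"] integral_Cauchy_density by simp
  have "integrable lborel (\<lambda>s. y * poisson y (t - (t + y * s)))"
    using poisson_affine[OF assms] integrable_Cauchy_density by simp
  then show "integrable lborel (\<lambda>x. poisson y (t - x))"
    using assms by (subst lborel_integrable_real_affine_iff[of y _ t, symmetric]) auto
qed

text \<open>Either \<open>1 + t\<^sup>2\<close> is comparable with \<open>1 + x\<^sup>2\<close>, or the kernel is small.\<close>

lemma poisson_decay:
  assumes "0 < y" "y \<le> 1"
  shows "poisson y (t - x) / (1 + x\<^sup>2) \<le> (4 * poisson y (t - x) + 8 / (1 + x\<^sup>2)) / (1 + t\<^sup>2)"
\<comment> \<open>In the first case 1 + t^2 \<le> 4 (1 + x^2), whence the 4. Otherwise |t| > 2|x|,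
  so |t - x| \<ge> |t|/2 and the kernel is at most 4 / t^2, which t^2 > 1 turns into 8 / (1 +
  t^2).\<close>
proof (cases "t\<^sup>2 \<le> 4 * x\<^sup>2 \<or> t\<^sup>2 \<le> 1")
  case True
  then have "1 + t\<^sup>2 \<le> 4 * (1 + x\<^sup>2)"
  proof -
    have "1 + a \<le> 4 * (1 + b)" if "0 \<le> b" "a \<le> 4 * b \<or> a \<le> 1" for a b :: real
      using that by auto
    then show ?thesis
      using True by simp
  qed
  then have "(1 + t\<^sup>2) / (1 + x\<^sup>2) \<le> 4"
    by (simp only: pos_divide_le_eq[OF one_plus_square_pos])
  then have "1 / (1 + x\<^sup>2) \<le> 4 / (1 + t\<^sup>2)"
    by (simp add: pos_le_divide_eq[OF one_plus_square_pos])
  then have "poisson y (t - x) * (1 / (1 + x\<^sup>2)) \<le> poisson y (t - x) * (4 / (1 + t\<^sup>2))"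
    using poisson_bounds[OF assms(1)] by (intro mult_left_mono) auto
  also have "\<dots> \<le> (4 * poisson y (t - x) + 8 / (1 + x\<^sup>2)) / (1 + t\<^sup>2)"
    using one_plus_square_pos[of x] one_plus_square_pos[of t] by (simp add: divide_right_mono)
  finally show ?thesis
    by simp
next
  case False
  then have t: "t\<^sup>2 > 1" "(2 * x)\<^sup>2 < t\<^sup>2"
    by (auto simp: power_mult_distrib)
  then have "\<bar>2 * x\<bar> < \<bar>t\<bar>"
    using power2_less_imp_less[of "\<bar>2 * x\<bar>" "\<bar>t\<bar>"] by simp
  then have "\<bar>t\<bar> / 2 \<le> \<bar>t - x\<bar>"
    by linarith
  then have "(\<bar>t\<bar> / 2)\<^sup>2 \<le> \<bar>t - x\<bar>\<^sup>2"
    by (intro power_mono) auto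
  then have d: "t\<^sup>2 / 4 \<le> (t - x)\<^sup>2"
    by (simp add: power_divide)
  have "poisson y (t - x) \<le> 1 / (t\<^sup>2 / 4)"
    unfolding poisson_def using assms d t by (intro frac_le) (auto intro: add_increasing2)
  also have "\<dots> \<le> 8 / (1 + t\<^sup>2)"
  proof -
    have "t\<^sup>2 > 0"
      using t by linarith
    from pos_divide_le_eq[OF this] show ?thesis
      using t by (simp add: pos_le_divide_eq[OF one_plus_square_pos])
  qed
  finally have "poisson y (t - x) * (1 / (1 + x\<^sup>2)) \<le> 8 / (1 + t\<^sup>2) * (1 / (1 + x\<^sup>2))"
    using one_plus_square_pos[of x] by (intro mult_right_mono) auto
  also have "\<dots> \<le> (4 * poisson y (t - x) + 8 / (1 + x\<^sup>2)) / (1 + t\<^sup>2)"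
    using one_plus_square_pos[of x] one_plus_square_pos[of t] poisson_bounds[OF assms(1), of "t - x"]
    by (simp add: add_divide_distrib mult.commute)
  finally show ?thesis
    by simp
qed

text \<open>The imaginary part removes the real constant and turns the Herglotz kernel k into the
  Poisson kernel. To pass it through the integral, k must be integrable; this follows from 1 / (t^2
  + 1) through k t = ((1 + z^2) / (t - z) + z) / (t^2 + 1), as |t - z| \<ge> Im z.\<close>

lemma herglotz_Im:
  assumes "herglotz_measure F \<nu>"
  obtains b where "\<And>z. Im z > 0 \<Longrightarrow> Im (F z) = b * Im z + (\<integral>t. poisson (Im z) (t - Re z) \<partial>\<nu>)"
    "\<And>z. Im z > 0 \<Longrightarrow> integrable \<nu> (\<lambda>t. poisson (Im z) (t - Re z))"
proof -
  from assms obtain a b :: real where sets: "sets \<nu> = sets borel"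
    and int: "integrable \<nu> (\<lambda>t. 1 / (t\<^sup>2 + 1))"
    and F: "\<And>z. Im z > 0 \<Longrightarrow> F z = of_real a + of_real b * z +
             (\<integral>t. (1 / (of_real t - z) - of_real (t / (t\<^sup>2 + 1))) \<partial>\<nu>)"
    unfolding herglotz_measure_def by blast
  note [measurable_cong] = sets
  have "Im (F z) = b * Im z + (\<integral>t. poisson (Im z) (t - Re z) \<partial>\<nu>) \<and>
     integrable \<nu> (\<lambda>t. poisson (Im z) (t - Re z))" if z: "Im z > 0" for z
  proof -
    define k where "k t = 1 / (of_real t - z) - of_real (t / (t\<^sup>2 + 1))" for t
    have k_Im: "Im (k t) = poisson (Im z) (t - Re z)" for t
      by (simp add: k_def poisson_def Im_divide)
    have "integrable \<nu> k"
    proof (rule Bochner_Integration.integrable_bound)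
      show "integrable \<nu> (\<lambda>t. (norm (1 + z\<^sup>2) / Im z + norm z) * (1 / (t\<^sup>2 + 1)))"
        using int by (intro integrable_mult_right)
      show "k \<in> borel_measurable \<nu>"
        unfolding k_def by measurable
      have "norm (k t) \<le> norm ((norm (1 + z\<^sup>2) / Im z + norm z) * (1 / (t\<^sup>2 + 1)))" for t
      proof -
        have tz: "of_real t - z \<noteq> 0"
          using z by (auto simp: complex_eq_iff)
        have t2: "complex_of_real (t\<^sup>2 + 1) \<noteq> 0"
          using one_plus_square_pos[of t] by (metis add.commute less_irrefl of_real_eq_0_iff)
        have "k t = ((1 + z\<^sup>2) / (of_real t - z) + z) / of_real (t\<^sup>2 + 1)"
        proof -
          have "k t = (of_real (t\<^sup>2 + 1) - of_real t * (of_real t - z)) / ((of_real t - z) * of_real (t\<^sup>2 + 1))"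
            unfolding k_def of_real_divide using tz t2 by (subst diff_frac_eq) (auto simp: mult.commute)
          also have "of_real (t\<^sup>2 + 1) - of_real t * (of_real t - z) = (1 + z\<^sup>2) + z * (of_real t - z)"
            by (simp add: power2_eq_square algebra_simps)
          also have "\<dots> / ((of_real t - z) * of_real (t\<^sup>2 + 1)) = ((1 + z\<^sup>2) / (of_real t - z) + z) / of_real (t\<^sup>2 + 1)"
            using tz by (simp add: add_divide_distrib)
          finally show ?thesis .
        qed
        moreover have "norm ((1 + z\<^sup>2) / (of_real t - z) + z) \<le> norm (1 + z\<^sup>2) / Im z + norm z"
        proof -
          have "Im z \<le> norm (of_real t - z)"
            using abs_Im_le_cmod[of "of_real t - z"] by simp
          then have "norm ((1 + z\<^sup>2) / (of_real t - z)) \<le> norm (1 + z\<^sup>2) / Im z"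
            unfolding norm_divide using z tz by (intro divide_left_mono mult_pos_pos) auto
          then show ?thesis
            using norm_triangle_ineq order_trans add_right_mono by blast
        qed
        moreover have "norm (complex_of_real (t\<^sup>2 + 1)) = t\<^sup>2 + 1"
          unfolding norm_of_real using one_plus_square_pos[of t] by simp
        ultimately have "norm (k t) \<le> (norm (1 + z\<^sup>2) / Im z + norm z) / (t\<^sup>2 + 1)"
          using one_plus_square_pos[of t] by (simp add: norm_divide divide_right_mono)
        also have "\<dots> \<le> norm ((norm (1 + z\<^sup>2) / Im z + norm z) * (1 / (t\<^sup>2 + 1)))"
          by (metis abs_ge_self real_norm_def times_divide_eq_right mult.right_neutral)
        finally show ?thesis .
      qed
      then show "AE t in \<nu>. norm (k t) \<le> norm ((norm (1 + z\<^sup>2) / Im z + norm z) * (1 / (t\<^sup>2 + 1)))"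
        by simp
    qed
    then have "integrable \<nu> (\<lambda>t. Im (k t))" "Im (integral\<^sup>L \<nu> k) = (\<integral>t. Im (k t) \<partial>\<nu>)"
      by simp_all
    moreover have "F z = of_real a + of_real b * z + integral\<^sup>L \<nu> k"
      using F[OF z] unfolding k_def .
    ultimately show ?thesis
      by (simp add: k_Im)
  qed
  then show thesis
    using that by blast
qed

lemma herglotz_sigma_finite:
  assumes "herglotz_measure F \<nu>"
  shows "sigma_finite_measure \<nu>"
proof
  have sets: "sets \<nu> = sets borel" and fin: "\<And>K. compact K \<Longrightarrow> emeasure \<nu> K < \<infinity>"
    using assms by (auto simp: herglotz_measure_def)
  define A where "A = range (\<lambda>n::nat. {- real n..real n})"
  have "\<Union>A = UNIV"
  proof -
    have "x \<in> {- real (nat \<lceil>\<bar>x\<bar>\<rceil>)..real (nat \<lceil>\<bar>x\<bar>\<rceil>)}" for x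
      by (simp, linarith)
    then show ?thesis
      unfolding A_def by blast
  qed
  then show "\<exists>A. countable A \<and> A \<subseteq> sets \<nu> \<and> \<Union> A = space \<nu> \<and> (\<forall>a\<in>A. emeasure \<nu> a \<noteq> \<infinity>)"
    using fin[OF compact_Icc] sets_eq_imp_space_eq[OF sets]
    by (intro exI[of _ A]) (auto simp: A_def sets less_top)
qed

text \<open>Stieltjes inversion. By Fubini the integral at height y is b y times the integral of
  \<phi>, plus the \<nu>-integral of the Poisson averages I y. These tend to \<pi> \<phi>(t) and are
  dominated by 12 \<pi> C / (t^2 + 1), where 12 = 4 + 8 comes from \<open>poisson_decay\<close>. The
  decay of \<phi> is only quadratic because the uniqueness proof uses test functions that decrease
  no faster.\<close>

theorem herglotz_boundary_limit:
  fixes \<phi> :: "real \<Rightarrow> complex"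
  assumes \<nu>: "herglotz_measure F \<nu>" and cont: "continuous_on UNIV \<phi>"
    and decay: "\<And>x. norm (\<phi> x) \<le> C / (1 + x\<^sup>2)"
  shows "(\<lambda>n. \<integral>x. \<phi> x * of_real (Im (F (Complex x (1 / real (Suc n))))) \<partial>lborel) \<longlonglongrightarrow>
    of_real pi * (\<integral>t. \<phi> t \<partial>\<nu>)"
proof -
  have sets: "sets \<nu> = sets borel" and int_nu: "integrable \<nu> (\<lambda>t. 1 / (t\<^sup>2 + 1))"
    using \<nu> by (auto simp: herglotz_measure_def)
  note [measurable_cong] = sets
  interpret \<nu>: sigma_finite_measure \<nu>
    by (rule herglotz_sigma_finite[OF \<nu>])
  interpret pair: pair_sigma_finite \<nu> lborel
    by unfold_locales
  obtain b where Im_F: "\<And>z. Im z > 0 \<Longrightarrow> Im (F z) = b * Im z + (\<integral>t. poisson (Im z) (t - Re z) \<partial>\<nu>)"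
    and int_p: "\<And>z. Im z > 0 \<Longrightarrow> integrable \<nu> (\<lambda>t. poisson (Im z) (t - Re z))"
    using herglotz_Im[OF \<nu>] by blast
  have [measurable]: "\<phi> \<in> borel_measurable borel"
    using cont by (rule borel_measurable_continuous_onI)
  have C: "C \<ge> 0"
    using order_trans[OF norm_ge_zero decay[of 0]] by simp
  have bdd: "norm (\<phi> x) \<le> C" for x
    using decay[of x] C one_plus_square_pos[of x] by (intro order_trans[OF decay]) (simp add: field_simps mult_left_mono)
  have int_phi: "integrable lborel \<phi>"
  proof (rule Bochner_Integration.integrable_bound)
    show "integrable lborel (\<lambda>x::real. C * (1 / (1 + x\<^sup>2)))"
      using integrable_Cauchy_density by (rule integrable_mult_right)
    show "AE x in lborel. norm (\<phi> x) \<le> norm (C * (1 / (1 + x\<^sup>2)))"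
      using decay C by simp
  qed simp
  define I where "I y t = (\<integral>x. poisson y (t - x) *\<^sub>R \<phi> x \<partial>lborel)" for y t
  have int_px: "integrable lborel (\<lambda>x. poisson y (t - x) *\<^sub>R \<phi> x)" if y: "y > 0" for y t
  proof (rule Bochner_Integration.integrable_bound)
    show "integrable lborel (\<lambda>x. C * poisson y (t - x))"
      using poisson_convolution(2)[OF y] by (rule integrable_mult_right)
    have "norm (poisson y (t - x) *\<^sub>R \<phi> x) \<le> C * poisson y (t - x)" for x
      using bdd[of x] poisson_bounds(1)[OF y, of "t - x"] mult_left_mono[of "norm (\<phi> x)" C "poisson y (t - x)"]
      by (simp add: mult.commute)
    then show "AE x in lborel. norm (poisson y (t - x) *\<^sub>R \<phi> x) \<le> norm (C * poisson y (t - x))"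
      unfolding real_norm_def by (intro always_eventually allI order_trans[OF _ abs_ge_self])
  qed measurable
  have bound: "(\<integral>x. norm (poisson y (t - x) *\<^sub>R \<phi> x) \<partial>lborel) \<le> (12 * pi * C) * (1 / (t\<^sup>2 + 1))"
    if y: "0 < y" "y \<le> 1" for y t
  proof -
    have "(\<integral>x. norm (poisson y (t - x) *\<^sub>R \<phi> x) \<partial>lborel) \<le>
        (\<integral>x. (C / (1 + t\<^sup>2)) * (4 * poisson y (t - x) + 8 * (1 / (1 + x\<^sup>2))) \<partial>lborel)"
    proof (rule integral_mono)
      show "integrable lborel (\<lambda>x. norm (poisson y (t - x) *\<^sub>R \<phi> x))"
        using int_px[OF y(1)] by (rule integrable_norm)
      show "integrable lborel (\<lambda>x. (C / (1 + t\<^sup>2)) * (4 * poisson y (t - x) + 8 * (1 / (1 + x\<^sup>2))))"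
        using poisson_convolution(2)[OF y(1)] integrable_Cauchy_density
        by (intro integrable_mult_right Bochner_Integration.integrable_add) auto
      fix x
      have "norm (poisson y (t - x) *\<^sub>R \<phi> x) \<le> poisson y (t - x) * (C / (1 + x\<^sup>2))"
        using poisson_bounds(1)[OF y(1), of "t - x"] mult_left_mono[OF decay[of x] poisson_bounds(1)[OF y(1), of "t - x"]]
        by simp
      also have "\<dots> = C * (poisson y (t - x) / (1 + x\<^sup>2))"
        by simp
      also have "\<dots> \<le> C * ((4 * poisson y (t - x) + 8 / (1 + x\<^sup>2)) / (1 + t\<^sup>2))"
        by (intro mult_left_mono poisson_decay y C)
      finally show "norm (poisson y (t - x) *\<^sub>R \<phi> x) \<le> (C / (1 + t\<^sup>2)) * (4 * poisson y (t - x) + 8 * (1 / (1 + x\<^sup>2)))"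
        by simp
    qed
    also have "\<dots> = (C / (1 + t\<^sup>2)) * (4 * pi + 8 * pi)"
      using poisson_convolution(2,3)[OF y(1)] integrable_Cauchy_density integral_Cauchy_density
      by (simp del: times_divide_eq_right)
    finally show ?thesis
      by (simp add: add.commute mult.commute)
  qed
  have U_eq: "(\<integral>x. \<phi> x * of_real (Im (F (Complex x y))) \<partial>lborel) =
      of_real (b * y) * (\<integral>x. \<phi> x \<partial>lborel) + (\<integral>t. I y t \<partial>\<nu>)"
    and I_int: "integrable \<nu> (I y)" if y: "0 < y" "y \<le> 1" for y
  proof -
    have int2: "integrable (\<nu> \<Otimes>\<^sub>M lborel) (\<lambda>(t, x). poisson y (t - x) *\<^sub>R \<phi> x)"
    proof (rule pair.Fubini_integrable)
      show "integrable \<nu> (\<lambda>t. \<integral>x. norm (case (t, x) of (t, x) \<Rightarrow> poisson y (t - x) *\<^sub>R \<phi> x) \<partial>lborel)"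
      proof (rule Bochner_Integration.integrable_bound)
        show "integrable \<nu> (\<lambda>t. (12 * pi * C) * (1 / (t\<^sup>2 + 1)))"
          using int_nu by (rule integrable_mult_right)
        show "AE t in \<nu>. norm (\<integral>x. norm (case (t, x) of (t, x) \<Rightarrow> poisson y (t - x) *\<^sub>R \<phi> x) \<partial>lborel)
            \<le> norm ((12 * pi * C) * (1 / (t\<^sup>2 + 1)))"
        proof (intro always_eventually allI)
          fix t
          have "(\<integral>x. norm (poisson y (t - x) *\<^sub>R \<phi> x) \<partial>lborel) \<ge> 0"
            by (rule Bochner_Integration.integral_nonneg) simp
          then show "norm (\<integral>x. norm (case (t, x) of (t, x) \<Rightarrow> poisson y (t - x) *\<^sub>R \<phi> x) \<partial>lborel)
            \<le> norm ((12 * pi * C) * (1 / (t\<^sup>2 + 1)))"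
            unfolding prod.case using bound[OF y, of t] by (simp only: real_norm_def)
        qed
      qed measurable
      show "AE t in \<nu>. integrable lborel (\<lambda>x. case (t, x) of (t, x) \<Rightarrow> poisson y (t - x) *\<^sub>R \<phi> x)"
        using int_px[OF y(1)] by simp
      show "(\<lambda>(t, x). poisson y (t - x) *\<^sub>R \<phi> x) \<in> borel_measurable (\<nu> \<Otimes>\<^sub>M lborel)"
        by measurable
    qed
    show "integrable \<nu> (I y)"
      unfolding I_def using pair.integrable_fst'[OF int2] by simp
    have "(\<integral>x. \<phi> x * of_real (Im (F (Complex x y))) \<partial>lborel) =
        (\<integral>x. of_real (b * y) * \<phi> x + (\<integral>t. poisson y (t - x) *\<^sub>R \<phi> x \<partial>\<nu>) \<partial>lborel)"
    proof (rule Bochner_Integration.integral_cong[OF refl])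
      fix x
      show "\<phi> x * of_real (Im (F (Complex x y))) = of_real (b * y) * \<phi> x + (\<integral>t. poisson y (t - x) *\<^sub>R \<phi> x \<partial>\<nu>)"
        using Im_F[of "Complex x y"] int_p[of "Complex x y"] y
        by (simp add: scaleR_conv_of_real algebra_simps)
    qed
    also have "\<dots> = of_real (b * y) * (\<integral>x. \<phi> x \<partial>lborel) + (\<integral>x. (\<integral>t. poisson y (t - x) *\<^sub>R \<phi> x \<partial>\<nu>) \<partial>lborel)"
      using int_phi pair.integrable_snd[OF int2] by (subst Bochner_Integration.integral_add) auto
    also have "(\<integral>x. (\<integral>t. poisson y (t - x) *\<^sub>R \<phi> x \<partial>\<nu>) \<partial>lborel) = (\<integral>t. I y t \<partial>\<nu>)"
      unfolding I_def using pair.Fubini_integral[OF int2] by simp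
    finally show "(\<integral>x. \<phi> x * of_real (Im (F (Complex x y))) \<partial>lborel) =
      of_real (b * y) * (\<integral>x. \<phi> x \<partial>lborel) + (\<integral>t. I y t \<partial>\<nu>)" .
  qed
  define Y where "Y n = 1 / real (Suc n)" for n
  have Y: "0 < Y n" "Y n \<le> 1" for n
    by (auto simp: Y_def)
  have Y_lim: "Y \<longlonglongrightarrow> 0"
    unfolding Y_def by (rule LIMSEQ_inverse_real_of_nat[unfolded inverse_eq_divide])
  have I_lim: "(\<lambda>n. I (Y n) t) \<longlonglongrightarrow> of_real pi * \<phi> t" for t
  proof -
    have "(\<lambda>n. \<integral>s. (1 / (1 + s\<^sup>2)) *\<^sub>R \<phi> (t + Y n * s) \<partial>lborel) \<longlonglongrightarrow> (\<integral>s. (1 / (1 + s\<^sup>2)) *\<^sub>R \<phi> t \<partial>lborel)"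
    proof (rule integral_dominated_convergence)
      show "integrable lborel (\<lambda>s::real. C * (1 / (1 + s\<^sup>2)))"
        using integrable_Cauchy_density by (rule integrable_mult_right)
      have "isCont \<phi> t"
        using cont by (simp add: continuous_on_eq_continuous_at)
      moreover have "(\<lambda>n. t + Y n * s) \<longlonglongrightarrow> t + 0 * s" for s
        by (intro tendsto_intros Y_lim)
      ultimately have "(\<lambda>n. \<phi> (t + Y n * s)) \<longlonglongrightarrow> \<phi> t" for s
        by (auto intro: isCont_tendsto_compose)
      then show "AE s in lborel. (\<lambda>n. (1 / (1 + s\<^sup>2)) *\<^sub>R \<phi> (t + Y n * s)) \<longlonglongrightarrow> (1 / (1 + s\<^sup>2)) *\<^sub>R \<phi> t"
        by (auto intro!: tendsto_intros)
      show "AE s in lborel. norm ((1 / (1 + s\<^sup>2)) *\<^sub>R \<phi> (t + Y n * s)) \<le> C * (1 / (1 + s\<^sup>2))" for n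
        using bdd one_plus_square_pos by (auto intro!: divide_right_mono simp: less_imp_le)
    qed measurable
    also have "(\<integral>s. (1 / (1 + s\<^sup>2)) *\<^sub>R \<phi> t \<partial>lborel) = of_real pi * \<phi> t"
      using integrable_Cauchy_density integral_Cauchy_density by (simp add: scaleR_conv_of_real[symmetric])
    finally show ?thesis
      unfolding I_def poisson_convolution(1)[OF Y(1)] .
  qed
  have "(\<lambda>n. \<integral>t. I (Y n) t \<partial>\<nu>) \<longlonglongrightarrow> (\<integral>t. of_real pi * \<phi> t \<partial>\<nu>)"
  proof (rule integral_dominated_convergence)
    show "integrable \<nu> (\<lambda>t. (12 * pi * C) * (1 / (t\<^sup>2 + 1)))"
      using int_nu by (rule integrable_mult_right)
    show "AE t in \<nu>. (\<lambda>n. I (Y n) t) \<longlonglongrightarrow> of_real pi * \<phi> t"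
      using I_lim by simp
    have "norm (I (Y n) t) \<le> (12 * pi * C) * (1 / (t\<^sup>2 + 1))" for n t
      unfolding I_def by (rule order_trans[OF integral_norm_bound bound[OF Y]])
    then show "AE t in \<nu>. norm (I (Y n) t) \<le> (12 * pi * C) * (1 / (t\<^sup>2 + 1))" for n
      by simp
    show "I (Y n) \<in> borel_measurable \<nu>" for n
      using I_int[OF Y] by (rule borel_measurable_integrable)
  qed measurable
  moreover have "(\<lambda>n. of_real (b * Y n) * (\<integral>x. \<phi> x \<partial>lborel)) \<longlonglongrightarrow> of_real (b * 0) * (\<integral>x. \<phi> x \<partial>lborel)"
    by (intro tendsto_intros Y_lim)
  ultimately have "(\<lambda>n. of_real (b * Y n) * (\<integral>x. \<phi> x \<partial>lborel) + (\<integral>t. I (Y n) t \<partial>\<nu>)) \<longlonglongrightarrow>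
    of_real (b * 0) * (\<integral>x. \<phi> x \<partial>lborel) + (\<integral>t. of_real pi * \<phi> t \<partial>\<nu>)"
    by (rule tendsto_add[rotated])
  then show ?thesis
    unfolding U_eq[OF Y, symmetric] by (simp add: Y_def)
qed

text \<open>Inversion is applied to exp(ist) / (t^2 + 1) for each s. The probability measures with
  density w / m then have equal characteristic functions, hence coincide, and the density m / w
  recovers both measures.\<close>

theorem herglotz_measure_unique:
  assumes "herglotz_measure F \<nu>" "herglotz_measure F \<nu>'"
  shows "\<nu> = \<nu>'"
proof -
  define w where "w t = 1 / (t\<^sup>2 + 1)" for t :: real
  have w: "w t > 0" for t
    using one_plus_square_pos[of t] by (simp add: w_def add.commute)
  have w_meas [measurable]: "w \<in> borel_measurable borel"
    unfolding w_def by measurable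
  have eq: "(\<integral>t. w t *\<^sub>R f t \<partial>\<nu>) = (\<integral>t. w t *\<^sub>R f t \<partial>\<nu>')"
    if "continuous_on UNIV f" "\<And>x. norm (f x) \<le> 1" for f :: "real \<Rightarrow> complex"
  proof -
    have "continuous_on UNIV (\<lambda>t. w t *\<^sub>R f t)"
      unfolding w_def using that(1) one_plus_square_pos
      by (intro continuous_intros) (auto simp: add.commute less_imp_neq[symmetric])
    moreover have "norm (w t *\<^sub>R f t) \<le> 1 / (1 + t\<^sup>2)" for t
      using that(2)[of t] w[of t] by (simp add: w_def add.commute divide_right_mono)
    ultimately have "of_real pi * (\<integral>t. w t *\<^sub>R f t \<partial>\<nu>) = of_real pi * (\<integral>t. w t *\<^sub>R f t \<partial>\<nu>')"
      using herglotz_boundary_limit[OF assms(1)] herglotz_boundary_limit[OF assms(2)] LIMSEQ_unique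
      by blast
    then show ?thesis
      by simp
  qed
  define m where "m = (\<integral>t. w t \<partial>\<nu>)"
  have props: "sets N = sets borel" "integrable N w" "(\<integral>t. w t \<partial>N) = m" if "N \<in> {\<nu>, \<nu>'}" for N
  proof -
    have "w = (\<lambda>t. 1 / (t\<^sup>2 + 1))"
      by (simp add: w_def fun_eq_iff)
    then show "sets N = sets borel" "integrable N w"
      using that assms unfolding herglotz_measure_def by (metis insertE singletonD)+
    have "complex_of_real (\<integral>t. w t \<partial>\<nu>) = of_real (\<integral>t. w t \<partial>\<nu>')"
      using eq[of "\<lambda>_. 1"] by (simp add: scaleR_conv_of_real)
    then show "(\<integral>t. w t \<partial>N) = m"
      using that by (auto simp: m_def)
  qed
  have "m \<ge> 0"
    unfolding m_def using w by (intro Bochner_Integration.integral_nonneg) (auto intro: less_imp_le)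
  show ?thesis
  proof (cases "m = 0")
    case True
    \<comment> \<open>For m = 0 there is nothing to normalise, but w > 0 forces both measures to
      vanish.\<close>
    have "emeasure N A = 0" if N: "N \<in> {\<nu>, \<nu>'}" for N A
    proof -
      have "AE t in N. w t = 0"
        using props[OF N] True w integral_nonneg_eq_0_iff_AE[of N w] by (simp add: less_imp_le)
      then have "AE t in N. False"
        using w by (auto simp: less_le)
      then have "emeasure N (space N) = 0"
        by (simp add: AE_iff_measurable[OF sets.top])
      then show ?thesis
        using emeasure_space[of N A] by simp
    qed
    then show ?thesis
      using props(1) by (intro measure_eqI) auto
  next
    case False
    then have m: "m > 0"
      using \<open>m \<ge> 0\<close> by simp
    define P where "P N = density N (\<lambda>t. ennreal (w t / m))" for N
    have dist: "real_distribution (P N)" if N: "N \<in> {\<nu>, \<nu>'}" for N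
    proof (intro real_distribution.intro real_distribution_axioms.intro prob_spaceI)
      note [measurable_cong] = props(1)[OF N]
      have "emeasure (P N) (space (P N)) = (\<integral>\<^sup>+t. ennreal (w t / m) \<partial>N)"
        unfolding P_def by (simp add: emeasure_density)
      also have "\<dots> = ennreal (\<integral>t. w t / m \<partial>N)"
        using props[OF N] w m by (intro nn_integral_eq_integral) (auto simp: less_imp_le)
      also have "\<dots> = 1"
        using props[OF N] m by simp
      finally show "emeasure (P N) (space (P N)) = 1" .
    qed (use props(1)[OF N] sets_eq_imp_space_eq[OF props(1)[OF N]] in \<open>auto simp: P_def\<close>)
    have char: "char (P N) s = (\<integral>t. w t *\<^sub>R iexp (s * t) \<partial>N) /\<^sub>R m" if N: "N \<in> {\<nu>, \<nu>'}" for N s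
    proof -
      note [measurable_cong] = props(1)[OF N]
      have "char (P N) s = (\<integral>t. (w t / m) *\<^sub>R iexp (s * t) \<partial>N)"
        unfolding P_def char_def using w m by (subst integral_density) (auto simp: less_imp_le)
      also have "\<dots> = (\<integral>t. (w t *\<^sub>R iexp (s * t)) /\<^sub>R m \<partial>N)"
        by (rule Bochner_Integration.integral_cong) (auto simp: divide_inverse mult.commute)
      also have "\<dots> = (\<integral>t. w t *\<^sub>R iexp (s * t) \<partial>N) /\<^sub>R m"
        by (rule integral_scaleR_right)
      finally show ?thesis .
    qed
    have "char (P \<nu>) = char (P \<nu>')"
    proof
      fix s
      have "(\<integral>t. w t *\<^sub>R iexp (s * t) \<partial>\<nu>) = (\<integral>t. w t *\<^sub>R iexp (s * t) \<partial>\<nu>')"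
        by (rule eq) (auto intro!: continuous_intros)
      then show "char (P \<nu>) s = char (P \<nu>') s"
        by (simp add: char)
    qed
    then have P_eq: "P \<nu> = P \<nu>'"
      using dist by (intro Levy_uniqueness) auto
    have recover: "density (P N) (\<lambda>t. ennreal (m / w t)) = N" if N: "N \<in> {\<nu>, \<nu>'}" for N
    proof -
      note [measurable_cong] = props(1)[OF N]
      have "density (P N) (\<lambda>t. ennreal (m / w t)) = density N (\<lambda>t. ennreal (w t / m) * ennreal (m / w t))"
        unfolding P_def by (subst density_density_eq) auto
      also have "(\<lambda>t. ennreal (w t / m) * ennreal (m / w t)) = (\<lambda>t. 1)"
      proof
        fix t
        have "ennreal (w t / m) * ennreal (m / w t) = ennreal ((w t / m) * (m / w t))"
          using w[of t] m by (intro ennreal_mult[symmetric]) auto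
        also have "(w t / m) * (m / w t) = 1"
          using w[of t] m by simp
        finally show "ennreal (w t / m) * ennreal (m / w t) = 1"
          by simp
      qed
      finally show ?thesis
        by (simp only: density_1)
    qed
    have "density (P \<nu>') (\<lambda>t. ennreal (m / w t)) = \<nu>"
      unfolding P_eq[symmetric] by (rule recover) simp
    moreover have "density (P \<nu>') (\<lambda>t. ennreal (m / w t)) = \<nu>'"
      by (rule recover) simp
    ultimately show ?thesis
      by (rule trans[OF sym])
  qed
qed

section \<open>Integrals against the Herglotz measure by Taylor expansion from height 1\<close>

lemma nonneg_factor: "0 \<le> C * w ^ N \<Longrightarrow> 0 < w \<Longrightarrow> 0 \<le> C" for C w :: real
  by (metis mult_less_0_iff not_le zero_less_power)

lemma hp_weight_Complex:
  assumes "y > 0"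
  shows "hp_weight (Complex x y) \<le> ((1 + y)\<^sup>2 / y) * (1 + \<bar>x\<bar>)\<^sup>2"
proof -
  have "norm (Complex x y) \<le> \<bar>x\<bar> + y"
    using cmod_le[of "Complex x y"] assms by simp
  moreover have "1 + (\<bar>x\<bar> + y) \<le> (1 + y) * (1 + \<bar>x\<bar>)"
    using assms by (simp add: algebra_simps)
  ultimately have "(1 + norm (Complex x y))\<^sup>2 \<le> ((1 + y) * (1 + \<bar>x\<bar>))\<^sup>2"
    by (intro power_mono) auto
  then show ?thesis
    using assms by (simp add: hp_weight_def divide_right_mono power_mult_distrib)
qed

text \<open>An upward shift only increases the imaginary part, and 1 + |z| at most doubles. The
  bound is uniform in e and provides the majorant for the limit of vanishing e.\<close>

lemma hp_weight_shift:
  assumes "Im z > 0" "0 \<le> e" "e \<le> 1"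
  shows "hp_weight (z + \<i> * of_real e) \<le> 4 * hp_weight z"
proof -
  have "norm (z + \<i> * of_real e) \<le> norm z + 1"
    using norm_triangle_ineq[of z "\<i> * of_real e"] assms by (simp add: norm_mult)
  then have "1 + norm (z + \<i> * of_real e) \<le> 2 + 2 * norm z"
    using norm_ge_zero[of z] by linarith
  then have "1 + norm (z + \<i> * of_real e) \<le> 2 * (1 + norm z)"
    by simp
  then have "(1 + norm (z + \<i> * of_real e))\<^sup>2 \<le> (2 * (1 + norm z))\<^sup>2"
    by (rule power_mono) simp
  then have "hp_weight (z + \<i> * of_real e) \<le> (2 * (1 + norm z))\<^sup>2 / Im z"
    unfolding hp_weight_def using assms by (intro frac_le) auto
  then show ?thesis
    unfolding hp_weight_def power_mult_distrib by simp
qed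

lemma hp_weight_ball:
  assumes "Im z > 0" "norm (u - z) \<le> Im z / 2"
  shows "Im u > 0" "hp_weight u \<le> 8 * hp_weight z"
proof -
  have "\<bar>Im u - Im z\<bar> \<le> Im z / 2"
    using abs_Im_le_cmod[of "u - z"] assms by simp
  then have Im_u: "Im u \<ge> Im z / 2"
    by linarith
  then show "Im u > 0"
    using assms by linarith
  have "norm u \<le> norm z + norm (u - z)"
    using norm_triangle_ineq[of z "u - z"] by simp
  also have "norm (u - z) \<le> norm z"
    using assms abs_Im_le_cmod[of z] by linarith
  finally have "(1 + norm u)\<^sup>2 \<le> (2 * (1 + norm z))\<^sup>2"
    by (intro power_mono) auto
  then have "hp_weight u \<le> (2 * (1 + norm z))\<^sup>2 / (Im z / 2)"
    unfolding hp_weight_def using assms Im_u by (intro frac_le) auto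
  then show "hp_weight u \<le> 8 * hp_weight z"
    unfolding hp_weight_def power_mult_distrib by simp
qed

text \<open>Cauchy's inequality on the disc of radius Im z / 2 about z. There the weight grows by a
  factor of at most 8, and the radius costs a factor 2 / Im z, hence one more power of the
  weight.\<close>

lemma deriv_growth:
  assumes hol: "F holomorphic_on {z. Im z > 0}"
    and bound: "\<And>z. Im z > 0 \<Longrightarrow> norm (F z) \<le> C * hp_weight z ^ N" and z: "Im z > 0"
  shows "norm (deriv F z) \<le> (2 * C * 8 ^ N) * hp_weight z ^ Suc N"
proof -
  have sub: "cball z (Im z / 2) \<subseteq> {z. Im z > 0}"
    using hp_weight_ball(1)[OF z] by (auto simp: dist_norm norm_minus_commute)
  have hol': "F holomorphic_on cball z (Im z / 2)"
    by (rule holomorphic_on_subset[OF hol sub])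
  have C: "C \<ge> 0"
    by (rule nonneg_factor[OF order_trans[OF norm_ge_zero bound[OF z]]])
      (use hp_weight_ge(1)[OF z] in linarith)
  have "norm ((deriv ^^ 1) F z) \<le> fact 1 * (C * (8 * hp_weight z) ^ N) / (Im z / 2) ^ 1"
  proof (rule Cauchy_inequality)
    show "F holomorphic_on ball z (Im z / 2)" "continuous_on (cball z (Im z / 2)) F"
      using hol' by (auto intro: holomorphic_on_subset holomorphic_on_imp_continuous_on)
    show "norm (F u) \<le> C * (8 * hp_weight z) ^ N" if "norm (z - u) = Im z / 2" for u
    proof -
      have u: "Im u > 0" "hp_weight u \<le> 8 * hp_weight z"
        using hp_weight_ball[OF z, of u] that by (auto simp: norm_minus_commute)
      have "norm (F u) \<le> C * hp_weight u ^ N"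
        by (rule bound[OF u(1)])
      also have "\<dots> \<le> C * (8 * hp_weight z) ^ N"
        using u hp_weight_ge(1)[OF u(1)] C by (intro mult_left_mono power_mono) auto
      finally show ?thesis .
    qed
  qed (use z in auto)
  also have "\<dots> = (2 * C * 8 ^ N * hp_weight z ^ N) * (1 / Im z)"
    by (simp add: power_mult_distrib)
  also have "\<dots> \<le> (2 * C * 8 ^ N * hp_weight z ^ N) * hp_weight z"
    using hp_weight_ge[OF z] C by (intro mult_left_mono) auto
  finally show ?thesis
    by (simp add: mult_ac)
qed

text \<open>\<open>ph k\<close> plays the k-th derivative of the Schwartz function; carrying the
  whole sequence keeps iterated \<open>vector_derivative\<close> out of the estimates.\<close>

locale rapid_decay =
  fixes ph :: "nat \<Rightarrow> real \<Rightarrow> complex"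
  assumes ph_deriv: "(ph k has_vector_derivative ph (Suc k) x) (at x)"
    and ph_bounded: "\<exists>C. \<forall>x. norm (x ^ m *\<^sub>R ph k x) \<le> C"
begin

lemma ph_continuous: "continuous_on A (ph k)"
  using ph_deriv by (meson continuous_at_imp_continuous_on has_vector_derivative_continuous)

lemma ph_measurable [measurable]: "ph k \<in> borel_measurable borel"
  using ph_continuous by (rule borel_measurable_continuous_onI)

lemma ph_decay: obtains C where "\<And>x. norm (ph k x) * (1 + \<bar>x\<bar>) ^ m \<le> C"
proof -
  obtain A where A: "\<And>x. norm (x ^ m *\<^sub>R ph k x) \<le> A"
    using ph_bounded[of m k] by blast
  obtain B where B: "\<And>x. norm (x ^ 0 *\<^sub>R ph k x) \<le> B"
    using ph_bounded[of 0 k] by blast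
  have "norm (ph k x) * (1 + \<bar>x\<bar>) ^ m \<le> 2 ^ m * (A + B)" for x
  proof -
    \<comment> \<open>1 + |x| is at most twice the larger of 1 and |x|, which reduces the weight to
      the two seminorms with exponents 0 and m.\<close>
    have "(1 + \<bar>x\<bar>) ^ m \<le> 2 ^ m * (\<bar>x\<bar> ^ m + 1)"
    proof (cases "\<bar>x\<bar> \<le> 1")
      case True
      then have "(1 + \<bar>x\<bar>) ^ m \<le> 2 ^ m"
        by (intro power_mono) auto
      then show ?thesis
        by (simp add: distrib_left add_increasing)
    next
      case False
      then have "(1 + \<bar>x\<bar>) ^ m \<le> (2 * \<bar>x\<bar>) ^ m"
        by (intro power_mono) auto
      then show ?thesis
        by (simp add: distrib_left power_mult_distrib add_increasing2)
    qed
    then have "norm (ph k x) * (1 + \<bar>x\<bar>) ^ m \<le> norm (ph k x) * (2 ^ m * (\<bar>x\<bar> ^ m + 1))"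
      by (rule mult_left_mono) simp
    also have "\<dots> = 2 ^ m * (norm (x ^ m *\<^sub>R ph k x) + norm (x ^ 0 *\<^sub>R ph k x))"
      by (simp add: power_abs algebra_simps)
    also have "\<dots> \<le> 2 ^ m * (A + B)"
      by (intro mult_left_mono add_mono A B) auto
    finally show ?thesis .
  qed
  then show thesis
    using that by blast
qed

text \<open>Two spare powers of 1 + |x| pay for the integrable factor 1 / (1 + x^2).\<close>

lemma ph_decay_square: obtains C where "\<And>x. norm (ph k x) * (1 + \<bar>x\<bar>) ^ m \<le> C * (1 / (1 + x\<^sup>2))"
proof -
  obtain C where C: "\<And>x. norm (ph k x) * (1 + \<bar>x\<bar>) ^ (m + 2) \<le> C"
    using ph_decay by blast
  have "norm (ph k x) * (1 + \<bar>x\<bar>) ^ m \<le> C * (1 / (1 + x\<^sup>2))" for x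
  proof -
    have "1 + x\<^sup>2 \<le> (1 + \<bar>x\<bar>)\<^sup>2"
      by (simp add: power2_eq_square algebra_simps)
    then have "(norm (ph k x) * (1 + \<bar>x\<bar>) ^ m) * (1 + x\<^sup>2) \<le> (norm (ph k x) * (1 + \<bar>x\<bar>) ^ m) * (1 + \<bar>x\<bar>)\<^sup>2"
      by (intro mult_left_mono) auto
    also have "\<dots> \<le> C"
      using C[of x] by (simp add: power_add power2_eq_square mult_ac)
    finally show ?thesis
      by (simp add: pos_le_divide_eq[OF one_plus_square_pos])
  qed
  then show thesis
    using that by blast
qed

lemma ph_integrable_weight: "integrable lborel (\<lambda>x. norm (ph k x) * (1 + \<bar>x\<bar>) ^ m)"
proof -
  obtain C where C: "\<And>x. norm (ph k x) * (1 + \<bar>x\<bar>) ^ m \<le> C * (1 / (1 + x\<^sup>2))"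
    using ph_decay_square by blast
  show ?thesis
  proof (rule Bochner_Integration.integrable_bound)
    show "integrable lborel (\<lambda>x::real. C * (1 / (1 + x\<^sup>2)))"
      using integrable_Cauchy_density by (rule integrable_mult_right)
    have "norm (norm (ph k x) * (1 + \<bar>x\<bar>) ^ m) \<le> norm (C * (1 / (1 + x\<^sup>2)))" for x
      using order_trans[OF C[of x] abs_ge_self] by simp
    then show "AE x in lborel. norm (norm (ph k x) * (1 + \<bar>x\<bar>) ^ m) \<le> norm (C * (1 / (1 + x\<^sup>2)))"
      by simp
  qed measurable
qed

lemma ph_integrable_hp_weight:
  assumes "y > 0"
  shows "integrable lborel (\<lambda>x. norm (ph k x) * hp_weight (Complex x y) ^ M)"
proof (rule Bochner_Integration.integrable_bound)
  show "integrable lborel (\<lambda>x. ((1 + y)\<^sup>2 / y) ^ M * (norm (ph k x) * (1 + \<bar>x\<bar>) ^ (2 * M)))"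
    using ph_integrable_weight by (rule integrable_mult_right)
  have "(\<lambda>x. hp_weight (Complex x y)) \<in> borel_measurable borel"
    unfolding hp_weight_def Complex_eq by simp
  then show "(\<lambda>x. norm (ph k x) * hp_weight (Complex x y) ^ M) \<in> borel_measurable lborel"
    by simp
  have "norm (norm (ph k x) * hp_weight (Complex x y) ^ M) \<le>
      norm (((1 + y)\<^sup>2 / y) ^ M * (norm (ph k x) * (1 + \<bar>x\<bar>) ^ (2 * M)))" for x
  proof -
    have ge: "hp_weight (Complex x y) \<ge> 1"
      using assms by (intro hp_weight_ge) auto
    have "hp_weight (Complex x y) ^ M \<le> (((1 + y)\<^sup>2 / y) * (1 + \<bar>x\<bar>)\<^sup>2) ^ M"
      using hp_weight_Complex[OF assms, of x] ge by (intro power_mono) auto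
    then have "norm (ph k x) * hp_weight (Complex x y) ^ M \<le> norm (ph k x) * (((1 + y)\<^sup>2 / y) * (1 + \<bar>x\<bar>)\<^sup>2) ^ M"
      by (rule mult_left_mono) simp
    also have "\<dots> = ((1 + y)\<^sup>2 / y) ^ M * (norm (ph k x) * (1 + \<bar>x\<bar>) ^ (2 * M))"
      by (simp only: power_mult_distrib power_mult) (simp only: mult_ac)
    finally show ?thesis
      using ge order_trans[OF _ abs_ge_self] by simp
  qed
  then show "AE x in lborel. norm (norm (ph k x) * hp_weight (Complex x y) ^ M) \<le>
      norm (((1 + y)\<^sup>2 / y) ^ M * (norm (ph k x) * (1 + \<bar>x\<bar>) ^ (2 * M)))"
    by simp
qed

lemma ph_integrable_mult:
  assumes q: "continuous_on {z. Im z > 0} q" "\<And>z. Im z > 0 \<Longrightarrow> norm (q z) \<le> C * hp_weight z ^ M"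
    and y: "y > 0"
  shows "integrable lborel (\<lambda>x. ph k x * q (Complex x y))"
proof (rule Bochner_Integration.integrable_bound)
  show "integrable lborel (\<lambda>x. C * (norm (ph k x) * hp_weight (Complex x y) ^ M))"
    using ph_integrable_hp_weight[OF y] by (rule integrable_mult_right)
  have "continuous_on UNIV (\<lambda>x. q (Complex x y))"
    by (rule continuous_on_compose2[OF q(1)]) (use y in \<open>auto simp: Complex_eq intro!: continuous_intros\<close>)
  then show "(\<lambda>x. ph k x * q (Complex x y)) \<in> borel_measurable lborel"
    using ph_continuous by (auto intro!: borel_measurable_continuous_onI continuous_intros)
  have "norm (ph k x * q (Complex x y)) \<le> norm (C * (norm (ph k x) * hp_weight (Complex x y) ^ M))" for x
  proof -
    have "norm (ph k x * q (Complex x y)) \<le> norm (ph k x) * (C * hp_weight (Complex x y) ^ M)"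
      unfolding norm_mult using q(2)[of "Complex x y"] y by (intro mult_left_mono) auto
    then show ?thesis
      using order_trans[OF _ abs_ge_self] by (simp add: mult_ac)
  qed
  then show "AE x in lborel. norm (ph k x * q (Complex x y)) \<le> norm (C * (norm (ph k x) * hp_weight (Complex x y) ^ M))"
    by simp
qed

end

text \<open>The integration variable \<open>s\<close> is the depth below height 1. The factor \<open>(1 - s) ^ n\<close> compensates
  the singularity at the real axis; \<open>strip_point\<close> is set to height 1 where the weight vanishes, so that
  it always lies in the upper half-plane.\<close>

definition strip_weight :: "nat \<Rightarrow> (real \<Rightarrow> complex) \<Rightarrow> real \<times> real \<Rightarrow> complex" where
  "strip_weight n f \<omega> = of_real (indicator {0..<1} (fst \<omega>) * (1 - fst \<omega>) ^ n) * f (snd \<omega>)"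

definition strip_point :: "real \<times> real \<Rightarrow> complex" where
  "strip_point \<omega> = Complex (snd \<omega>) (if fst \<omega> \<in> {0..<1} then 1 - fst \<omega> else 1)"

lemma Im_strip_point: "Im (strip_point \<omega>) > 0"
  by (simp add: strip_point_def)

lemma strip_point_measurable [measurable]: "strip_point \<in> borel_measurable (lborel \<Otimes>\<^sub>M lborel)"
  unfolding strip_point_def Complex_eq by measurable

context rapid_decay
begin

lemma strip_weight_measurable [measurable]: "strip_weight n (ph k) \<in> borel_measurable (lborel \<Otimes>\<^sub>M lborel)"
  unfolding strip_weight_def by measurable

text \<open>With y = 1 - s \<le> 1 the weight at x + iy is at most (4 / y) (1 + |x|)^2. The factor
  y^n with n \<ge> N cancels y^(-N), and the decay of \<open>ph k\<close> absorbs the powers of 1 +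
  |x|.\<close>

lemma strip_weight_integrable:
  assumes "N \<le> n"
  shows "integrable (lborel \<Otimes>\<^sub>M lborel) (\<lambda>\<omega>. norm (strip_weight n (ph k) \<omega>) * hp_weight (strip_point \<omega>) ^ N)"
proof (rule Bochner_Integration.integrable_bound)
  show "integrable (lborel \<Otimes>\<^sub>M lborel)
      (\<lambda>(s, x). indicator {0..<1::real} s * (4 ^ N * (norm (ph k x) * (1 + \<bar>x\<bar>) ^ (2 * N))))"
  proof (rule lborel_pair.Fubini_integrable)
    have 1: "integrable lborel (\<lambda>x. 4 ^ N * (norm (ph k x) * (1 + \<bar>x\<bar>) ^ (2 * N)))"
      using ph_integrable_weight by (rule integrable_mult_right)
    have 2: "norm (case (s, x) of (s, x) \<Rightarrow> indicator {0..<1::real} s * (4 ^ N * (norm (ph k x) * (1 + \<bar>x\<bar>) ^ (2 * N)))) =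
        indicator {0..<1::real} s * (4 ^ N * (norm (ph k x) * (1 + \<bar>x\<bar>) ^ (2 * N)))" for s x
      by simp
    show "integrable lborel (\<lambda>s. \<integral>x. norm (case (s, x) of (s, x) \<Rightarrow> indicator {0..<1::real} s * (4 ^ N * (norm (ph k x) * (1 + \<bar>x\<bar>) ^ (2 * N)))) \<partial>lborel)"
      unfolding 2 by (simp del: integral_mult_right integral_mult_left add: integral_mult_right_zero)
    show "AE s in lborel. integrable lborel (\<lambda>x. case (s, x) of (s, x) \<Rightarrow> indicator {0..<1::real} s * (4 ^ N * (norm (ph k x) * (1 + \<bar>x\<bar>) ^ (2 * N))))"
      using integrable_mult_right[OF 1] by simp
  qed measurable
  show "(\<lambda>\<omega>. norm (strip_weight n (ph k) \<omega>) * hp_weight (strip_point \<omega>) ^ N) \<in> borel_measurable (lborel \<Otimes>\<^sub>M lborel)"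
    unfolding hp_weight_def by measurable
  have "norm (norm (strip_weight n (ph k) \<omega>) * hp_weight (strip_point \<omega>) ^ N) \<le>
      norm (case \<omega> of (s, x) \<Rightarrow> indicator {0..<1::real} s * (4 ^ N * (norm (ph k x) * (1 + \<bar>x\<bar>) ^ (2 * N))))" for \<omega>
  proof (cases "fst \<omega> \<in> {0..<1}")
    case True
    define y x where "y = 1 - fst \<omega>" and "x = snd \<omega>"
    have y: "0 < y" "y \<le> 1" and \<omega>: "fst \<omega> = 1 - y" "strip_point \<omega> = Complex x y"
      using True by (auto simp: y_def x_def strip_point_def)
    have ge: "hp_weight (Complex x y) \<ge> 1"
      using y by (intro hp_weight_ge) auto
    have "(1 + y)\<^sup>2 / y \<le> 2\<^sup>2 / y"
      using y by (intro divide_right_mono power_mono) auto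
    then have "((1 + y)\<^sup>2 / y) * (1 + \<bar>x\<bar>)\<^sup>2 \<le> (4 / y) * (1 + \<bar>x\<bar>)\<^sup>2"
      by (intro mult_right_mono) auto
    then have "hp_weight (Complex x y) \<le> (4 / y) * (1 + \<bar>x\<bar>)\<^sup>2"
      using hp_weight_Complex[OF y(1), of x] by linarith
    then have "hp_weight (Complex x y) ^ N \<le> ((4 / y) * (1 + \<bar>x\<bar>)\<^sup>2) ^ N"
      using ge by (intro power_mono) auto
    then have "y ^ n * hp_weight (Complex x y) ^ N \<le> y ^ n * ((4 / y) * (1 + \<bar>x\<bar>)\<^sup>2) ^ N"
      using y by (intro mult_left_mono) auto
    also have "\<dots> = y ^ (n - N) * (4 ^ N * (1 + \<bar>x\<bar>) ^ (2 * N))"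
    proof -
      have "y ^ n = y ^ (n - N) * y ^ N"
        using assms by (simp flip: power_add)
      then show ?thesis
        using y by (simp add: power_mult_distrib power_divide power_mult)
    qed
    also have "\<dots> \<le> 1 * (4 ^ N * (1 + \<bar>x\<bar>) ^ (2 * N))"
      using y by (intro mult_right_mono power_le_one) auto
    finally have "norm (ph k x) * (y ^ n * hp_weight (Complex x y) ^ N) \<le> norm (ph k x) * (4 ^ N * (1 + \<bar>x\<bar>) ^ (2 * N))"
      by (intro mult_left_mono) auto
    then show ?thesis
      using True y ge \<omega> by (simp add: strip_weight_def norm_mult norm_power case_prod_unfold mult_ac flip: x_def)
  qed (simp add: strip_weight_def)
  then show "AE \<omega> in lborel \<Otimes>\<^sub>M lborel. norm (norm (strip_weight n (ph k) \<omega>) * hp_weight (strip_point \<omega>) ^ N) \<le>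
      norm (case \<omega> of (s, x) \<Rightarrow> indicator {0..<1::real} s * (4 ^ N * (norm (ph k x) * (1 + \<bar>x\<bar>) ^ (2 * N))))"
    by simp
qed

end

text \<open>\<open>U k y\<close> is the \<open>k\<close>-th derivative of \<open>y \<mapsto> \<integral> \<phi>(x) Im F(x + iy) dx\<close>: by the Cauchy-Riemann
  equations and integration by parts, a derivative in \<open>y\<close> can be moved onto \<open>\<phi>\<close>. Taylor expansion
  at height 1, evaluated at height 0, then gives the integral against the boundary measure.\<close>

locale boundary_taylor = rapid_decay ph for ph +
  fixes F :: "complex \<Rightarrow> complex" and C :: real and N :: nat
  assumes hol: "F holomorphic_on {z. Im z > 0}"
    and growth: "\<And>z. Im z > 0 \<Longrightarrow> norm (F z) \<le> C * hp_weight z ^ N"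
begin

text \<open>After k derivatives in y have been moved onto \<phi>, the remaining factor is, up to
  sign, Im F or Re F in turn; the power of -i records which.\<close>

definition J :: "nat \<Rightarrow> complex \<Rightarrow> real" where
  "J k z = Im ((- \<i>) ^ k * F z)"

definition U :: "nat \<Rightarrow> real \<Rightarrow> complex" where
  "U k y = (\<integral>x. ph k x * of_real (J k (Complex x y)) \<partial>lborel)"

text \<open>This is the derivative of \<open>J k\<close> in y and also minus the derivative of
  \<open>J (Suc k)\<close> in x, which is the Cauchy-Riemann relation behind
  \<open>integral_by_parts\<close>.\<close>

definition J' :: "nat \<Rightarrow> complex \<Rightarrow> real" where
  "J' k z = Im ((- \<i>) ^ k * (\<i> * deriv F z))"

lemma open_hp: "open {z. Im z > 0}"
  by (rule open_halfspace_Im_gt)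

lemma F_deriv: "Im z > 0 \<Longrightarrow> (F has_field_derivative deriv F z) (at z)"
  using holomorphic_derivI[OF hol open_hp] by simp

lemma J_continuous: "continuous_on {z. Im z > 0} (\<lambda>z. of_real (J k z) :: complex)"
  and J'_continuous: "continuous_on {z. Im z > 0} (\<lambda>z. of_real (J' k z) :: complex)"
proof -
  have dF: "deriv F holomorphic_on {z. Im z > 0}"
    by (rule holomorphic_deriv[OF hol open_hp])
  show "continuous_on {z. Im z > 0} (\<lambda>z. of_real (J k z) :: complex)"
    "continuous_on {z. Im z > 0} (\<lambda>z. of_real (J' k z) :: complex)"
    unfolding J_def J'_def
    by (intro continuous_on_of_real continuous_on_Im continuous_on_mult continuous_on_const
        holomorphic_on_imp_continuous_on hol dF)+
qed

lemma J_bound: "Im z > 0 \<Longrightarrow> norm (complex_of_real (J k z)) \<le> C * hp_weight z ^ N"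
  unfolding J_def norm_of_real
  using growth[of z] by (intro order_trans[OF abs_Im_le_cmod]) (simp add: norm_mult norm_power)

lemma J'_bound:
  "Im z > 0 \<Longrightarrow> norm (complex_of_real (J' k z)) \<le> (2 * C * 8 ^ N) * hp_weight z ^ Suc N"
  unfolding J'_def norm_of_real
  using deriv_growth[OF hol growth, of z]
  by (intro order_trans[OF abs_Im_le_cmod]) (simp add: norm_mult norm_power)

text \<open>The product g of \<open>ph k\<close> and \<open>J (Suc k)\<close> tends to 0 at both
  ends, so its derivative g' has integral 0; by the relation between \<open>J\<close> and
  \<open>J'\<close>, g' is the difference of the two integrands to be compared.\<close>

lemma integral_by_parts:
  assumes y: "y > 0"
  shows "(\<integral>x. ph k x * of_real (J' k (Complex x y)) \<partial>lborel) = U (Suc k) y"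
proof -
  define g where "g x = ph k x * of_real (J (Suc k) (Complex x y))" for x
  define g' where "g' x = ph (Suc k) x * of_real (J (Suc k) (Complex x y)) - ph k x * of_real (J' k (Complex x y))" for x
  have int1: "integrable lborel (\<lambda>x. ph (Suc k) x * of_real (J (Suc k) (Complex x y)))"
    using J_continuous J_bound y by (rule ph_integrable_mult)
  have int2: "integrable lborel (\<lambda>x. ph k x * of_real (J' k (Complex x y)))"
    using J'_continuous J'_bound y by (rule ph_integrable_mult)
  have der: "(g has_vector_derivative g' x) (at x)" for x
  proof -
    have "((\<lambda>x. Complex x y) has_vector_derivative 1) (at x)"
      unfolding Complex_eq by (auto intro!: derivative_eq_intros)
    from field_vector_diff_chain_at[OF this, of F "deriv F (Complex x y)"]
    have "((\<lambda>x. F (Complex x y)) has_vector_derivative deriv F (Complex x y)) (at x)"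
      using F_deriv[of "Complex x y"] y by (simp add: o_def)
    then have "((\<lambda>x. (- \<i>) ^ Suc k * F (Complex x y)) has_vector_derivative (- \<i>) ^ Suc k * deriv F (Complex x y)) (at x)"
      by (rule has_vector_derivative_mult_right)
    from bounded_linear.has_vector_derivative[OF bounded_linear_Im this]
    have "((\<lambda>x. J (Suc k) (Complex x y)) has_vector_derivative - J' k (Complex x y)) (at x)"
      unfolding J_def J'_def by (simp add: mult.assoc)
    from has_vector_derivative_mult[OF ph_deriv[of k x] bounded_linear.has_vector_derivative[OF bounded_linear_of_real this]]
    show ?thesis
      unfolding g_def g'_def by (simp add: algebra_simps)
  qed
  have cont: "continuous_on UNIV g'"
  proof -
    have "continuous_on UNIV (\<lambda>x. complex_of_real (J (Suc k) (Complex x y)))"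
      by (rule continuous_on_compose2[OF J_continuous]) (use y in \<open>auto simp: Complex_eq intro!: continuous_intros\<close>)
    moreover have "continuous_on UNIV (\<lambda>x. complex_of_real (J' k (Complex x y)))"
      by (rule continuous_on_compose2[OF J'_continuous]) (use y in \<open>auto simp: Complex_eq intro!: continuous_intros\<close>)
    ultimately show ?thesis
      unfolding g'_def by (intro continuous_on_diff continuous_on_mult ph_continuous)
  qed
  have int: "integrable lborel g'"
    unfolding g'_def by (rule Bochner_Integration.integrable_diff[OF int1 int2])
  obtain D where D: "\<And>x. norm (ph k x) * (1 + \<bar>x\<bar>) ^ (2 * N) \<le> D * (1 / (1 + x\<^sup>2))"
    using ph_decay_square by blast
  define K where "K = C * ((1 + y)\<^sup>2 / y) ^ N"
  have C: "C \<ge> 0"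
    by (rule nonneg_factor[OF order_trans[OF norm_ge_zero growth[of \<i>]]]) (simp_all add: hp_weight_def)
  have g_bound: "norm (g x) \<le> (K * D) * (1 / (1 + x\<^sup>2))" for x
  proof -
    have "norm (g x) \<le> norm (ph k x) * (C * hp_weight (Complex x y) ^ N)"
      unfolding g_def norm_mult using J_bound[of "Complex x y"] y by (intro mult_left_mono) auto
    also have "\<dots> \<le> norm (ph k x) * (C * (((1 + y)\<^sup>2 / y) * (1 + \<bar>x\<bar>)\<^sup>2) ^ N)"
      using hp_weight_Complex[OF y, of x] hp_weight_ge(1)[of "Complex x y"] y C
      by (intro mult_left_mono power_mono) auto
    also have "\<dots> = K * (norm (ph k x) * (1 + \<bar>x\<bar>) ^ (2 * N))"
      by (simp only: K_def power_mult_distrib power_mult) (simp only: mult_ac)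
    also have "\<dots> \<le> K * (D * (1 / (1 + x\<^sup>2)))"
      using C y by (intro mult_left_mono D) (auto simp: K_def)
    finally show ?thesis
      by simp
  qed
  have "((\<lambda>x::real. 1 / (1 + x\<^sup>2)) \<longlongrightarrow> 0) at_top" "((\<lambda>x::real. 1 / (1 + x\<^sup>2)) \<longlongrightarrow> 0) at_bot"
    by real_asymp+
  note null = this[THEN tendsto_mult_right_zero, of "K * D"]
  have lim: "(g \<longlongrightarrow> 0) at_top" "(g \<longlongrightarrow> 0) at_bot"
    using null(1) null(2) by (auto intro: Lim_null_comparison[OF always_eventually[OF allI[OF g_bound]]] simp del: times_divide_eq_right)
  have "(LBINT x=-\<infinity>..\<infinity>. g' x) = 0 - 0"
  proof (rule interval_integral_FTC_integrable)
    show "isCont g' x" for x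
      using cont by (simp add: continuous_on_eq_continuous_at)
    show "set_integrable lborel (einterval (-\<infinity>) \<infinity>) g'"
      using int by (simp add: set_integrable_def einterval_def)
    show "((g \<circ> real_of_ereal) \<longlongrightarrow> 0) (at_right (-\<infinity>))" "((g \<circ> real_of_ereal) \<longlongrightarrow> 0) (at_left \<infinity>)"
      using lim by (simp_all add: ereal_tendsto_simps)
  qed (use der in auto)
  then have "(\<integral>x. g' x \<partial>lborel) = 0"
    by (simp add: interval_lebesgue_integral_def set_lebesgue_integral_def einterval_def)
  then show ?thesis
    unfolding g'_def U_def using int1 int2 by simp
qed

text \<open>Differentiation under the integral sign in the locale of two real parameters: the first
  is the height, the second a dummy. The integration variable enters as x + i, of which only the
  real part is used.\<close>

lemma U_has_vector_derivative:
  assumes y: "y > 0"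
  shows "(U k has_vector_derivative U (Suc k) y) (at y)"
proof -
  define S where "S = {y / 2<..<2 * y} \<times> (UNIV :: real set)"
  define h where "h p z = complex_of_real (J k (Complex (Re z) (fst p)))" for p :: "real \<times> real" and z
  define h1 where "h1 p z = complex_of_real (J' k (Complex (Re z) (fst p)))" for p :: "real \<times> real" and z
  \<comment> \<open>Replacing the height of z by the parameter costs a square of the weight, since 1
    + |Re z| is at most twice the weight and enters squared. Heights between y/2 and 2y keep the
    constant uniform.\<close>
  have W: "hp_weight (Complex (Re z) (fst p)) \<le> ((1 + 2 * y)\<^sup>2 / (y / 2) * 4) * hp_weight z ^ 2"
    if "p \<in> S" "Im z > 0" for p z
  proof -
    have p: "y / 2 \<le> fst p" "fst p \<le> 2 * y" "fst p > 0"
      using that y by (auto simp: S_def)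
    have x: "1 + \<bar>Re z\<bar> \<le> 2 * hp_weight z"
      using hp_weight_ge(1,2)[OF that(2)] abs_Re_le_cmod[of z] by linarith
    have "hp_weight (Complex (Re z) (fst p)) \<le> ((1 + fst p)\<^sup>2 / fst p) * (1 + \<bar>Re z\<bar>)\<^sup>2"
      by (rule hp_weight_Complex[OF p(3)])
    also have "\<dots> \<le> ((1 + 2 * y)\<^sup>2 / (y / 2)) * (2 * hp_weight z)\<^sup>2"
      using p y x by (intro mult_mono frac_le power_mono) auto
    finally show ?thesis
      by (simp add: power_mult_distrib)
  qed
  have pb: "power_bounded (2 * M) S (\<lambda>p z. q (Complex (Re z) (fst p)))"
    if q: "continuous_on {z. Im z > 0} q" "\<And>z. Im z > 0 \<Longrightarrow> norm (q z) \<le> A * hp_weight z ^ M" for q A M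
  proof (rule power_boundedI)
    have A: "A \<ge> 0"
      by (rule nonneg_factor[OF order_trans[OF norm_ge_zero q(2)[of \<i>]]]) (simp_all add: hp_weight_def)
    have pos: "fst p > 0" if "p \<in> S" for p
      using that y by (auto simp: S_def)
    show "continuous_on S (\<lambda>p. q (Complex (Re z) (fst p)))" for z
      using pos by (intro continuous_on_compose2[OF q(1)]) (auto simp: Complex_eq intro!: continuous_intros)
    show "continuous_on {z. Im z > 0} (\<lambda>z. q (Complex (Re z) (fst p)))" if "p \<in> S" for p
      using pos[OF that] by (intro continuous_on_compose2[OF q(1)]) (auto simp: Complex_eq intro!: continuous_intros)
    show "norm (q (Complex (Re z) (fst p))) \<le> (A * ((1 + 2 * y)\<^sup>2 / (y / 2) * 4) ^ M) * hp_weight z ^ (2 * M)"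
      if "p \<in> S" "Im z > 0" for p z
    proof -
      have "norm (q (Complex (Re z) (fst p))) \<le> A * hp_weight (Complex (Re z) (fst p)) ^ M"
        using pos[OF that(1)] by (intro q(2)) simp
      also have "\<dots> \<le> A * (((1 + 2 * y)\<^sup>2 / (y / 2) * 4) * hp_weight z ^ 2) ^ M"
        using W[OF that] hp_weight_ge(1)[of "Complex (Re z) (fst p)"] pos[OF that(1)] A
        by (intro mult_left_mono power_mono) auto
      also have "\<dots> = (A * ((1 + 2 * y)\<^sup>2 / (y / 2) * 4) ^ M) * hp_weight z ^ (2 * M)"
        by (simp only: power_mult_distrib power_mult mult.assoc)
      finally show ?thesis .
    qed
  qed
  interpret weighted_param S lborel "ph k" "\<lambda>x. Complex x 1" "2 * Suc N"
  proof
    show "open S" "convex S"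
      unfolding S_def by (auto intro!: open_Times convex_Times)
    show "(\<lambda>x. Complex x 1) \<in> borel_measurable lborel"
      unfolding Complex_eq by simp
    show "integrable lborel (\<lambda>x. norm (ph k x) * hp_weight (Complex x 1) ^ (2 * Suc N))"
      by (rule ph_integrable_hp_weight) simp
  qed auto
  have p: "(y, 0) \<in> S"
    using y by (simp add: S_def)
  have "((\<lambda>p. \<integral>x. ph k x * h p (Complex x 1) \<partial>lborel) has_derivative
    (\<lambda>v. fst v *\<^sub>R (\<integral>x. ph k x * h1 (y, 0) (Complex x 1) \<partial>lborel) + snd v *\<^sub>R (\<integral>x. ph k x * 0 \<partial>lborel))) (at (y, 0))"
  proof (rule has_derivative_integral[OF _ _ _ p])
    show "power_bounded (2 * Suc N) S h"
      unfolding h_def by (rule power_bounded_mono[OF pb[OF J_continuous J_bound]]) auto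
    show "power_bounded (2 * Suc N) S h1"
      unfolding h1_def by (rule pb[OF J'_continuous J'_bound])
    show "power_bounded (2 * Suc N) S (\<lambda>p z. 0)"
      by (rule power_boundedI[where C = 0]) auto
    fix p z assume pz: "p \<in> S" "Im z > 0"
    have pos: "fst p > 0"
      using pz(1) y by (auto simp: S_def)
    have "((\<lambda>p. Complex (Re z) (fst p)) has_derivative (\<lambda>v. \<i> * of_real (fst v))) (at p)"
      unfolding Complex_eq by (auto intro!: derivative_eq_intros)
    from has_derivative_compose[OF this F_deriv[of "Complex (Re z) (fst p)", unfolded has_field_derivative_def]]
    have "((\<lambda>p. F (Complex (Re z) (fst p))) has_derivative
        (\<lambda>v. deriv F (Complex (Re z) (fst p)) * (\<i> * of_real (fst v)))) (at p)"
      using pos by simp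
    from bounded_linear.has_derivative[OF bounded_linear_of_real
        bounded_linear.has_derivative[OF bounded_linear_Im has_derivative_mult_right[OF this, of "(- \<i>) ^ k"]]]
    have "((\<lambda>p. h p z) has_derivative
      (\<lambda>v. of_real (Im ((- \<i>) ^ k * (deriv F (Complex (Re z) (fst p)) * (\<i> * of_real (fst v))))))) (at p)"
      unfolding h_def J_def .
    moreover have "complex_of_real (Im ((- \<i>) ^ k * (deriv F (Complex (Re z) (fst p)) * (\<i> * of_real r)))) = r *\<^sub>R h1 p z" for r
    proof -
      have "(- \<i>) ^ k * (deriv F (Complex (Re z) (fst p)) * (\<i> * of_real r)) =
          r *\<^sub>R ((- \<i>) ^ k * (\<i> * deriv F (Complex (Re z) (fst p))))"
        by (simp add: scaleR_conv_of_real)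
      moreover have "complex_of_real (Im (r *\<^sub>R c)) = r *\<^sub>R of_real (Im c)" for c
        by (simp add: scaleR_conv_of_real)
      ultimately show ?thesis
        unfolding h1_def J'_def by (simp only:)
    qed
    ultimately show "((\<lambda>p. h p z) has_derivative (\<lambda>v. fst v *\<^sub>R h1 p z + snd v *\<^sub>R 0)) (at p)"
      by simp
  qed
  then have "((\<lambda>p. U k (fst p)) has_derivative (\<lambda>v. fst v *\<^sub>R U (Suc k) y)) (at (y, 0 :: real))"
    by (simp add: h_def h1_def integral_by_parts[OF y] flip: U_def)
  moreover have "((\<lambda>t. (t, 0 :: real)) has_derivative (\<lambda>t. (t, 0))) (at y)"
    by (auto intro!: derivative_eq_intros)
  ultimately have "((\<lambda>t. U k (fst (t, 0 :: real))) has_derivative (\<lambda>t. fst (t, 0 :: real) *\<^sub>R U (Suc k) y)) (at y)"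
    by (rule has_derivative_compose[rotated])
  then show ?thesis
    by (simp add: has_vector_derivative_def)
qed

lemma U_continuous: "y > 0 \<Longrightarrow> isCont (U k) y"
  using U_has_vector_derivative has_vector_derivative_continuous by blast

lemma J_strip_measurable:
  assumes "0 \<le> e"
  shows "(\<lambda>\<omega>. complex_of_real (J k (strip_point \<omega> + \<i> * of_real e))) \<in> borel_measurable (lborel \<Otimes>\<^sub>M lborel)"
proof (rule borel_measurable_half_plane[OF J_continuous])
  show "0 < Im (strip_point \<omega> + \<i> * of_real e)" for \<omega>
    using Im_strip_point[of \<omega>] assms by simp
qed measurable

lemma strip_bound:
  assumes "0 \<le> e" "e \<le> 1"
  shows "norm (strip_weight n f \<omega> * of_real (J k (strip_point \<omega> + \<i> * of_real e))) \<le>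
    (\<bar>C\<bar> * 4 ^ N) * (norm (strip_weight n f \<omega>) * hp_weight (strip_point \<omega>) ^ N)"
proof -
  define z where "z = strip_point \<omega>"
  have z: "Im z > 0" "Im (z + \<i> * of_real e) > 0"
    using Im_strip_point[of \<omega>] assms by (auto simp: z_def)
  have "norm (complex_of_real (J k (z + \<i> * of_real e))) \<le> C * hp_weight (z + \<i> * of_real e) ^ N"
    by (rule J_bound[OF z(2)])
  also have "\<dots> \<le> \<bar>C\<bar> * (4 * hp_weight z) ^ N"
    using hp_weight_shift[OF z(1) assms] hp_weight_ge(1)[OF z(2)] by (intro mult_mono power_mono) auto
  finally have "norm (strip_weight n f \<omega>) * norm (complex_of_real (J k (z + \<i> * of_real e))) \<le>
      norm (strip_weight n f \<omega>) * (\<bar>C\<bar> * (4 * hp_weight z) ^ N)"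
    by (rule mult_left_mono) simp
  then show ?thesis
    unfolding norm_mult z_def by (simp add: power_mult_distrib mult_ac)
qed

text \<open>Writes the Taylor remainder as one double integral over the strip, so that the limit in
  e and the parameter derivatives can both be taken by dominated convergence.\<close>

lemma integral_strip:
  assumes n: "N \<le> n" "n \<noteq> 0" and e: "0 < e" "e \<le> 1"
  shows "integral {0..1} (\<lambda>s. ((1 - s) ^ n / fact n) *\<^sub>R ((- 1) ^ Suc n *\<^sub>R U (Suc n) (1 + e - s))) =
    ((- 1) ^ Suc n / fact n) *\<^sub>R (\<integral>\<omega>. strip_weight n (ph (Suc n)) \<omega> *
       of_real (J (Suc n) (strip_point \<omega> + \<i> * of_real e)) \<partial>(lborel \<Otimes>\<^sub>M lborel))"
proof -
  define f where "f s = ((1 - s) ^ n) *\<^sub>R U (Suc n) (1 + e - s)" for s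
  have "continuous_on {0..1} f"
    unfolding f_def using e
    by (intro continuous_intros continuous_at_imp_continuous_on ballI isCont_o2[OF _ U_continuous]) auto
  then have int_f: "set_integrable lborel {0..1} f"
    by (rule borel_integrable_atLeastAtMost')
  define q where "q \<omega> = strip_weight n (ph (Suc n)) \<omega> * of_real (J (Suc n) (strip_point \<omega> + \<i> * of_real e))" for \<omega>
  have int_q: "integrable (lborel \<Otimes>\<^sub>M lborel) q"
  proof (rule Bochner_Integration.integrable_bound)
    show "integrable (lborel \<Otimes>\<^sub>M lborel) (\<lambda>\<omega>. (\<bar>C\<bar> * 4 ^ N) * (norm (strip_weight n (ph (Suc n)) \<omega>) * hp_weight (strip_point \<omega>) ^ N))"
      using strip_weight_integrable[OF n(1)] by (rule integrable_mult_right)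
    show "q \<in> borel_measurable (lborel \<Otimes>\<^sub>M lborel)"
      unfolding q_def using e by (intro borel_measurable_times strip_weight_measurable J_strip_measurable) auto
    show "AE \<omega> in lborel \<Otimes>\<^sub>M lborel. norm (q \<omega>) \<le> norm ((\<bar>C\<bar> * 4 ^ N) * (norm (strip_weight n (ph (Suc n)) \<omega>) * hp_weight (strip_point \<omega>) ^ N))"
      unfolding q_def real_norm_def using e
      by (intro always_eventually allI order_trans[OF strip_bound abs_ge_self]) auto
  qed
  \<comment> \<open>The endpoint s = 1 is missing from the strip weight; there f has the factor 0^n,
    which vanishes because n \<noteq> 0.\<close>
  have inner: "(\<integral>x. q (s, x) \<partial>lborel) = indicator {0..1} s *\<^sub>R f s" for s
  proof (cases "s \<in> {0..<1}")
    case True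
    then have "strip_point (s, x) + \<i> * of_real e = Complex x (1 + e - s)" for x
      by (simp add: strip_point_def complex_eq_iff)
    then show ?thesis
      using True by (simp add: q_def f_def strip_weight_def U_def scaleR_conv_of_real mult.assoc)
  next
    case False
    then show ?thesis
      using n(2) by (auto simp: q_def strip_weight_def f_def indicator_def)
  qed
  have "integral {0..1} (\<lambda>s. ((1 - s) ^ n / fact n) *\<^sub>R ((- 1) ^ Suc n *\<^sub>R U (Suc n) (1 + e - s))) =
      integral {0..1} (\<lambda>s. ((- 1) ^ Suc n / fact n) *\<^sub>R f s)"
    by (simp add: f_def mult_ac)
  also have "\<dots> = ((- 1) ^ Suc n / fact n) *\<^sub>R integral {0..1} f"
    by (rule integral_cmul)
  also have "integral {0..1} f = (\<integral>s. indicator {0..1} s *\<^sub>R f s \<partial>lborel)"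
    using set_borel_integral_eq_integral(2)[OF int_f] by (simp add: set_lebesgue_integral_def)
  also have "\<dots> = (\<integral>s. (\<integral>x. q (s, x) \<partial>lborel) \<partial>lborel)"
    by (simp only: inner)
  also have "\<dots> = (\<integral>\<omega>. q \<omega> \<partial>(lborel \<Otimes>\<^sub>M lborel))"
    by (rule lborel_pair.integral_fst'[OF int_q])
  finally show ?thesis
    by (simp only: q_def)
qed

text \<open>Taylor's formula runs from height 1 + e down to height e, as derivatives of U are at
  hand for positive heights only; then e tends to 0. The left side converges by Stieltjes inversion,
  the remainder by the majorant of \<open>strip_bound\<close>, which does not depend on e.\<close>

theorem boundary_formula:
  assumes \<nu>: "herglotz_measure F \<nu>" and n: "N \<le> n" "n \<noteq> 0"
  shows "of_real pi * (\<integral>t. ph 0 t \<partial>\<nu>) = (\<Sum>i<Suc n. ((- 1) ^ i / fact i) *\<^sub>R U i 1) +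
    ((- 1) ^ Suc n / fact n) *\<^sub>R (\<integral>\<omega>. strip_weight n (ph (Suc n)) \<omega> *
       of_real (J (Suc n) (strip_point \<omega>)) \<partial>(lborel \<Otimes>\<^sub>M lborel))"
proof -
  define e where "e j = 1 / real (Suc j)" for j
  have e: "0 < e j" "e j \<le> 1" for j
    by (auto simp: e_def)
  have e_lim: "e \<longlonglongrightarrow> 0"
    unfolding e_def by (rule LIMSEQ_inverse_real_of_nat[unfolded inverse_eq_divide])
  define I where "I j = (\<integral>\<omega>. strip_weight n (ph (Suc n)) \<omega> *
       of_real (J (Suc n) (strip_point \<omega> + \<i> * of_real (e j))) \<partial>(lborel \<Otimes>\<^sub>M lborel))" for j
  have taylor: "U 0 (e j) = (\<Sum>i<Suc n. ((- 1) ^ i / fact i) *\<^sub>R U i (1 + e j)) + ((- 1) ^ Suc n / fact n) *\<^sub>R I j" for j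
  proof -
    \<comment> \<open>These are the successive derivatives in the depth s; each one contributes a
      sign because the height decreases with s.\<close>
    define D where "D m = (\<lambda>s. ((- 1) ^ m :: real) *\<^sub>R U m (1 + e j - s))" for m
    have "(D m has_vector_derivative D (Suc m) s) (at s within {0..1})" if "0 \<le> s" "s \<le> 1" for m s
    proof -
      have "((\<lambda>s. 1 + e j - s) has_vector_derivative - 1) (at s)"
        by (auto intro!: derivative_eq_intros)
      moreover have "(U m has_vector_derivative U (Suc m) (1 + e j - s)) (at (1 + e j - s))"
        using that e[of j] by (intro U_has_vector_derivative) linarith
      ultimately have "(U m \<circ> (\<lambda>s. 1 + e j - s) has_vector_derivative (- 1) *\<^sub>R U (Suc m) (1 + e j - s)) (at s)"
        by (rule vector_diff_chain_at)
      then have "((\<lambda>s. ((- 1) ^ m :: real) *\<^sub>R U m (1 + e j - s)) has_vector_derivative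
          ((- 1) ^ m :: real) *\<^sub>R ((- 1) *\<^sub>R U (Suc m) (1 + e j - s))) (at s)"
        unfolding o_def by (rule bounded_linear.has_vector_derivative[OF bounded_linear_scaleR_right])
      then have "(D m has_vector_derivative D (Suc m) s) (at s)"
        unfolding D_def by (simp only: power_Suc scaleR_scaleR mult.commute)
      then show ?thesis
        by (rule has_vector_derivative_at_within)
    qed
    then have "D 0 1 = (\<Sum>i<Suc n. ((1 - 0) ^ i / fact i) *\<^sub>R D i 0) +
        integral {0..1} (\<lambda>s. ((1 - s) ^ (Suc n - 1) / fact (Suc n - 1)) *\<^sub>R D (Suc n) s)"
      by (intro Taylor_integral) auto
    then show ?thesis
      using integral_strip[OF n e(1,2)[of j]] by (simp add: D_def I_def)
  qed
  have "(\<lambda>j. U 0 (e j)) \<longlonglongrightarrow> of_real pi * (\<integral>t. ph 0 t \<partial>\<nu>)"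
  proof -
    obtain A where A: "\<And>x. norm (ph 0 x) * (1 + \<bar>x\<bar>) ^ 0 \<le> A * (1 / (1 + x\<^sup>2))"
      using ph_decay_square by blast
    show ?thesis
      unfolding U_def e_def J_def using herglotz_boundary_limit[OF \<nu> ph_continuous, of 0 A] A by simp
  qed
  moreover have "(\<lambda>j. (\<Sum>i<Suc n. ((- 1) ^ i / fact i) *\<^sub>R U i (1 + e j)) + ((- 1) ^ Suc n / fact n) *\<^sub>R I j) \<longlonglongrightarrow>
    (\<Sum>i<Suc n. ((- 1) ^ i / fact i) *\<^sub>R U i 1) + ((- 1) ^ Suc n / fact n) *\<^sub>R (\<integral>\<omega>. strip_weight n (ph (Suc n)) \<omega> *
       of_real (J (Suc n) (strip_point \<omega>)) \<partial>(lborel \<Otimes>\<^sub>M lborel))"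
  proof (intro tendsto_intros)
    have "(\<lambda>j. 1 + e j) \<longlonglongrightarrow> 1 + 0"
      by (intro tendsto_intros e_lim)
    then show "(\<lambda>j. U i (1 + e j)) \<longlonglongrightarrow> U i 1" for i
      using U_continuous[of 1 i] by (auto intro: isCont_tendsto_compose)
    show "I \<longlonglongrightarrow> (\<integral>\<omega>. strip_weight n (ph (Suc n)) \<omega> *
       of_real (J (Suc n) (strip_point \<omega>)) \<partial>(lborel \<Otimes>\<^sub>M lborel))"
      unfolding I_def
    proof (rule integral_dominated_convergence)
      show "integrable (lborel \<Otimes>\<^sub>M lborel) (\<lambda>\<omega>. (\<bar>C\<bar> * 4 ^ N) * (norm (strip_weight n (ph (Suc n)) \<omega>) * hp_weight (strip_point \<omega>) ^ N))"
        using strip_weight_integrable[OF n(1)] by (rule integrable_mult_right)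
      show "AE \<omega> in lborel \<Otimes>\<^sub>M lborel. norm (strip_weight n (ph (Suc n)) \<omega> * of_real (J (Suc n) (strip_point \<omega> + \<i> * of_real (e j))))
          \<le> (\<bar>C\<bar> * 4 ^ N) * (norm (strip_weight n (ph (Suc n)) \<omega>) * hp_weight (strip_point \<omega>) ^ N)" for j
        using strip_bound[of "e j"] e[of j] by simp
      show "(\<lambda>\<omega>. strip_weight n (ph (Suc n)) \<omega> * of_real (J (Suc n) (strip_point \<omega>))) \<in> borel_measurable (lborel \<Otimes>\<^sub>M lborel)"
        using J_strip_measurable[of 0 "Suc n"] by simp
      show "(\<lambda>\<omega>. strip_weight n (ph (Suc n)) \<omega> * of_real (J (Suc n) (strip_point \<omega> + \<i> * of_real (e j)))) \<in> borel_measurable (lborel \<Otimes>\<^sub>M lborel)" for j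
        using J_strip_measurable[of "e j" "Suc n"] e[of j] by simp
      have "(\<lambda>j. complex_of_real (J (Suc n) (strip_point \<omega> + \<i> * of_real (e j)))) \<longlonglongrightarrow> of_real (J (Suc n) (strip_point \<omega>))" for \<omega>
      proof -
        have "isCont (\<lambda>z. complex_of_real (J (Suc n) z)) (strip_point \<omega>)"
          using J_continuous Im_strip_point open_hp by (simp add: continuous_on_eq_continuous_at)
        moreover have "(\<lambda>j. strip_point \<omega> + \<i> * of_real (e j)) \<longlonglongrightarrow> strip_point \<omega> + \<i> * of_real 0"
          by (intro tendsto_intros e_lim)
        ultimately show ?thesis
          by (auto intro: isCont_tendsto_compose[where f = "\<lambda>j. strip_point \<omega> + \<i> * of_real (e j)"])
      qed
      then show "AE \<omega> in lborel \<Otimes>\<^sub>M lborel. (\<lambda>j. strip_weight n (ph (Suc n)) \<omega> * of_real (J (Suc n) (strip_point \<omega> + \<i> * of_real (e j))))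
          \<longlonglongrightarrow> strip_weight n (ph (Suc n)) \<omega> * of_real (J (Suc n) (strip_point \<omega>))"
        by (auto intro!: tendsto_mult_left)
    qed
  qed
  ultimately show ?thesis
    unfolding taylor by (rule LIMSEQ_unique)
qed

end

section \<open>Growth of entire functions of order one half\<close>

text \<open>Growth of order at most one half and finite type. The argument u will be a multiple of
  w^2 or bounded, with |w| \<le> |ln |z|| + \<pi>, so that exp(M \<surd>|u|) is bounded by a power
  of the weight.\<close>

definition half_order :: "(complex \<Rightarrow> complex) \<Rightarrow> bool" where
  "half_order f \<longleftrightarrow> f holomorphic_on UNIV \<and> (\<exists>K\<ge>0. \<exists>M\<ge>0. \<forall>u. norm (f u) \<le> K * exp (M * sqrt (norm u)))"

lemma norm_sinh_cosh_le: "norm (sinh v) \<le> exp (norm v)" "norm (cosh v) \<le> exp (norm v)" for v :: complex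
proof -
  have e: "norm (exp v) \<le> exp (norm v)" "norm (exp (- v)) \<le> exp (norm v)"
    using norm_exp[of v] norm_exp[of "- v"] by auto
  have "norm (exp v - exp (- v)) \<le> exp (norm v) + exp (norm v)"
    "norm (exp v + exp (- v)) \<le> exp (norm v) + exp (norm v)"
    by (rule order_trans[OF norm_triangle_ineq4 add_mono[OF e]] order_trans[OF norm_triangle_ineq add_mono[OF e]])+
  then show "norm (sinh v) \<le> exp (norm v)" "norm (cosh v) \<le> exp (norm v)"
    by (simp_all add: sinh_field_def cosh_field_def norm_divide)
qed

lemma norm_csqrt: "norm (csqrt u) = sqrt (norm u)"
  by (metis norm_ge_zero norm_power power2_csqrt real_sqrt_unique)

lemma half_order_shc: "half_order shc"
proof -
  have "bounded (shc ` cball 0 1)"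
    by (intro compact_imp_bounded compact_continuous_image holomorphic_on_imp_continuous_on
        shc_holomorphic compact_cball)
  then obtain B where "\<forall>u\<in>cball 0 1. norm (shc u) \<le> B"
    unfolding bounded_iff by auto
  then have B: "norm (shc u) \<le> B" if "norm u \<le> 1" for u
    using that by simp
  have "norm (shc u) \<le> max B 1 * exp (1 * sqrt (norm u))" for u
  proof (cases "norm u \<le> 1")
    case True
    have "norm (shc u) * 1 \<le> max B 1 * exp (1 * sqrt (norm u))"
      using B[OF True] by (intro mult_mono) auto
    then show ?thesis
      by simp
  next
    case False
    define v where "v = csqrt u"
    have v: "norm v = sqrt (norm u)" "norm v \<ge> 1" "v\<^sup>2 = u"
      using False by (auto simp: v_def norm_csqrt)
    have "norm (shc u) \<le> norm v * norm (shc u)"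
      using v(2) mult_right_mono[of 1 "norm v" "norm (shc u)"] by simp
    also have "\<dots> = norm (sinh v)"
      using shc_square[of v] v(3) by (metis norm_mult)
    also have "\<dots> \<le> 1 * exp (1 * sqrt (norm u))"
      using norm_sinh_cosh_le(1)[of v] v(1) by simp
    also have "\<dots> \<le> max B 1 * exp (1 * sqrt (norm u))"
      by (intro mult_right_mono) auto
    finally show ?thesis .
  qed
  then show ?thesis
    unfolding half_order_def using shc_holomorphic
    by (intro conjI exI[of _ "max B 1"] exI[of _ 1]) auto
qed

lemma half_order_chc: "half_order chc"
proof -
  have "norm (chc u) \<le> 1 * exp (1 * sqrt (norm u))" for u
    using norm_sinh_cosh_le(2)[of "csqrt u"] chc_square[of "csqrt u"] by (simp add: norm_csqrt)
  then show ?thesis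
    unfolding half_order_def using chc_holomorphic
    by (intro conjI exI[of _ 1]) auto
qed

text \<open>Cauchy's inequality on the unit disc about u, with \<surd>(|u| + 1) \<le> \<surd>|u| +
  1. This stability carries the bounds through all orders of differentiation in \<alpha>.\<close>

lemma half_order_deriv:
  assumes "half_order f"
  shows "half_order (deriv f)"
proof -
  obtain K M where hol: "f holomorphic_on UNIV" and KM: "K \<ge> 0" "M \<ge> 0"
    and f: "\<And>u. norm (f u) \<le> K * exp (M * sqrt (norm u))"
    using assms unfolding half_order_def by blast
  have "norm (deriv f u) \<le> (K * exp M) * exp (M * sqrt (norm u))" for u
  proof -
    have "norm ((deriv ^^ 1) f u) \<le> fact 1 * ((K * exp M) * exp (M * sqrt (norm u))) / 1 ^ 1"
    proof (rule Cauchy_inequality)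
      show "f holomorphic_on ball u 1" "continuous_on (cball u 1) f"
        using hol by (auto intro: holomorphic_on_subset holomorphic_on_imp_continuous_on)
      show "norm (f x) \<le> (K * exp M) * exp (M * sqrt (norm u))" if "norm (u - x) = 1" for x
      proof -
        have "norm x \<le> norm u + 1"
          using norm_triangle_ineq2[of x u] that by (simp add: norm_minus_commute)
        then have "sqrt (norm x) \<le> sqrt (norm u + 1)"
          by simp
        also have "\<dots> \<le> sqrt (norm u) + sqrt 1"
          by (rule sqrt_add_le_add_sqrt) auto
        finally have "M * sqrt (norm x) \<le> M * (sqrt (norm u) + 1)"
          using KM by (intro mult_left_mono) auto
        then have "K * exp (M * sqrt (norm x)) \<le> K * exp (M * (sqrt (norm u) + 1))"
          using KM by (intro mult_left_mono) auto
        also have "\<dots> = (K * exp M) * exp (M * sqrt (norm u))"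
          by (simp add: distrib_left exp_add)
        finally show ?thesis
          using f[of x] by linarith
      qed
    qed simp
    then show ?thesis
      by simp
  qed
  moreover have "deriv f holomorphic_on UNIV"
    using hol by (intro holomorphic_deriv) auto
  ultimately show ?thesis
    unfolding half_order_def using KM by (intro conjI exI[of _ "K * exp M"] exI[of _ M]) auto
qed

section \<open>Parameter dependence of \<open>R\<close> and \<open>M\<close>\<close>

text \<open>The lower bound for the imaginary part degenerates as \<alpha> tends to 1, and the
  growth exponents depend on the size of \<alpha>; \<theta> stays unrestricted. The strips are open
  and convex, as \<open>weighted_param\<close> demands, and exhaust the domain as L grows.\<close>

definition param_strip :: "real \<Rightarrow> (real \<times> real) set" where
  "param_strip L = {p. - L < fst p \<and> fst p < 1 - 1 / L}"

lemma open_param_strip: "open (param_strip L)"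
  unfolding param_strip_def by (intro open_Collect_conj open_Collect_less continuous_intros)

lemma convex_param_strip: "convex (param_strip L)"
proof -
  have "param_strip L = {- L<..<1 - 1 / L} \<times> UNIV"
    by (auto simp: param_strip_def)
  then show ?thesis
    by (simp add: convex_Times)
qed

lemma param_strip_abs:
  assumes "L \<ge> 1" "p \<in> param_strip L"
  shows "\<bar>fst p\<bar> \<le> L"
proof -
  have "0 \<le> 1 / L" "- L < fst p" "fst p < 1 - 1 / L"
    using assms by (auto simp: param_strip_def)
  then show ?thesis
    using assms(1) by linarith
qed

lemma param_strip_UN: "(\<Union>n. param_strip (real (Suc n))) = {(\<alpha>, \<theta>). \<alpha> < 1}"
proof (intro set_eqI iffI)
  fix p :: "real \<times> real"
  assume "p \<in> (\<Union>n. param_strip (real (Suc n)))"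
  then obtain n where "fst p < 1 - 1 / real (Suc n)"
    by (auto simp: param_strip_def)
  also have "\<dots> < 1"
    by simp
  finally show "p \<in> {(\<alpha>, \<theta>). \<alpha> < 1}"
    by (simp add: case_prod_unfold)
next
  fix p :: "real \<times> real"
  assume "p \<in> {(\<alpha>, \<theta>). \<alpha> < 1}"
  then have p: "1 - fst p > 0"
    by (simp add: case_prod_unfold)
  obtain n where n: "real n > max \<bar>fst p\<bar> (1 / (1 - fst p))"
    using reals_Archimedean2 by blast
  have "1 / (1 - fst p) < real (Suc n)"
    using n by simp
  then have "1 / real (Suc n) < 1 - fst p"
    using p by (simp add: divide_less_eq less_divide_eq mult.commute)
  moreover have "\<bar>fst p\<bar> < real n"
    using n by simp
  then have "- real (Suc n) < fst p"
    by linarith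
  ultimately have "p \<in> param_strip (real (Suc n))"
    by (simp add: param_strip_def)
  then show "p \<in> (\<Union>n. param_strip (real (Suc n)))"
    by blast
qed

lemma log_neg_eq: "log_neg z = Ln (- \<i> * z) - \<i> * of_real (pi / 2)"
  by (simp add: log_neg_def slit_ln_def)

text \<open>For the third claim: -Im w = \<pi> - arg z has sine Im z / |z|, and sin x \<le> x. From
  it stems the factor Im z / |z| in the lower bound for the imaginary part.\<close>

lemma log_neg_half_plane:
  assumes z: "Im z > 0"
  shows "Re (log_neg z) = ln (norm z)" "- pi < Im (log_neg z)" "Im (log_neg z) \<le> - Im z / norm z"
    "z \<in> slit_plane" "(log_neg has_field_derivative 1 / z) (at z)"
proof -
  define u where "u = - \<i> * z"
  have u: "Re u = Im z" "norm u = norm z" "u \<noteq> 0" "u \<notin> \<real>\<^sub>\<le>\<^sub>0"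
    using z by (auto simp: u_def norm_mult complex_nonpos_Reals_iff)
  have nz: "z \<noteq> 0"
    using z by auto
  have log_u: "log_neg z = Ln u - \<i> * of_real (pi / 2)"
    unfolding log_neg_eq u_def ..
  show "Re (log_neg z) = ln (norm z)"
    using u by (simp add: log_u)
  have "\<bar>Im (Ln u)\<bar> < pi / 2"
    using u z Re_Ln_pos_lt[of u] by simp
  moreover have Im: "Im (log_neg z) = Im (Ln u) - pi / 2"
    by (simp add: log_u)
  ultimately show "- pi < Im (log_neg z)"
    by linarith
  have "Im z = Re (exp (Ln u))"
    using u by simp
  also have "\<dots> = norm z * cos (Im (Ln u))"
    unfolding Re_exp using u nz by simp
  finally have "Im z / norm z = cos (Im (Ln u))"
    using nz by (simp add: field_simps)
  also have "\<dots> = sin (- Im (log_neg z))"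
    unfolding Im by (simp add: sin_diff)
  also have "\<dots> \<le> - Im (log_neg z)"
    using \<open>\<bar>Im (Ln u)\<bar> < pi / 2\<close> unfolding Im by (intro sin_x_le_x) linarith
  finally show "Im (log_neg z) \<le> - Im z / norm z"
    by simp
  show "z \<in> slit_plane"
    using z by (auto simp: slit_plane_def)
  show "(log_neg has_field_derivative 1 / z) (at z)"
    unfolding log_neg_def slit_ln_def using u(3,4) unfolding u_def
    by (auto intro!: derivative_eq_intros simp: field_simps)
qed

lemma log_neg_continuous: "continuous_on {z. Im z > 0} log_neg"
  by (intro continuous_at_imp_continuous_on ballI DERIV_isCont[OF log_neg_half_plane(5)]) simp

text \<open>As |Im w| \<le> \<pi>, exp |w| is at most exp \<pi> times the larger of |z| and 1 / |z|,
  both of which the weight dominates.\<close>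

lemma exp_log_neg_bound:
  assumes z: "Im z > 0"
  shows "exp (real N * norm (log_neg z)) \<le> exp (real N * pi) * hp_weight z ^ N"
proof -
  have n: "norm z > 0"
    using z by auto
  have "0 < Im z / norm z"
    using z n by (rule divide_pos_pos)
  then have "\<bar>Im (log_neg z)\<bar> \<le> pi"
    using log_neg_half_plane(2,3)[OF z] by linarith
  then have "norm (log_neg z) \<le> \<bar>ln (norm z)\<bar> + pi"
    using cmod_le[of "log_neg z"] log_neg_half_plane(1)[OF z] by simp
  then have "exp (real N * norm (log_neg z)) \<le> exp (real N * (\<bar>ln (norm z)\<bar> + pi))"
    by (simp add: mult_left_mono)
  also have "\<dots> = exp (real N * pi) * exp \<bar>ln (norm z)\<bar> ^ N"
    by (simp add: distrib_left exp_add exp_of_nat_mult)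
  also have "exp \<bar>ln (norm z)\<bar> \<le> hp_weight z"
  proof (cases "ln (norm z) \<ge> 0")
    case True
    then show ?thesis
      using n hp_weight_ge(2)[OF z] by simp
  next
    case False
    then have "exp \<bar>ln (norm z)\<bar> = 1 / norm z"
      using n by (simp add: exp_minus inverse_eq_divide)
    then show ?thesis
      using hp_weight_ge(4)[OF z] by simp
  qed
  then have "exp (real N * pi) * exp \<bar>ln (norm z)\<bar> ^ N \<le> exp (real N * pi) * hp_weight z ^ N"
    by (intro mult_left_mono power_mono) auto
  finally show ?thesis .
qed

lemma norm_log_neg_bound:
  assumes "Im z > 0"
  shows "norm (log_neg z) \<le> exp pi * hp_weight z ^ 1"
proof -
  have "exp (norm (log_neg z)) \<le> exp pi * hp_weight z ^ 1"
    using exp_log_neg_bound[OF assms, of 1] by simp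
  then show ?thesis
    using exp_ge_add_one_self[of "norm (log_neg z)"] by linarith
qed

text \<open>Applied with c constant or c = w^2 / 4. Since |c| is at most quadratic in |w|, M
  \<surd>(L |c|) is at most linear in |w| and its exponential is bounded by a power of the weight. A
  derivative in \<alpha> yields c f'(c \<alpha>), where f' is again of half order, so the induction
  closes.\<close>

lemma bounded_diff_half_order:
  assumes L: "L \<ge> 1" and c: "continuous_on {z. Im z > 0} c"
    "\<And>z. Im z > 0 \<Longrightarrow> norm (c z) \<le> A * (1 + (norm (log_neg z))\<^sup>2)" and A: "A \<ge> 0"
    and f: "half_order f"
  shows "bounded_diff (param_strip L) k (\<lambda>p z. f (c z * of_real (fst p)))"
  using f
proof (induction k arbitrary: f)
  have c_exp: "\<exists>C N. \<forall>z. Im z > 0 \<longrightarrow> exp (M * sqrt (L * norm (c z))) \<le> C * hp_weight z ^ N" if "M \<ge> 0" for M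
  proof -
    \<comment> \<open>The slope of the linear bound in |w|, rounded up because the weight carries
      natural exponents.\<close>
    obtain N where N: "real N \<ge> M * sqrt (L * A)"
      using real_arch_simple by blast
    have "exp (M * sqrt (L * norm (c z))) \<le> (exp (real N) * exp (real N * pi)) * hp_weight z ^ N" if z: "Im z > 0" for z
    proof -
      define x where "x = norm (log_neg z)"
      have "sqrt (L * norm (c z)) \<le> sqrt ((L * A) * (1 + x)\<^sup>2)"
      proof (rule real_sqrt_le_mono)
        have "A * (1 + x\<^sup>2) \<le> A * (1 + x)\<^sup>2"
          using A by (intro mult_left_mono) (auto simp: x_def power2_sum)
        then have "L * norm (c z) \<le> L * (A * (1 + x)\<^sup>2)"
          using c(2)[OF z] L by (intro mult_left_mono) (auto simp: x_def)
        then show "L * norm (c z) \<le> L * A * (1 + x)\<^sup>2"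
          by (simp add: mult.assoc)
      qed
      also have "\<dots> = sqrt (L * A) * (1 + x)"
        using L A by (simp add: real_sqrt_mult x_def)
      finally have "M * sqrt (L * norm (c z)) \<le> M * (sqrt (L * A) * (1 + x))"
        using that \<open>M \<ge> 0\<close> by (intro mult_left_mono) auto
      also have "\<dots> \<le> real N * (1 + x)"
        unfolding mult.assoc[symmetric] by (intro mult_right_mono N) (simp add: x_def)
      finally have "exp (M * sqrt (L * norm (c z))) \<le> exp (real N) * exp (real N * x)"
        by (simp add: distrib_left flip: exp_add)
      also have "\<dots> \<le> exp (real N) * (exp (real N * pi) * hp_weight z ^ N)"
        unfolding x_def by (intro mult_left_mono exp_log_neg_bound z) auto
      finally show ?thesis
        by (simp add: mult.assoc)
    qed
    then show ?thesis
      by blast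
  qed
  have pb: "\<exists>N. power_bounded N (param_strip L) (\<lambda>p z. f (c z * of_real (fst p)))" if hf: "half_order f" for f
  proof -
    obtain K M where hol: "f holomorphic_on UNIV" and KM: "K \<ge> 0" "M \<ge> 0"
      and f: "\<And>u. norm (f u) \<le> K * exp (M * sqrt (norm u))"
      using hf unfolding half_order_def by blast
    have cont: "continuous_on UNIV f"
      using hol by (rule holomorphic_on_imp_continuous_on)
    obtain C N where CN: "\<And>z. Im z > 0 \<Longrightarrow> exp (M * sqrt (L * norm (c z))) \<le> C * hp_weight z ^ N"
      using c_exp[OF KM(2)] by blast
    have "power_bounded N (param_strip L) (\<lambda>p z. f (c z * of_real (fst p)))"
    proof (rule power_boundedI)
      show "continuous_on (param_strip L) (\<lambda>p. f (c z * of_real (fst p)))" for z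
        by (rule continuous_on_compose2[OF cont]) (auto intro!: continuous_intros)
      show "continuous_on {z. Im z > 0} (\<lambda>z. f (c z * of_real (fst p)))" for p :: "real \<times> real"
        by (rule continuous_on_compose2[OF cont]) (auto intro!: continuous_intros c(1))
      show "norm (f (c z * of_real (fst p))) \<le> (K * C) * hp_weight z ^ N" if p: "p \<in> param_strip L" and z: "Im z > 0" for p z
      proof -
        have "norm (c z * complex_of_real (fst p)) \<le> L * norm (c z)"
          using param_strip_abs[OF L p] mult_right_mono[of "\<bar>fst p\<bar>" L "norm (c z)"] by (simp add: norm_mult mult.commute)
        then have "M * sqrt (norm (c z * complex_of_real (fst p))) \<le> M * sqrt (L * norm (c z))"
          using KM by (intro mult_left_mono) auto
        then have "K * exp (M * sqrt (norm (c z * complex_of_real (fst p)))) \<le> K * exp (M * sqrt (L * norm (c z)))"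
          using KM by (intro mult_left_mono) auto
        also have "\<dots> \<le> K * (C * hp_weight z ^ N)"
          using KM by (intro mult_left_mono CN z)
        finally show ?thesis
          using f[of "c z * of_real (fst p)"] by (simp add: mult.assoc)
      qed
    qed
    then show ?thesis
      by blast
  qed
  {
    case 0
    then show ?case
      unfolding bounded_diff_0 using pb by blast
  next
    case (Suc k)
    obtain N where N: "power_bounded N (param_strip L) (\<lambda>p z. f (c z * of_real (fst p)))"
      using pb[OF Suc.prems] by blast
    show ?case
    proof (rule bounded_diff_SucI[OF N])
      have "norm (c z) \<le> (A * (1 + (exp pi)\<^sup>2)) * hp_weight z ^ 2" if z: "Im z > 0" for z
      proof -
        have "(norm (log_neg z))\<^sup>2 \<le> (exp pi * hp_weight z)\<^sup>2"
          using norm_log_neg_bound[OF z] by (intro power_mono) auto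
        moreover have "1 \<le> hp_weight z ^ 2"
          using hp_weight_ge(1)[OF z] by (rule one_le_power)
        ultimately have "A * (1 + (norm (log_neg z))\<^sup>2) \<le> A * (hp_weight z ^ 2 + (exp pi * hp_weight z)\<^sup>2)"
          using A by (intro mult_left_mono add_mono) auto
        then show ?thesis
          using c(2)[OF z] by (simp add: power_mult_distrib algebra_simps)
      qed
      then have "bounded_diff (param_strip L) k (\<lambda>p z. c z)"
        using c(1) by (intro bounded_diff_function_of_z)
      then show "bounded_diff (param_strip L) k (\<lambda>p z. c z * deriv f (c z * of_real (fst p)))"
        using Suc.IH[OF half_order_deriv[OF Suc.prems]] by (rule bounded_diff_mult)
      show "bounded_diff (param_strip L) k (\<lambda>p z. 0)"
        by (rule bounded_diff_const)
      fix p :: "real \<times> real" and z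
      have f': "(f has_field_derivative deriv f (c z * of_real (fst p))) (at (c z * of_real (fst p)))"
        using Suc.prems unfolding half_order_def by (intro holomorphic_derivI[of _ UNIV]) auto
      have "((\<lambda>p. c z * of_real (fst p)) has_derivative (\<lambda>v. c z * of_real (fst v))) (at p)"
        by (auto intro!: derivative_eq_intros)
      from has_derivative_compose[OF this f'[unfolded has_field_derivative_def]]
      show "((\<lambda>p. f (c z * of_real (fst p))) has_derivative
        (\<lambda>v. fst v *\<^sub>R (c z * deriv f (c z * of_real (fst p))) + snd v *\<^sub>R 0)) (at p)"
        by (rule has_derivative_eq_rhs) (auto simp: scaleR_conv_of_real mult_ac)
    qed
  }
qed

lemma bounded_diff_sin_cos:
  "bounded_diff S k (\<lambda>p z. of_real (sin (snd p)))" "bounded_diff S k (\<lambda>p z. of_real (cos (snd p)))"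
proof -
  have pb: "power_bounded 0 S (\<lambda>p z. complex_of_real (sin (snd p)))" "power_bounded 0 S (\<lambda>p z. complex_of_real (cos (snd p)))"
    by (rule power_boundedI[where C = 1]; auto intro!: continuous_intros)+
  have "bounded_diff S k (\<lambda>p z. of_real (sin (snd p))) \<and> bounded_diff S k (\<lambda>p z. of_real (cos (snd p)))"
  proof (induction k)
    case 0
    then show ?case
      unfolding bounded_diff_0 using pb by blast
  next
    case (Suc k)
    have "bounded_diff S (Suc k) (\<lambda>p z. of_real (sin (snd p)))"
    proof (rule bounded_diff_SucI[OF pb(1) bounded_diff_const[of _ _ 0]])
      show "bounded_diff S k (\<lambda>p z. of_real (cos (snd p)))"
        using Suc by blast
    qed (auto intro!: derivative_eq_intros simp: scaleR_conv_of_real)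
    moreover have "bounded_diff S (Suc k) (\<lambda>p z. of_real (cos (snd p)))"
    proof (rule bounded_diff_SucI[OF pb(2) bounded_diff_const[of _ _ 0]])
      show "bounded_diff S k (\<lambda>p z. - 1 * of_real (sin (snd p)))"
        using Suc by (intro bounded_diff_mult bounded_diff_const) auto
    qed (auto intro!: derivative_eq_intros simp: scaleR_conv_of_real)
    ultimately show ?case
      by blast
  qed
  then show "bounded_diff S k (\<lambda>p z. of_real (sin (snd p)))" "bounded_diff S k (\<lambda>p z. of_real (cos (snd p)))"
    by auto
qed

text \<open>The functions A and B are the coefficients of -cos \<theta> and sin \<theta> in
  \<open>R\<close>. Arguments are written as a coefficient times \<open>of_real \<alpha>\<close>,
  and \<open>R1\<close>, \<open>R2\<close> as sums of products with constants, to match the closure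
  rules of \<open>bounded_diff\<close>.\<close>

definition solA :: "real \<Rightarrow> complex \<Rightarrow> complex" where
  "solA \<alpha> z = chc (of_real (- pi\<^sup>2 / 4) * of_real \<alpha>) * (log_neg z * shc ((log_neg z)\<^sup>2 / 4 * of_real \<alpha>))"

definition solB :: "real \<Rightarrow> complex \<Rightarrow> complex" where
  "solB \<alpha> z = of_real pi * (shc (of_real (- pi\<^sup>2 / 4) * of_real \<alpha>) * chc ((log_neg z)\<^sup>2 / 4 * of_real \<alpha>))"

definition R1 :: "real \<times> real \<Rightarrow> complex \<Rightarrow> complex" where
  "R1 p z = of_real (sin (snd p)) * solB (fst p) z + - 1 * (of_real (cos (snd p)) * solA (fst p) z)"

definition R2 :: "real \<times> real \<Rightarrow> complex \<Rightarrow> complex" where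
  "R2 p z = of_real (cos (snd p)) * solB (fst p) z + of_real (sin (snd p)) * solA (fst p) z"

lemma R_fun_half_plane:
  assumes "Im z > 0"
  shows "R_fun (of_real \<alpha>, of_real \<theta>, z) = R1 (\<alpha>, \<theta>) z"
    "R_fun (of_real \<alpha>, of_real (\<theta> + pi / 2), z) = R2 (\<alpha>, \<theta>) z"
proof -
  have z: "z \<in> slit_plane"
    using assms by (rule log_neg_half_plane(4))
  have "cos (complex_of_real \<theta> + of_real pi / 2) = - of_real (sin \<theta>)"
    "sin (complex_of_real \<theta> + of_real pi / 2) = of_real (cos \<theta>)"
    using arg_cong[OF cos_add[of \<theta> "pi / 2"], of complex_of_real] arg_cong[OF sin_add[of \<theta> "pi / 2"], of complex_of_real]
    by (simp_all flip: cos_of_real sin_of_real)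
  moreover have "R_expl (of_real \<alpha>) t (log_neg z) = sin t * solB \<alpha> z - cos t * solA \<alpha> z" for t
  proof -
    have e: "- (complex_of_real pi)\<^sup>2 / 4 * of_real \<alpha> = of_real (- pi\<^sup>2 / 4) * of_real \<alpha>"
      "of_real \<alpha> * (log_neg z)\<^sup>2 / 4 = (log_neg z)\<^sup>2 / 4 * of_real \<alpha>"
      by simp_all
    show ?thesis
      unfolding R_expl_def solA_def solB_def e by (simp only: mult.assoc mult.left_commute)
  qed
  ultimately show "R_fun (of_real \<alpha>, of_real \<theta>, z) = R1 (\<alpha>, \<theta>) z"
    "R_fun (of_real \<alpha>, of_real (\<theta> + pi / 2), z) = R2 (\<alpha>, \<theta>) z"
    unfolding R_fun_eq using z by (simp_all add: R_closed_form_def R1_def R2_def sin_of_real cos_of_real)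
qed

text \<open>Quotients are spelled out as products with inverses, the form that the closure rules
  accept.\<close>

lemma M_fun_half_plane:
  assumes "Im z > 0"
  shows "M_fun \<alpha> \<theta> z = of_real (- 1 / (2 * pi\<^sup>2)) *
    ((inverse (shc (of_real (- pi\<^sup>2) * of_real \<alpha>)) * inverse (shc (of_real (- pi\<^sup>2) * of_real \<alpha>))) *
      (R2 (\<alpha>, \<theta>) z * inverse (R1 (\<alpha>, \<theta>) z)))"
proof -
  have S: "Sinc (of_real (pi\<^sup>2 * \<alpha>)) = shc (of_real (- pi\<^sup>2) * of_real \<alpha>)"
    by (simp add: shc_def)
  have "- r / (2 * (of_real pi)\<^sup>2 * s\<^sup>2 * q) = of_real (- 1 / (2 * pi\<^sup>2)) * ((inverse s * inverse s) * (r * inverse q))"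
    for r s q :: complex
  proof -
    have "of_real (- 1 / (2 * pi\<^sup>2)) = - inverse (2 * (complex_of_real pi)\<^sup>2)"
      by (simp add: inverse_eq_divide)
    then show ?thesis
      by (simp only: divide_inverse inverse_mult_distrib power2_eq_square[of s] mult_minus_left
          mult_minus_right mult.assoc mult.left_commute mult.commute)
  qed
  then show ?thesis
    unfolding M_fun_def R_fun_half_plane(2)[OF assms] unfolding R_fun_half_plane(1)[OF assms] S .
qed

text \<open>The constant factors of A and B multiply to \<pi> times \<open>shc\<close> at -\<pi>^2
  \<alpha> by \<open>shc_double\<close>; of the two summands in \<open>shc_chc_cnj\<close> only the
  second has an imaginary part.\<close>

lemma Im_solA_solB:
  "Im (solA \<alpha> z * cnj (solB \<alpha> z)) = pi * Re (shc (of_real (- pi\<^sup>2 * \<alpha>))) *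
     (Im (log_neg z) * Re (shc (of_real (- \<alpha> * (Im (log_neg z))\<^sup>2))))"
proof -
  define w where "w = log_neg z"
  define a b where "a = Re (chc (of_real (- pi\<^sup>2 / 4 * \<alpha>)))" and "b = Re (shc (of_real (- pi\<^sup>2 / 4 * \<alpha>)))"
  have chc_real: "chc (of_real x) = of_real (Re (chc (of_real x)))" for x
    using chc_cnj[of "of_real x"] by (metis Reals_cnj_iff complex_cnj_complex_of_real of_real_Re)
  have a: "chc (of_real (- pi\<^sup>2 / 4) * of_real \<alpha>) = of_real a"
    unfolding a_def using chc_real[of "- pi\<^sup>2 / 4 * \<alpha>"] by (simp only: of_real_mult)
  have b: "shc (of_real (- pi\<^sup>2 / 4) * of_real \<alpha>) = of_real b"
    unfolding b_def using shc_of_real[of "- pi\<^sup>2 / 4 * \<alpha>"] by (simp only: of_real_mult)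
  have ab: "Re (shc (of_real (- pi\<^sup>2 * \<alpha>))) = a * b"
  proof -
    have "of_real (- pi\<^sup>2 * \<alpha>) / 4 = complex_of_real (- pi\<^sup>2 / 4) * of_real \<alpha>"
      by simp
    then show ?thesis
      using shc_double[of "of_real (- pi\<^sup>2 * \<alpha>)"] a b by simp
  qed
  have "solA \<alpha> z * cnj (solB \<alpha> z) = of_real (pi * (a * b)) *
      (w * shc (of_real \<alpha> * w\<^sup>2 / 4) * cnj (chc (of_real \<alpha> * w\<^sup>2 / 4)))"
    unfolding solA_def solB_def a b by (simp add: w_def mult_ac)
  also have "\<dots> = of_real (pi * (a * b)) * (of_real (Re w) * shc (of_real (\<alpha> * (Re w)\<^sup>2)) +
      \<i> * of_real (Im w) * shc (of_real (- \<alpha> * (Im w)\<^sup>2)))"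
    by (simp only: shc_chc_cnj)
  finally show ?thesis
    unfolding ab by (simp add: w_def del: of_real_mult)
qed

text \<open>An orthogonal substitution by \<theta>: the terms with |A|^2 and |B|^2 are real, and the
  mixed ones combine with coefficient sin^2 + cos^2.\<close>

lemma Im_R2_R1: "Im (R2 p z * cnj (R1 p z)) = Im (solA (fst p) z * cnj (solB (fst p) z))"
proof -
  have "Im ((of_real c * B + of_real s * A) * cnj (of_real s * B + - 1 * (of_real c * A))) = (s\<^sup>2 + c\<^sup>2) * Im (A * cnj B)"
    for s c :: real and A B
    by (simp add: power2_eq_square algebra_simps)
  from this[of "cos (snd p)" _ "sin (snd p)"] show ?thesis
    unfolding R1_def R2_def by simp
qed

section \<open>Growth of \<open>R\<close>, \<open>1 / R\<close> and \<open>M\<close> together with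
  their parameter derivatives\<close>

lemma bounded_diff_sol:
  assumes L: "L \<ge> 1"
  shows "bounded_diff (param_strip L) k (\<lambda>p z. solA (fst p) z)" "bounded_diff (param_strip L) k (\<lambda>p z. solB (fst p) z)"
proof -
  have const: "bounded_diff (param_strip L) k (\<lambda>p z. f (of_real x * of_real (fst p)))" if "half_order f" for f x
    by (rule bounded_diff_half_order[OF L _ _ _ that, of _ "\<bar>x\<bar>"]) (auto simp: distrib_left)
  have w: "bounded_diff (param_strip L) k (\<lambda>p z. f ((log_neg z)\<^sup>2 / 4 * of_real (fst p)))" if "half_order f" for f
    by (rule bounded_diff_half_order[OF L _ _ _ that, of _ 1])
      (auto simp: norm_divide norm_power intro!: continuous_intros log_neg_continuous)
  have "bounded_diff (param_strip L) k (\<lambda>p z. log_neg z)"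
    using log_neg_continuous norm_log_neg_bound by (rule bounded_diff_function_of_z)
  then show "bounded_diff (param_strip L) k (\<lambda>p z. solA (fst p) z)" "bounded_diff (param_strip L) k (\<lambda>p z. solB (fst p) z)"
    unfolding solA_def solB_def
    by (intro bounded_diff_mult bounded_diff_const const w half_order_shc half_order_chc; assumption)+
qed

lemma bounded_diff_R:
  assumes L: "L \<ge> 1"
  shows "bounded_diff (param_strip L) k R1" "bounded_diff (param_strip L) k R2"
proof -
  have "bounded_diff (param_strip L) k (\<lambda>p z. R1 p z)" "bounded_diff (param_strip L) k (\<lambda>p z. R2 p z)"
    unfolding R1_def R2_def by (intro bounded_diff_add bounded_diff_mult bounded_diff_const bounded_diff_sin_cos bounded_diff_sol L)+
  then show "bounded_diff (param_strip L) k R1" "bounded_diff (param_strip L) k R2"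
    by simp_all
qed

text \<open>For |y| \<le> \<pi> the numbers -\<alpha> y^2 stay in a compact interval to the right of
  -\<pi>^2, where the continuous function \<open>shc\<close> is positive and attains its
  minimum.\<close>

lemma shc_lower_bound:
  assumes L: "L \<ge> 1"
  obtains c where "c > 0" "\<And>\<alpha> y. - L < \<alpha> \<Longrightarrow> \<alpha> < 1 - 1 / L \<Longrightarrow> \<bar>y\<bar> \<le> pi \<Longrightarrow> Re (shc (of_real (- \<alpha> * y\<^sup>2))) \<ge> c"
proof -
  define I where "I = {- ((1 - 1 / L) * pi\<^sup>2)..L * pi\<^sup>2}"
  have L1: "0 \<le> 1 - 1 / L" "1 - 1 / L < 1"
    using L by (auto simp: divide_simps)
  have "continuous_on I (\<lambda>s. Re (shc (of_real s)))"
    by (intro continuous_intros continuous_on_compose2[OF holomorphic_on_imp_continuous_on[OF shc_holomorphic[of UNIV]]]) auto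
  moreover have "0 \<in> I"
    unfolding I_def using mult_nonneg_nonneg[OF L1(1) zero_le_power2[of pi]] L by auto
  then have "I \<noteq> {}"
    by blast
  moreover have "compact I"
    by (simp add: I_def)
  ultimately obtain s where s: "s \<in> I" "\<And>t. t \<in> I \<Longrightarrow> Re (shc (of_real s)) \<le> Re (shc (of_real t))"
    using continuous_attains_inf[of I "\<lambda>s. Re (shc (of_real s))"] by blast
  have "(1 - 1 / L) * pi\<^sup>2 < 1 * pi\<^sup>2"
    using L1 by (intro mult_strict_right_mono) auto
  moreover have "- ((1 - 1 / L) * pi\<^sup>2) \<le> s"
    using s(1) by (simp only: I_def atLeastAtMost_iff)
  ultimately have "s > - pi\<^sup>2"
    by linarith
  then have "Re (shc (of_real s)) > 0"
    by (rule Re_shc_pos)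
  moreover have "- \<alpha> * y\<^sup>2 \<in> I" if "- L < \<alpha>" "\<alpha> < 1 - 1 / L" "\<bar>y\<bar> \<le> pi" for \<alpha> y
  proof -
    have y: "0 \<le> y\<^sup>2" "y\<^sup>2 \<le> pi\<^sup>2"
      using that by (auto simp: abs_le_square_iff[symmetric])
    have "\<alpha> * y\<^sup>2 \<le> (1 - 1 / L) * pi\<^sup>2"
      using that y L1 by (intro mult_mono) auto
    moreover have "- \<alpha> * y\<^sup>2 \<le> L * pi\<^sup>2"
      using that y L by (intro mult_mono) auto
    ultimately show ?thesis
      by (simp add: I_def)
  qed
  ultimately show thesis
    using that s(2) by blast
qed

text \<open>The crux is 1 / R1. The imaginary part bounds |R2| |R1| from below by a constant over
  the weight; divided by the polynomial upper bound for |R2|, this bounds |1 / R1| by a constant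
  times one more power of the weight.\<close>

lemma bounded_diff_M:
  assumes L: "L \<ge> 1"
  shows "bounded_diff (param_strip L) k (\<lambda>p z. of_real (- 1 / (2 * pi\<^sup>2)) *
    ((inverse (shc (of_real (- pi\<^sup>2) * of_real (fst p))) * inverse (shc (of_real (- pi\<^sup>2) * of_real (fst p)))) *
      (R2 p z * inverse (R1 p z))))"
proof -
  obtain c where c: "c > 0" "\<And>\<alpha> y. - L < \<alpha> \<Longrightarrow> \<alpha> < 1 - 1 / L \<Longrightarrow> \<bar>y\<bar> \<le> pi \<Longrightarrow> Re (shc (of_real (- \<alpha> * y\<^sup>2))) \<ge> c"
    using shc_lower_bound[OF L] by blast
  \<comment> \<open>The choice y = \<pi> covers the factor Sinc(\<pi>^2 \<alpha>); the choice y = Im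
    w below covers the other one.\<close>
  have cp: "Re (shc (of_real (- pi\<^sup>2 * fst p))) \<ge> c" if "p \<in> param_strip L" for p
    using c(2)[of "fst p" pi] that by (simp add: param_strip_def mult.commute)
  have norm_shc: "norm (shc (of_real (- pi\<^sup>2) * of_real (fst p))) \<ge> c" if "p \<in> param_strip L" for p
    using cp[OF that] complex_Re_le_cmod[of "shc (of_real (- pi\<^sup>2 * fst p))"] by simp
  have inv_shc: "bounded_diff (param_strip L) k (\<lambda>p z. inverse (shc (of_real (- pi\<^sup>2) * of_real (fst p))))"
  proof (rule bounded_diff_inverse)
    show "bounded_diff (param_strip L) k (\<lambda>p z. shc (of_real (- pi\<^sup>2) * of_real (fst p)))"
      by (rule bounded_diff_half_order[OF L _ _ _ half_order_shc, of _ "pi\<^sup>2"]) (auto simp: distrib_left norm_power)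
    show "shc (of_real (- pi\<^sup>2) * of_real (fst p)) \<noteq> 0" if "p \<in> param_strip L" for p
      using norm_shc[OF that] c(1) by auto
    show "norm (inverse (shc (of_real (- pi\<^sup>2) * of_real (fst p)))) \<le> (1 / c) * hp_weight z ^ 0" if "p \<in> param_strip L" for p z
      unfolding norm_inverse using le_imp_inverse_le[OF norm_shc[OF that] c(1)]
      by (simp only: power_0 mult_1_right inverse_eq_divide)
  qed
  obtain N where N: "power_bounded N (param_strip L) R2"
    using bounded_diff_power_bounded[OF bounded_diff_R(2)[OF L]] by blast
  obtain C where C: "C \<ge> 0" "\<And>p z. p \<in> param_strip L \<Longrightarrow> Im z > 0 \<Longrightarrow> norm (R2 p z) \<le> C * hp_weight z ^ N"
    using N by (rule power_boundedE) blast
  have lower: "pi * c\<^sup>2 / hp_weight z \<le> norm (R2 p z) * norm (R1 p z)" if p: "p \<in> param_strip L" and z: "Im z > 0" for p z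
  proof -
    define y where "y = Im (log_neg z)"
    have nz: "norm z > 0"
      using z by auto
    have zp: "0 < Im z / norm z"
      using z nz by (rule divide_pos_pos)
    have y: "- pi < y" "y \<le> - (Im z / norm z)"
      using log_neg_half_plane[OF z] by (auto simp: y_def)
    then have y': "\<bar>y\<bar> \<le> pi" "Im z / norm z \<le> - y" "0 \<le> - y"
      using zp by auto
    have 1: "c \<le> Re (shc (of_real (- fst p * y\<^sup>2)))"
      using p y' by (intro c(2)) (auto simp: param_strip_def)
    have "1 / hp_weight z \<le> Im z / norm z"
    proof -
      have "norm z / Im z > 0"
        using nz z by (rule divide_pos_pos)
      then have "1 / hp_weight z \<le> 1 / (norm z / Im z)"
        using hp_weight_ge(5)[OF z] by (intro frac_le) auto
      then show ?thesis
        by simp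
    qed
    then have "(pi * c) * ((1 / hp_weight z) * c) \<le> (pi * Re (shc (of_real (- pi\<^sup>2 * fst p)))) * ((- y) * Re (shc (of_real (- fst p * y\<^sup>2))))"
      using c(1) cp[OF p] 1 y' hp_weight_ge(1)[OF z] by (intro mult_mono mult_nonneg_nonneg) auto
    also have "\<dots> = - Im (R2 p z * cnj (R1 p z))"
      unfolding Im_R2_R1 Im_solA_solB y_def by simp
    also have "\<dots> \<le> norm (R2 p z * cnj (R1 p z))"
      using abs_Im_le_cmod[of "R2 p z * cnj (R1 p z)"] by linarith
    finally show ?thesis
      by (simp add: norm_mult power2_eq_square)
  qed
  have inv_R1: "bounded_diff (param_strip L) k (\<lambda>p z. inverse (R1 p z))"
  proof (rule bounded_diff_inverse)
    show "bounded_diff (param_strip L) k R1"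
      by (rule bounded_diff_R[OF L])
    show nz: "R1 p z \<noteq> 0" if "p \<in> param_strip L" "Im z > 0" for p z
    proof
      assume "R1 p z = 0"
      moreover have "0 < pi * c\<^sup>2 / hp_weight z"
        using c(1) hp_weight_ge(1)[OF that(2)] by simp
      ultimately show False
        using lower[OF that] by simp
    qed
    show "norm (inverse (R1 p z)) \<le> (C / (pi * c\<^sup>2)) * hp_weight z ^ Suc N" if "p \<in> param_strip L" "Im z > 0" for p z
    proof -
      define r where "r = norm (R1 p z)"
      have r: "r > 0"
        using nz[OF that] by (simp add: r_def)
      have "pi * c\<^sup>2 / hp_weight z \<le> (C * hp_weight z ^ N) * r"
        using lower[OF that] mult_right_mono[OF C(2)[OF that], of r] by (simp add: r_def)
      then show ?thesis
        unfolding norm_inverse r_def[symmetric] using r c(1) hp_weight_ge(1)[OF that(2)]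
        by (simp add: field_simps)
    qed
  qed
  show ?thesis
    by (intro bounded_diff_mult bounded_diff_const inv_shc inv_R1) (rule bounded_diff_R(2)[OF L])
qed

text \<open>R2 / R1 = R2 cnj(R1) / |R1|^2 has negative imaginary part, and the factor -1 / (2
  \<pi>^2 \<sigma>^2) with \<sigma> = Sinc(\<pi>^2 \<alpha>) reverses the sign. The strict
  inequality also rules out zeros of R1.\<close>

lemma M_fun_holomorphic:
  assumes "\<alpha> < 1"
  shows "M_fun \<alpha> \<theta> holomorphic_on {z. Im z > 0}"
    and "Im z > 0 \<Longrightarrow> Im (M_fun \<alpha> \<theta> z) > 0"
proof -
  define \<sigma> where "\<sigma> = Re (shc (of_real (- pi\<^sup>2 * \<alpha>)))"
  have "pi\<^sup>2 * \<alpha> < pi\<^sup>2 * 1"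
    using assms by (rule mult_strict_left_mono) simp
  then have \<sigma>: "shc (of_real (- pi\<^sup>2) * of_real \<alpha>) = of_real \<sigma>" "\<sigma> > 0"
    unfolding \<sigma>_def using shc_of_real[of "- pi\<^sup>2 * \<alpha>"] Re_shc_pos[of "- pi\<^sup>2 * \<alpha>"] by simp_all
  have neg: "Im (R2 (\<alpha>, \<theta>) z * cnj (R1 (\<alpha>, \<theta>) z)) < 0" if z: "Im z > 0" for z
  proof -
    define y where "y = Im (log_neg z)"
    have "norm z > 0"
      using z by auto
    with z have "0 < Im z / norm z"
      by (rule divide_pos_pos)
    then have y: "- pi < y" "y < 0"
      using log_neg_half_plane(2,3)[OF z] by (auto simp: y_def)
    have y2: "0 < y\<^sup>2" "y\<^sup>2 < pi\<^sup>2"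
      using y power_strict_mono[of "- y" pi 2] by auto
    have "\<alpha> * y\<^sup>2 < pi\<^sup>2"
    proof -
      have "\<alpha> * y\<^sup>2 < 1 * y\<^sup>2"
        using assms y2(1) by (rule mult_strict_right_mono)
      then show ?thesis
        using y2(2) by linarith
    qed
    then have "Re (shc (of_real (- \<alpha> * y\<^sup>2))) > 0"
      by (intro Re_shc_pos) simp
    then have "pi * \<sigma> * (y * Re (shc (of_real (- \<alpha> * y\<^sup>2)))) < 0"
      using \<sigma>(2) y(2) by (intro mult_pos_neg mult_neg_pos mult_pos_pos) auto
    then show ?thesis
      unfolding Im_R2_R1 fst_conv Im_solA_solB \<sigma>_def y_def .
  qed
  have nz: "R1 (\<alpha>, \<theta>) z \<noteq> 0" if "Im z > 0" for z
    using neg[OF that] by auto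
  show "Im (M_fun \<alpha> \<theta> z) > 0" if z: "Im z > 0"
  proof -
    define r q where "r = R2 (\<alpha>, \<theta>) z" and "q = R1 (\<alpha>, \<theta>) z"
    have "r * inverse q = of_real (1 / (norm q)\<^sup>2) * (r * cnj q)"
      using nz[OF z] complex_norm_square[of q] by (simp add: q_def field_simps)
    then have "M_fun \<alpha> \<theta> z = of_real (- 1 / (2 * pi\<^sup>2) * (inverse \<sigma> * inverse \<sigma>) * (1 / (norm q)\<^sup>2)) * (r * cnj q)"
      unfolding M_fun_half_plane[OF z] \<sigma>(1) r_def[symmetric] q_def[symmetric]
      by (simp only: of_real_mult of_real_inverse mult.assoc)
    then have "Im (M_fun \<alpha> \<theta> z) = - 1 / (2 * pi\<^sup>2) * (inverse \<sigma> * inverse \<sigma>) * (1 / (norm q)\<^sup>2) * Im (r * cnj q)"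
    proof -
      have "Im (of_real a * b) = a * Im b" for a b
        by simp
      then show ?thesis
        by (simp only: \<open>M_fun \<alpha> \<theta> z = _\<close>)
    qed
    also have "\<dots> > 0"
      using neg[OF z] nz[OF z] \<sigma>(2) unfolding r_def[symmetric] q_def[symmetric]
      by (intro mult_neg_neg mult_neg_pos mult_pos_pos) (auto simp: divide_neg_pos)
    finally show ?thesis .
  qed
  have ln: "log_neg holomorphic_on {z. Im z > 0}"
    using log_neg_half_plane(5) unfolding holomorphic_on_def field_differentiable_def
    by (blast intro: has_field_derivative_at_within)
  have comp: "(\<lambda>z. f (g z)) holomorphic_on {z. Im z > 0}"
    if "f holomorphic_on UNIV" "g holomorphic_on {z. Im z > 0}" for f g :: "complex \<Rightarrow> complex"
    using holomorphic_on_compose_gen[OF that(2,1)] by (simp add: o_def)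
  have "solA \<alpha> holomorphic_on {z. Im z > 0}" "solB \<alpha> holomorphic_on {z. Im z > 0}"
    unfolding solA_def[abs_def] solB_def[abs_def]
    by (intro holomorphic_intros ln comp[OF shc_holomorphic] comp[OF chc_holomorphic]; simp)+
  then have "(\<lambda>z. R1 (\<alpha>, \<theta>) z) holomorphic_on {z. Im z > 0}" "(\<lambda>z. R2 (\<alpha>, \<theta>) z) holomorphic_on {z. Im z > 0}"
    unfolding R1_def R2_def fst_conv snd_conv by (intro holomorphic_intros; simp)+
  then have "(\<lambda>z. of_real (- 1 / (2 * pi\<^sup>2)) *
    ((inverse (shc (of_real (- pi\<^sup>2) * of_real \<alpha>)) * inverse (shc (of_real (- pi\<^sup>2) * of_real \<alpha>))) *
      (R2 (\<alpha>, \<theta>) z * inverse (R1 (\<alpha>, \<theta>) z)))) holomorphic_on {z. Im z > 0}"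
    using nz by (intro holomorphic_on_mult holomorphic_on_const holomorphic_on_inverse) auto
  then show "M_fun \<alpha> \<theta> holomorphic_on {z. Im z > 0}"
    by (rule holomorphic_transform) (use M_fun_half_plane in auto)
qed

section \<open>Spectral measures and the smoothness of their integrals\<close>

lemma spectral_measure_herglotz:
  assumes "\<alpha> < 1"
  shows "herglotz_measure (\<lambda>z. of_real pi * M_fun \<alpha> \<theta> z) (spectral_measure \<alpha> \<theta>)"
  unfolding spectral_measure_def
proof (rule theI')
  have "(\<lambda>z. of_real pi * M_fun \<alpha> \<theta> z) holomorphic_on {z. Im z > 0}"
    using M_fun_holomorphic(1)[OF assms] by (intro holomorphic_intros)
  moreover have "Im (of_real pi * M_fun \<alpha> \<theta> z) > 0" if "Im z > 0" for z
    using M_fun_holomorphic(2)[OF assms that] by simp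
  ultimately have "\<exists>\<nu>. herglotz_measure (\<lambda>z. of_real pi * M_fun \<alpha> \<theta> z) \<nu>"
    by (rule Herglotz_half_plane)
  then show "\<exists>!\<nu>. herglotz_measure (\<lambda>z. of_real pi * M_fun \<alpha> \<theta> z) \<nu>"
    using herglotz_measure_unique by blast
qed

text \<open>In one real variable the Frechet derivative in direction 1 is the vector derivative, so
  \<open>smooth_on\<close> passes to all iterated vector derivatives.\<close>

lemma schwartz_rapid_decay:
  assumes "\<phi> \<in> schwartz"
  shows "rapid_decay (\<lambda>n. ((\<lambda>f x. vector_derivative f (at x)) ^^ n) \<phi>)"
proof
  define ph where "ph n = ((\<lambda>f x. vector_derivative f (at x)) ^^ n) \<phi>" for n
  have "\<forall>k. C_k_on UNIV (ph n) k" for n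
  proof (induction n)
    case 0
    then show ?case
      using assms by (simp add: ph_def schwartz_def smooth_on_def)
  next
    case (Suc n)
    show ?case
    proof
      fix k
      have S: "C_k_on UNIV (ph n) (Suc k)"
        using Suc by blast
      have "frechet_derivative (ph n) (at x) 1 = ph (Suc n) x" for x
        using S frechet_derivative_eq_vector_derivative[of "ph n" x] by (simp add: ph_def)
      then show "C_k_on UNIV (ph (Suc n)) k"
        using S by (auto dest: spec[of _ 1])
    qed
  qed
  then have "ph n differentiable at x" for n x
    using C_k_on.simps(2)[of UNIV "ph n" 0] by blast
  then show "(((\<lambda>f x. vector_derivative f (at x)) ^^ k) \<phi> has_vector_derivative
      ((\<lambda>f x. vector_derivative f (at x)) ^^ Suc k) \<phi> x) (at x)" for k x
    unfolding ph_def by (simp add: vector_derivative_works)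
  show "\<exists>C. \<forall>x. norm (x ^ m *\<^sub>R ((\<lambda>f x. vector_derivative f (at x)) ^^ k) \<phi> x) \<le> C" for m k
    using assms unfolding schwartz_def bounded_iff by auto
qed

theorem theorem1p3:
  fixes \<phi> :: "real \<Rightarrow> complex"
  assumes "\<phi> \<in> schwartz"
  shows "smooth_on {(\<alpha>, \<theta>). \<alpha> < 1}
           (\<lambda>(\<alpha>, \<theta>). \<integral>E. \<phi> E \<partial>(spectral_measure \<alpha> \<theta>))"
proof -
  define ph where "ph n = ((\<lambda>f x. vector_derivative f (at x)) ^^ n) \<phi>" for n
  interpret rapid_decay ph
    unfolding ph_def[abs_def] using assms by (rule schwartz_rapid_decay)
  have ph0: "ph 0 = \<phi>"
    by (simp add: ph_def)
  define I where "I p = (\<integral>E. \<phi> E \<partial>(spectral_measure (fst p) (snd p)))" for p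
  have "C_k_on (param_strip L) I k" if L: "L \<ge> 1" for k L
  proof -
    define h where "h p z = of_real pi * (of_real (- 1 / (2 * pi\<^sup>2)) *
      ((inverse (shc (of_real (- pi\<^sup>2) * of_real (fst p))) * inverse (shc (of_real (- pi\<^sup>2) * of_real (fst p)))) *
      (R2 p z * inverse (R1 p z))))" for p z
    have "bounded_diff (param_strip L) k h"
      unfolding h_def by (intro bounded_diff_mult[OF bounded_diff_const bounded_diff_M[OF L]])
    then obtain N where N: "diff_upto N (param_strip L) k h"
      unfolding bounded_diff_def by blast
    obtain C where C: "\<And>p z. p \<in> param_strip L \<Longrightarrow> Im z > 0 \<Longrightarrow> norm (h p z) \<le> C * hp_weight z ^ N"
      using diff_upto_power_bounded[OF N] by (rule power_boundedE) blast
    \<comment> \<open>n \<ge> N makes the strip weight integrable, and n \<noteq> 0 is needed at its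
      endpoint. N depends on the order k and on the strip, so the representing formula varies with
      them while I does not.\<close>
    define n where "n = Suc N"
    \<comment> \<open>This is \<open>J i\<close> of \<open>boundary_taylor\<close>, written outside
      that locale so that the dependence on p is explicit.\<close>
    define H where "H i p z = complex_of_real (Im ((- \<i>) ^ i * h p z))" for i p z
    have H: "diff_upto N (param_strip L) k (H i)" for i
    proof -
      have "bounded_linear (\<lambda>u. complex_of_real (Im ((- \<i>) ^ i * u)))"
        by (intro bounded_linear_compose[OF bounded_linear_of_real]
            bounded_linear_compose[OF bounded_linear_Im] bounded_linear_mult_right)
      from diff_upto_linear[OF this N] show ?thesis
        unfolding H_def .
    qed
    define V where "V i p = (\<integral>x. ph i x * H i p (Complex x 1) \<partial>lborel)" for i p
    define W where "W p = (\<integral>\<omega>. strip_weight n (ph (Suc n)) \<omega> * H (Suc n) p (strip_point \<omega>) \<partial>(lborel \<Otimes>\<^sub>M lborel))" for p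
    have V: "C_k_on (param_strip L) (V i) k" for i
    proof -
      interpret weighted_param "param_strip L" lborel "ph i" "\<lambda>x. Complex x 1" N
        by unfold_locales
          (auto simp: open_param_strip convex_param_strip Complex_eq ph_integrable_hp_weight[of 1, unfolded Complex_eq of_real_1 mult_1_right])
      show ?thesis
        unfolding V_def[abs_def] by (rule C_k_on_integral[OF H])
    qed
    have W: "C_k_on (param_strip L) W k"
    proof -
      interpret weighted_param "param_strip L" "lborel \<Otimes>\<^sub>M lborel" "strip_weight n (ph (Suc n))" strip_point N
        by unfold_locales
          (auto simp: open_param_strip convex_param_strip Im_strip_point n_def intro!: strip_weight_integrable)
      show ?thesis
        unfolding W_def[abs_def] by (rule C_k_on_integral[OF H])
    qed
    have formula: "(1 / pi) *\<^sub>R (\<Sum>i<Suc n. ((- 1) ^ i / fact i) *\<^sub>R V i p) + ((1 / pi) * ((- 1) ^ Suc n / fact n)) *\<^sub>R W p = I p"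
      if p: "p \<in> param_strip L" for p
    proof -
      define F where "F z = of_real pi * M_fun (fst p) (snd p) z" for z
      have "0 \<le> 1 / L"
        using L by simp
      then have lt: "fst p < 1"
        using p unfolding param_strip_def mem_Collect_eq by linarith
      have F_h: "F z = h p z" if "Im z > 0" for z
        unfolding F_def h_def M_fun_half_plane[OF that] by simp
      interpret boundary_taylor ph F C N
      proof
        show "F holomorphic_on {z. Im z > 0}"
          unfolding F_def using M_fun_holomorphic(1)[OF lt] by (intro holomorphic_intros)
        show "norm (F z) \<le> C * hp_weight z ^ N" if "Im z > 0" for z
          using C[OF p that] F_h[OF that] by simp
      qed
      have J: "complex_of_real (J i z) = H i p z" if "Im z > 0" for i z
        unfolding J_def H_def F_h[OF that] ..
      have U_V: "U i 1 = V i p" for i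
        unfolding U_def V_def by (simp add: J)
      have strip: "(\<integral>\<omega>. strip_weight n (ph (Suc n)) \<omega> * of_real (J (Suc n) (strip_point \<omega>)) \<partial>(lborel \<Otimes>\<^sub>M lborel)) = W p"
        unfolding W_def by (simp add: J Im_strip_point)
      have "herglotz_measure F (spectral_measure (fst p) (snd p))"
        unfolding F_def[abs_def] by (rule spectral_measure_herglotz[OF lt])
      then have "of_real pi * I p = (\<Sum>i<Suc n. ((- 1) ^ i / fact i) *\<^sub>R V i p) + ((- 1) ^ Suc n / fact n) *\<^sub>R W p"
        unfolding I_def ph0[symmetric] U_V[symmetric] strip[symmetric] by (rule boundary_formula) (auto simp: n_def)
      then have "(1 / pi) *\<^sub>R (of_real pi * I p) = (1 / pi) *\<^sub>R ((\<Sum>i<Suc n. ((- 1) ^ i / fact i) *\<^sub>R V i p) + ((- 1) ^ Suc n / fact n) *\<^sub>R W p)"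
        by (rule arg_cong)
      moreover have "(1 / pi) *\<^sub>R (of_real pi * I p) = I p"
        by (simp add: scaleR_conv_of_real)
      ultimately show ?thesis
        by (simp only: scaleR_add_right scaleR_scaleR)
    qed
    show ?thesis
      by (rule C_k_on_cong[OF open_param_strip formula])
        (assumption, intro C_k_on_lincomb C_k_on_sum open_param_strip V W)
  qed
  then have "C_k_on (\<Union>n. param_strip (real (Suc n))) I k" for k
    by (intro C_k_on_UN open_param_strip) auto
  moreover have "open (\<Union>n. param_strip (real (Suc n)))"
    by (intro open_UN ballI open_param_strip)
  moreover have eq: "(\<lambda>(\<alpha>, \<theta>). \<integral>E. \<phi> E \<partial>(spectral_measure \<alpha> \<theta>)) = I"
    by (auto simp: I_def)
  ultimately show ?thesis
    unfolding smooth_on_def param_strip_UN eq by blast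
qed

end
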